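(* Let $k\in\mathbb{N}$, $F\in\mathcal{H}_k$ with $e(F)>0$, and let $\mathcal{R}$ be the $F$-removal rule. Then for every $\varepsilon>0$ there exists $T\ge0$ such that for every graphon $W$ we have $\|\Phi^TW-\mathrm{dest}(W)\|_1<\varepsilon$.
   Context: Let $(\Omega,\pi)$ be an atomless probability space with separable $\sigma$-algebra. A kernel is a bounded symmetric measurable $W:\Omega^2\to\mathbb{R}$ (up to a.e. equality); $\mathcal{W}$ is the Banach space of kernels with $\|\cdot\|_\infty$; graphons are kernels with values in $[0,1]$; $\|W\|_1=\int|W|\,d\pi^2$; $d_\square(U,W)=\sup_{S,T\subseteq\Omega}|\int_{S\times T}(U-W)\,d\pi^2|$. $\mathcal{H}_k$ is the set of graphs on $[k]$. A rule of order $k$ is a matrix $\mathcal{R}\in[0,1]^{\mathcal{H}_k\times\mathcal{H}_k}$ with row sums $1$. For a kernel $W$, $G\in\mathcal{H}_k$, distinct $a,b$, $x,y$: $t^{x,y}_{\mathrm{ind}}(G^{a,b},W)=\int\prod_{ij\in E(G)}W(x_i,x_j)\prod_{ij\notin E(G)}(1-W(x_i,x_j))\prod_{i\ne a,b}d\pi(x_i)$ with $x_a=x,x_b=y$. Velocity: $\mathfrak{V}_{\mathcal{R}}W(x,y)=\sum_{G,H}\sum_{a\ne b}\mathcal{R}_{G,H}t^{x,y}_{\mathrm{ind}}(G^{a,b},W)(\mathbb{1}[ab\in E(H)\setminus E(G)]-\mathbb{1}[ab\in E(G)\setminus E(H)])$. For a graphon $W$, the trajectory $t\mapsto\Phi^tW$,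 $t\ge0$, is the unique solution of $\frac{d}{dt}\Phi^tW=\mathfrak{V}_{\mathcal{R}}(\Phi^tW)$ in $(\mathcal{W},\|\cdot\|_\infty)$ with $\Phi^0W=W$; $\mathrm{dest}(W)$ is the graphon $S$ with $d_\square(\Phi^tW,S)\to0$ as $t\to\infty$ (it exists for removal rules). The $F$-removal rule: $\mathcal{R}_{H,H-F}=1$ for every $H\in\mathcal{H}_k$ containing $F$ as a labelled subgraph ($H-F$ is $H$ with the edges of $F$ deleted), $\mathcal{R}_{H,H}=1$ for every other $H$; all other entries $0$. *)

theory Defs
  imports "HOL-Probability.Probability"
begin

definition atomless :: "'a measure \<Rightarrow> bool" where
  "atomless M \<longleftrightarrow> (\<forall>A\<in>sets M. emeasure M A > 0 \<longrightarrow>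
     (\<exists>B\<in>sets M. B \<subseteq> A \<and> 0 < emeasure M B \<and> emeasure M B < emeasure M A))"

text \<open>Separability of the \<open>\<sigma>\<close>-algebra in the pseudometric \<open>(A, B) \<mapsto> \<pi>(A \<triangle> B)\<close>; every countably
  generated \<open>\<sigma>\<close>-algebra on a probability space satisfies this.\<close>

definition separable_sigma_algebra :: "'a measure \<Rightarrow> bool" where
  "separable_sigma_algebra M \<longleftrightarrow> (\<exists>D. countable D \<and> D \<subseteq> sets M \<and>
     (\<forall>A\<in>sets M. \<forall>e>0. \<exists>B\<in>D. measure M ((A - B) \<union> (B - A)) < e))"

text \<open>Elements of the Banach space of kernels are represented by functions that are bounded and
  symmetric everywhere on \<open>\<Omega>\<close>; equality almost everywhere is accounted for in the notions below.\<close>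

definition kernel :: "'a measure \<Rightarrow> ('a \<Rightarrow> 'a \<Rightarrow> real) \<Rightarrow> bool" where
  "kernel M W \<longleftrightarrow>
     (\<lambda>(x, y). W x y) \<in> borel_measurable (M \<Otimes>\<^sub>M M) \<and>
     (\<forall>x\<in>space M. \<forall>y\<in>space M. W x y = W y x) \<and>
     (\<exists>B. \<forall>x\<in>space M. \<forall>y\<in>space M. \<bar>W x y\<bar> \<le> B)"

definition graphon :: "'a measure \<Rightarrow> ('a \<Rightarrow> 'a \<Rightarrow> real) \<Rightarrow> bool" where
  "graphon M W \<longleftrightarrow> kernel M W \<and> (\<forall>x\<in>space M. \<forall>y\<in>space M. 0 \<le> W x y \<and> W x y \<le> 1)"

definition L1_norm :: "'a measure \<Rightarrow> ('a \<Rightarrow> 'a \<Rightarrow> real) \<Rightarrow> real" where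
  "L1_norm M W = (LINT z|(M \<Otimes>\<^sub>M M). \<bar>W (fst z) (snd z)\<bar>)"

definition Linf_norm :: "'a measure \<Rightarrow> ('a \<Rightarrow> 'a \<Rightarrow> real) \<Rightarrow> ereal" where
  "Linf_norm M W = esssup (M \<Otimes>\<^sub>M M) (\<lambda>(x, y). ereal \<bar>W x y\<bar>)"

definition cut_dist :: "'a measure \<Rightarrow> ('a \<Rightarrow> 'a \<Rightarrow> real) \<Rightarrow> ('a \<Rightarrow> 'a \<Rightarrow> real) \<Rightarrow> real" where
  "cut_dist M U W =
     (SUP (S, T) \<in> sets M \<times> sets M.
        \<bar>LINT z:(S \<times> T)|(M \<Otimes>\<^sub>M M). U (fst z) (snd z) - W (fst z) (snd z)\<bar>)"

text \<open>A graph on \<open>[k]\<close> is identified with its edge set, a set of two-element subsets of \<open>{1..k}\<close>.\<close>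

definition graphs :: "nat \<Rightarrow> nat set set set" where
  "graphs k = Pow {e. e \<subseteq> {1..k} \<and> card e = 2}"

definition is_rule :: "nat \<Rightarrow> (nat set set \<Rightarrow> nat set set \<Rightarrow> real) \<Rightarrow> bool" where
  "is_rule k R \<longleftrightarrow>
     (\<forall>G\<in>graphs k. \<forall>H\<in>graphs k. 0 \<le> R G H \<and> R G H \<le> 1) \<and>
     (\<forall>G\<in>graphs k. (\<Sum>H\<in>graphs k. R G H) = 1)"

definition removal_rule :: "nat set set \<Rightarrow> nat set set \<Rightarrow> nat set set \<Rightarrow> real" where
  "removal_rule F G H =
     (if F \<subseteq> G then (if H = G - F then 1 else 0) else (if H = G then 1 else 0))"

definition ind_weight ::
    "nat \<Rightarrow> nat set set \<Rightarrow> ('a \<Rightarrow> 'a \<Rightarrow> real) \<Rightarrow> (nat \<Rightarrow> 'a) \<Rightarrow> real" where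
  "ind_weight k G W v =
     (\<Prod>(i, j) | i \<in> {1..k} \<and> j \<in> {1..k} \<and> i < j \<and> {i, j} \<in> G. W (v i) (v j)) *
     (\<Prod>(i, j) | i \<in> {1..k} \<and> j \<in> {1..k} \<and> i < j \<and> {i, j} \<notin> G. 1 - W (v i) (v j))"

definition t_ind ::
    "'a measure \<Rightarrow> nat \<Rightarrow> nat set set \<Rightarrow> nat \<Rightarrow> nat \<Rightarrow> ('a \<Rightarrow> 'a \<Rightarrow> real) \<Rightarrow> 'a \<Rightarrow> 'a \<Rightarrow> real" where
  "t_ind M k G a b W x y =
     (LINT v|(\<Pi>\<^sub>M i\<in>{1..k} - {a, b}. M). ind_weight k G W (v(a := x, b := y)))"

definition velocity ::
    "'a measure \<Rightarrow> nat \<Rightarrow> (nat set set \<Rightarrow> nat set set \<Rightarrow> real) \<Rightarrow>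
     ('a \<Rightarrow> 'a \<Rightarrow> real) \<Rightarrow> 'a \<Rightarrow> 'a \<Rightarrow> real" where
  "velocity M k R W x y =
     (\<Sum>G\<in>graphs k. \<Sum>H\<in>graphs k. \<Sum>a\<in>{1..k}. \<Sum>b\<in>{1..k} - {a}.
        R G H * t_ind M k G a b W x y *
        (of_bool ({a, b} \<in> H - G) - of_bool ({a, b} \<in> G - H)))"

text \<open>\<open>U\<close> solves the differential equation on \<open>[0, \<infinity>)\<close> with initial value \<open>W\<close>; the time derivative
  is the limit of difference quotients in the norm of \<open>L\<^sup>\<infinity>\<close> (one-sided at time \<open>0\<close>).\<close>

definition is_trajectory ::
    "'a measure \<Rightarrow> nat \<Rightarrow> (nat set set \<Rightarrow> nat set set \<Rightarrow> real) \<Rightarrow>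
     ('a \<Rightarrow> 'a \<Rightarrow> real) \<Rightarrow> (real \<Rightarrow> 'a \<Rightarrow> 'a \<Rightarrow> real) \<Rightarrow> bool" where
  "is_trajectory M k R W U \<longleftrightarrow>
     (\<forall>t\<ge>0. kernel M (U t)) \<and>
     (AE (x, y) in M \<Otimes>\<^sub>M M. U 0 x y = W x y) \<and>
     (\<forall>t\<ge>0. ((\<lambda>s. Linf_norm M
         (\<lambda>x y. (U s x y - U t x y) / (s - t) - velocity M k R (U t) x y)) \<longlongrightarrow> 0)
         (at t within {0..}))"

text \<open>Trajectories and destinations are unique only up to equality almost everywhere, so a
  representative is chosen (\<open>THE\<close> would be unspecified here).\<close>

definition flow ::
    "'a measure \<Rightarrow> nat \<Rightarrow> (nat set set \<Rightarrow> nat set set \<Rightarrow> real) \<Rightarrow>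
     real \<Rightarrow> ('a \<Rightarrow> 'a \<Rightarrow> real) \<Rightarrow> 'a \<Rightarrow> 'a \<Rightarrow> real" where
  "flow M k R t W = (SOME U. is_trajectory M k R W U) t"

definition dest ::
    "'a measure \<Rightarrow> nat \<Rightarrow> (nat set set \<Rightarrow> nat set set \<Rightarrow> real) \<Rightarrow>
     ('a \<Rightarrow> 'a \<Rightarrow> real) \<Rightarrow> 'a \<Rightarrow> 'a \<Rightarrow> real" where
  "dest M k R W =
     (SOME S. graphon M S \<and> ((\<lambda>t. cut_dist M (flow M k R t W) S) \<longlongrightarrow> 0) at_top)"

lemma finite_graphs: "finite (graphs k)"
  unfolding graphs_def by (rule finite_Pow_iff[THEN iffD2], rule finite_subset[of _ "Pow {1..k}"]) auto

lemma removal_rule_is_rule: "is_rule k (removal_rule F)"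
proof -
  have "(\<Sum>H\<in>graphs k. removal_rule F G H) = 1" if "G \<in> graphs k" for G
  proof -
    have "G - F \<in> graphs k" using that by (auto simp: graphs_def)
    then show ?thesis using that
      by (cases "F \<subseteq> G") (simp_all add: removal_rule_def finite_graphs)
  qed
  then show ?thesis by (auto simp: is_rule_def removal_rule_def)
qed

end

theory Submission
  imports Defs
begin

text \<open>
  Summing the induced densities over all graphs containing \<open>F\<close> shows that the velocity of the removal
  rule at \<open>(x, y)\<close> is minus the density of copies of \<open>F\<close> through \<open>(x, y)\<close>. Hence the trajectory
  decreases pointwise and its destination is the pointwise limit. Since the total mass decreases at a
  rate proportional to the density of \<open>F\<close>, which is itself decreasing, that density is \<open>O(1/T)\<close> at time
  \<open>T\<close>, uniformly in the initial graphon. By the removal lemma (for graphons, via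
  Szemeredi's regularity lemma) the kernel at time \<open>T\<close> becomes free of \<open>F\<close> after restriction to a set \<open>A\<close>
  whose complement carries little mass. Every copy removed later then uses an edge outside \<open>A\<close>, so
  the total later loss is at most a constant times the loss outside \<open>A\<close>, which is small.
\<close>

section \<open>Integration over powers of a probability space\<close>

text \<open>\<open>flow\<close> and \<open>dest\<close> are arbitrary choices among functions
  determined only almost everywhere, so existence and uniqueness have to be proved. Uniqueness faces
  a competitor of which little is known: \<open>is_trajectory\<close> demands neither values in
  \<open>[0, 1]\<close>, nor measurability in time, nor a common bound for different times. For
  existence a path is built that behaves well at every point: decreasing, with values in
  \<open>[0, 1]\<close>, and with increments of error at most \<open>C * (s - t)\<^sup>2\<close>.
  This one estimate gives the derivative in the supremum norm and the derivative of every weighted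
  mass.

  Monotonicity turns the L1 distance to the destination into a difference of masses, so only the
  loss after time \<open>T\<close> has to be bounded. The removal lemma alone does not bound it: it
  says that little mass could be removed to destroy all copies, while the flow removes mass from all
  edges of a copy. But it does so at the same rate on each of them, so the loss at the edges inside
  \<open>A\<close> is dominated by the loss at those outside.\<close>

lemma integrable_bounded:
  fixes f :: "'b \<Rightarrow> real"
  assumes "prob_space N" "f \<in> borel_measurable N" "\<And>x. x \<in> space N \<Longrightarrow> \<bar>f x\<bar> \<le> B"
  shows "integrable N f"
proof -
  interpret N: prob_space N by fact
  show ?thesis using assms by (intro N.integrable_const_bound[of _ B]) auto
qed

lemma measurable_upd2_PiM:
  assumes "a \<in> I" "b \<in> I" "a \<noteq> b"
  shows "(\<lambda>(z, v). v(a := fst z, b := snd z)) \<in>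
    (M \<Otimes>\<^sub>M M) \<Otimes>\<^sub>M PiM (I - {a, b}) (\<lambda>_. M) \<rightarrow>\<^sub>M PiM I (\<lambda>_. M)"
proof (rule measurable_PiM_single')
  fix i assume i: "i \<in> I"
  have eq: "(\<lambda>x. (case x of (z, v) \<Rightarrow> v(a := fst z, b := snd z)) i) =
    (if i = b then (\<lambda>x. snd (fst x)) else if i = a then (\<lambda>x. fst (fst x)) else (\<lambda>x. snd x i))"
    by (auto simp: fun_eq_iff)
  consider "i = b" | "i \<noteq> b" "i = a" | "i \<in> I - {a, b}" using i by auto
  then show "(\<lambda>x. (case x of (z, v) \<Rightarrow> v(a := fst z, b := snd z)) i) \<in>
      (M \<Otimes>\<^sub>M M) \<Otimes>\<^sub>M PiM (I - {a, b}) (\<lambda>_. M) \<rightarrow>\<^sub>M M"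
    unfolding eq by cases (auto intro!: measurable_compose[OF measurable_snd measurable_component_singleton])
next
  show "(\<lambda>(z, v). v(a := fst z, b := snd z)) \<in>
     space ((M \<Otimes>\<^sub>M M) \<Otimes>\<^sub>M PiM (I - {a, b}) (\<lambda>_. M)) \<rightarrow> I \<rightarrow>\<^sub>E space M"
    using assms by (auto simp: space_pair_measure space_PiM PiE_def Pi_iff extensional_def)
qed

lemma measurable_pair_component:
  assumes "a \<in> I" "b \<in> I"
  shows "(\<lambda>v. (v a, v b)) \<in> PiM I (\<lambda>_. M) \<rightarrow>\<^sub>M M \<Otimes>\<^sub>M M"
  using assms by (intro measurable_Pair measurable_component_singleton)

context prob_space
begin

abbreviation M2 :: "('a \<times> 'a) measure" where
  "M2 \<equiv> M \<Otimes>\<^sub>M M"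

abbreviation Mpow :: "'i set \<Rightarrow> ('i \<Rightarrow> 'a) measure" where
  "Mpow I \<equiv> PiM I (\<lambda>_. M)"

lemma prob_space_pair: "prob_space M2"
proof -
  interpret pair_prob_space M M ..
  show ?thesis by (rule P.prob_space_axioms)
qed

lemma prob_space_power: "prob_space (Mpow I)"
  by (intro prob_space_PiM prob_space_axioms)

text \<open>Filling in two coordinates independently gives the product measure again, because both
  measures agree on boxes. This links \<open>t_ind\<close>, which integrates over all vertices
  except two, with integrals over all vertices.\<close>

lemma distr_upd2_PiM:
  fixes I :: "'i set"
  assumes I: "finite I" "a \<in> I" "b \<in> I" "a \<noteq> b"
  shows "distr (M2 \<Otimes>\<^sub>M Mpow (I - {a, b})) (Mpow I)
           (\<lambda>(z, v). v(a := fst z, b := snd z)) = Mpow I"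
    (is "distr ?N _ ?h = _")
proof -
  interpret P: product_sigma_finite "\<lambda>_::'i. M" by unfold_locales
  interpret MM: pair_prob_space M M ..
  interpret J: prob_space "Mpow (I - {a, b})" by (rule prob_space_power)
  interpret MJ: pair_prob_space M2 "Mpow (I - {a, b})" ..
  show ?thesis
  proof (rule P.PiM_eqI)
    fix A :: "'i \<Rightarrow> 'a set" assume A: "\<And>i. i \<in> I \<Longrightarrow> A i \<in> sets M"
    have "emeasure (distr ?N (Mpow I) ?h) (Pi\<^sub>E I A) = emeasure ?N (?h -` Pi\<^sub>E I A \<inter> space ?N)"
      using A I by (intro emeasure_distr measurable_upd2_PiM sets_PiM_I_finite) auto
    also have "?h -` Pi\<^sub>E I A \<inter> space ?N = (A a \<times> A b) \<times> Pi\<^sub>E (I - {a, b}) A"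
    proof -
      have s: "\<And>i x. i \<in> I \<Longrightarrow> x \<in> A i \<Longrightarrow> x \<in> space M" using A sets.sets_into_space by blast
      then show ?thesis using I
        by (fastforce simp: space_pair_measure space_PiM PiE_def Pi_iff extensional_def split: if_split_asm)
    qed
    also have "emeasure ?N \<dots> = emeasure M2 (A a \<times> A b) *
        emeasure (Mpow (I - {a, b})) (Pi\<^sub>E (I - {a, b}) A)"
      using A I by (intro J.emeasure_pair_measure_Times) (auto intro!: sets_PiM_I_finite)
    also have "\<dots> = (emeasure M (A a) * emeasure M (A b)) * (\<Prod>i\<in>I - {a, b}. emeasure M (A i))"
      using A I by (subst emeasure_pair_measure_Times, simp, simp, subst P.emeasure_PiM) auto
    also have "\<dots> = (\<Prod>i\<in>I. emeasure M (A i))"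
    proof -
      have e: "I = insert a (insert b (I - {a, b}))" using I by auto
      show ?thesis using I by (subst (2) e) (simp add: mult.assoc)
    qed
    finally show "emeasure (distr ?N (Mpow I) ?h) (Pi\<^sub>E I A) = (\<Prod>i\<in>I. emeasure M (A i))" .
  qed (use I in auto)
qed

text \<open>Fubini in both orders. With the pair outside, a rate integrates to a density of copies;
  with the pair inside, all other vertices are frozen, as the counting lemma requires.\<close>

lemma integral_PiM_pair:
  fixes f :: "('i \<Rightarrow> 'a) \<Rightarrow> real"
  assumes I: "finite I" "a \<in> I" "b \<in> I" "a \<noteq> b"
    and f: "integrable (Mpow I) f"
  shows "(\<integral>v. f v \<partial>Mpow I) =
      (\<integral>z. (\<integral>v. f (v(a := fst z, b := snd z)) \<partial>Mpow (I - {a, b})) \<partial>M2)" (is ?th1)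
    and "(\<integral>v. f v \<partial>Mpow I) =
      (\<integral>v. (\<integral>z. f (v(a := fst z, b := snd z)) \<partial>M2) \<partial>Mpow (I - {a, b}))" (is ?th2)
    and "integrable M2
      (\<lambda>z. \<integral>v. f (v(a := fst z, b := snd z)) \<partial>Mpow (I - {a, b}))" (is ?th3)
    and "integrable (Mpow (I - {a, b}))
      (\<lambda>v. \<integral>z. f (v(a := fst z, b := snd z)) \<partial>M2)" (is ?th4)
proof -
  interpret MM: pair_prob_space M M ..
  interpret J: prob_space "Mpow (I - {a, b})" by (rule prob_space_power)
  interpret MJ: pair_prob_space M2 "Mpow (I - {a, b})" ..
  note h = measurable_upd2_PiM[OF I(2-4), of M]
  note d = distr_upd2_PiM[OF I]
  have eq: "(\<integral>v. f v \<partial>Mpow I) =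
     (\<integral>(z,v). f (v(a := fst z, b := snd z)) \<partial>(M2 \<Otimes>\<^sub>M Mpow (I - {a, b})))"
    by (subst d[symmetric], subst integral_distr[OF h]) (use f in \<open>auto simp: split_beta'\<close>)
  have int: "integrable (M2 \<Otimes>\<^sub>M Mpow (I - {a, b}))
      (\<lambda>(z,v). f (v(a := fst z, b := snd z)))"
    using f by (subst (asm) d[symmetric], subst (asm) integrable_distr_eq[OF h])
      (auto simp: split_beta')
  show ?th1 unfolding eq by (rule MJ.integral_fst[OF int, symmetric])
  show ?th2 unfolding eq by (rule MJ.integral_snd[OF int, symmetric])
  show ?th3 by (rule MJ.integrable_fst[OF int])
  show ?th4 by (rule MJ.integrable_snd[OF int])
qed

lemma distr_pair_component:
  fixes I :: "'i set"
  assumes I: "finite I" "a \<in> I" "b \<in> I" "a \<noteq> b"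
  shows "distr (Mpow I) M2 (\<lambda>v. (v a, v b)) = M2"
proof -
  interpret MM: prob_space M2 by (rule prob_space_pair)
  interpret J: prob_space "Mpow (I - {a, b})" by (rule prob_space_power)
  interpret MJ: pair_prob_space M2 "Mpow (I - {a, b})" ..
  have "distr (Mpow I) M2 (\<lambda>v. (v a, v b)) =
      distr (M2 \<Otimes>\<^sub>M Mpow (I - {a, b})) M2
        ((\<lambda>v. (v a, v b)) \<circ> (\<lambda>(z, v). v(a := fst z, b := snd z)))"
    by (subst distr_upd2_PiM[OF I, symmetric], rule distr_distr)
      (use I measurable_pair_component measurable_upd2_PiM in auto)
  also have "((\<lambda>v. (v a, v b)) \<circ> (\<lambda>(z, v). v(a := fst z, b := snd z))) = (fst :: _ \<Rightarrow> 'a \<times> 'a)"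
    using I by (auto simp: fun_eq_iff)
  also have "distr (M2 \<Otimes>\<^sub>M Mpow (I - {a, b})) M2 fst = M2"
    by (rule J.distr_pair_fst)
  finally show ?thesis .
qed

lemma integral_pair_component:
  fixes g :: "'a \<times> 'a \<Rightarrow> real"
  assumes I: "finite I" "a \<in> I" "b \<in> I" "a \<noteq> b" and [measurable]: "g \<in> borel_measurable M2"
  shows "(\<integral>v. g (v a, v b) \<partial>Mpow I) = (\<integral>z. g z \<partial>M2)"
  by (subst distr_pair_component[OF I, symmetric], subst integral_distr)
    (use I measurable_pair_component in auto)

text \<open>Two distinct vertices of a random copy have the joint law \<open>M2\<close>.
  Distinctness matters, since \<open>P\<close> may fail on the diagonal if that is a null
  set.\<close>

lemma AE_pair_component:
  assumes I: "finite I" "a \<in> I" "b \<in> I" "a \<noteq> b" and "AE z in M2. P z"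
  shows "AE v in Mpow I. P (v a, v b)"
  by (rule AE_distrD[OF measurable_pair_component[of a I b]])
    (use assms(2-5) in \<open>simp_all only: distr_pair_component[OF I]\<close>)

end

text \<open>Its integral over \<open>Mpow I\<close> is the homomorphism density. The edges are
  ordered pairs, one for each edge of the graph: with both orientations in \<open>E\<close>, each
  factor of a symmetric kernel would occur twice.\<close>

definition hom_weight :: "('i \<times> 'i) set \<Rightarrow> ('a \<Rightarrow> 'a \<Rightarrow> real) \<Rightarrow> ('i \<Rightarrow> 'a) \<Rightarrow> real" where
  "hom_weight E W v = (\<Prod>(i, j)\<in>E. W (v i) (v j))"

lemma hom_weight_measurable:
  assumes "(\<lambda>(x, y). W x y) \<in> borel_measurable (M \<Otimes>\<^sub>M M)" "E \<subseteq> I \<times> I"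
  shows "hom_weight E W \<in> borel_measurable (PiM I (\<lambda>_. M))"
proof -
  have "(\<lambda>v. W (v i) (v j)) \<in> borel_measurable (PiM I (\<lambda>_. M))" if "(i, j) \<in> E" for i j
    using measurable_compose[OF measurable_pair_component assms(1), of i I j]
      that assms(2) by auto
  then show ?thesis unfolding hom_weight_def[abs_def] by (intro borel_measurable_prod) auto
qed

lemma hom_weight_unit:
  assumes "\<And>i j. (i, j) \<in> E \<Longrightarrow> 0 \<le> W (v i) (v j) \<and> W (v i) (v j) \<le> 1"
  shows "0 \<le> hom_weight E W v" "hom_weight E W v \<le> 1"
  using assms unfolding hom_weight_def by (auto intro!: prod_nonneg prod_le_1)

section \<open>Regularity of graphons\<close>

text \<open>Every set appends one binary digit to the label, so the new label encodes the old one
  together with all memberships. Its level sets form the common refinement.\<close>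

fun refine :: "('a \<Rightarrow> nat) \<Rightarrow> 'a set list \<Rightarrow> 'a \<Rightarrow> nat" where
  "refine p [] = p"
| "refine p (S # Ss) = (\<lambda>x. 2 * refine p Ss x + of_bool (x \<in> S))"

text \<open>Deleting the appended digits recovers the old label, which exhibits \<open>p\<close> as
  a function of its refinement.\<close>

lemma refine_div: "refine p Ss x div 2 ^ length Ss = p x"
proof (induction Ss)
  case (Cons S Ss)
  have "refine p (S # Ss) x div 2 ^ length (S # Ss) = (refine p (S # Ss) x div 2) div 2 ^ length Ss"
    by (simp only: div_mult2_eq power_Suc length_Cons)
  also have "refine p (S # Ss) x div 2 = refine p Ss x" by simp
  finally show ?case using Cons by simp
qed simp

text \<open>Membership is one digit of the label. The indicator of such a set is therefore a
  function of the refined label, to which \<open>step_projection\<close> applies.\<close>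

lemma refine_determines_mem:
  "S \<in> set Ss \<Longrightarrow> \<exists>D. \<forall>x. x \<in> S \<longleftrightarrow> D (refine p Ss x)"
proof (induction Ss)
  case (Cons A Ss)
  show ?case
  proof (cases "S = A")
    case True
    then show ?thesis by (intro exI[of _ odd]) auto
  next
    case False
    then obtain D where D: "\<forall>x. x \<in> S \<longleftrightarrow> D (refine p Ss x)" using Cons by auto
    have "refine p (A # Ss) x div 2 = refine p Ss x" for x by simp
    then show ?thesis using D by (intro exI[of _ "\<lambda>n. D (n div 2)"]) simp
  qed
qed simp

text \<open>A labelling with \<open>m\<close> labels has at most \<open>m * m\<close> irregular
  pairs, each with two witness sets, and every set doubles the number of labels.\<close>

fun tower :: "nat \<Rightarrow> nat" where
  "tower 0 = 1"
| "tower (Suc n) = tower n * 2 ^ (2 * tower n * tower n)"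

context prob_space
begin

definition labelling :: "('a \<Rightarrow> nat) \<Rightarrow> nat \<Rightarrow> bool" where
  "labelling p m \<longleftrightarrow> p \<in> M \<rightarrow>\<^sub>M count_space UNIV \<and> (\<forall>x\<in>space M. p x < m)"

definition cell :: "('a \<Rightarrow> nat) \<Rightarrow> nat \<Rightarrow> 'a set" where
  "cell p i = {x \<in> space M. p x = i}"

text \<open>Division by zero gives density 0 if a cell is null. For bounded \<open>g\<close> the
  numerator vanishes there as well, so multiplying back by the measures is correct for all
  cells.\<close>

definition cell_density :: "('a \<times> 'a \<Rightarrow> real) \<Rightarrow> ('a \<Rightarrow> nat) \<Rightarrow> nat \<Rightarrow> nat \<Rightarrow> real" where
  "cell_density g p i j = (\<integral>z. g z * indicator (cell p i \<times> cell p j) z \<partial>M2) /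
     (prob (cell p i) * prob (cell p j))"

text \<open>The conditional expectation of \<open>g\<close> given the two labels;
  \<open>energy\<close> is its squared norm in L2.\<close>

definition step :: "('a \<times> 'a \<Rightarrow> real) \<Rightarrow> ('a \<Rightarrow> nat) \<Rightarrow> 'a \<times> 'a \<Rightarrow> real" where
  "step g p z = cell_density g p (p (fst z)) (p (snd z))"

definition energy :: "('a \<times> 'a \<Rightarrow> real) \<Rightarrow> ('a \<Rightarrow> nat) \<Rightarrow> real" where
  "energy g p = (\<integral>z. (step g p z)\<^sup>2 \<partial>M2)"

text \<open>The deviation is compared with the mass of the entire pair of cells. This replaces a
  lower bound on the size of \<open>S\<close> and \<open>T\<close>: a small rectangle cannot deviate
  that much.\<close>

definition irregular :: "('a \<times> 'a \<Rightarrow> real) \<Rightarrow> ('a \<Rightarrow> nat) \<Rightarrow> real \<Rightarrow> nat \<Rightarrow> nat \<Rightarrow> bool" where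
  "irregular g p \<eta> i j \<longleftrightarrow> (\<exists>S\<in>sets M. \<exists>T\<in>sets M. S \<subseteq> cell p i \<and> T \<subseteq> cell p j \<and>
     \<eta> * (prob (cell p i) * prob (cell p j)) <
       \<bar>\<integral>z. (g z - cell_density g p i j) * indicator (S \<times> T) z \<partial>M2\<bar>)"

text \<open>Pairs are weighted by their measure and not counted, since the cells may have different
  sizes.\<close>

definition irregular_mass :: "('a \<times> 'a \<Rightarrow> real) \<Rightarrow> ('a \<Rightarrow> nat) \<Rightarrow> nat \<Rightarrow> real \<Rightarrow> real" where
  "irregular_mass g p m \<eta> = (\<Sum>(i, j)\<in>{(i, j). i < m \<and> j < m \<and> irregular g p \<eta> i j}.
     prob (cell p i) * prob (cell p j))"

lemma labelling_measurable: "labelling p m \<Longrightarrow> p \<in> M \<rightarrow>\<^sub>M count_space UNIV"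
  by (simp add: labelling_def)

lemma cell_sets: "labelling p m \<Longrightarrow> cell p i \<in> sets M"
  unfolding cell_def by (drule labelling_measurable) measurable

lemma labelling_refine:
  assumes "labelling p m" "set Ss \<subseteq> sets M"
  shows "labelling (refine p Ss) (m * 2 ^ length Ss)"
  using assms(2)
proof (induction Ss)
  case (Cons S Ss)
  then have IH: "refine p Ss \<in> M \<rightarrow>\<^sub>M count_space UNIV" "\<forall>x\<in>space M. refine p Ss x < m * 2 ^ length Ss"
    and [measurable]: "S \<in> sets M" by (auto simp: labelling_def)
  note [measurable] = IH(1)
  have "refine p (S # Ss) = (\<lambda>x. if x \<in> S then Suc (2 * refine p Ss x) else 2 * refine p Ss x)"
    by auto
  moreover have "\<dots> \<in> M \<rightarrow>\<^sub>M count_space UNIV" by measurable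
  moreover have "refine p (S # Ss) x < m * 2 ^ length (S # Ss)" if "x \<in> space M" for x
    using IH(2)[rule_format, OF that] by simp
  ultimately show ?case unfolding labelling_def by simp
qed (use assms in simp)

lemma measurable_labels:
  fixes h :: "nat \<Rightarrow> nat \<Rightarrow> real"
  assumes "labelling p m"
  shows "(\<lambda>z. h (p (fst z)) (p (snd z))) \<in> borel_measurable M2"
proof -
  note [measurable] = labelling_measurable[OF assms]
  show ?thesis
    by (rule measurable_compose_countable[where g="\<lambda>z. p (fst z)"],
        rule measurable_compose_countable[where g="\<lambda>z. p (snd z)"]) measurable
qed

lemma labels_bounded:
  fixes h :: "nat \<Rightarrow> nat \<Rightarrow> real"
  assumes "labelling p m"
  shows "\<exists>B. \<forall>z\<in>space M2. \<bar>h (p (fst z)) (p (snd z))\<bar> \<le> B"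
proof -
  let ?X = "(\<lambda>(i, j). \<bar>h i j\<bar>) ` ({..<m} \<times> {..<m})"
  have "\<bar>h (p (fst z)) (p (snd z))\<bar> \<le> Max ?X" if "z \<in> space M2" for z
    using that assms by (intro Max_ge) (auto simp: labelling_def space_pair_measure)
  then show ?thesis by blast
qed

lemma sum_cells:
  fixes f :: "'a \<times> 'a \<Rightarrow> real"
  assumes p: "labelling p m" and z: "z \<in> space M2"
  shows "(\<Sum>(i, j)\<in>{..<m} \<times> {..<m}. f z * indicator (cell p i \<times> cell p j) z) = f z"
proof -
  let ?c = "(p (fst z), p (snd z))"
  have c: "?c \<in> {..<m} \<times> {..<m}" using p z by (auto simp: labelling_def space_pair_measure)
  have "(\<Sum>(i, j)\<in>{..<m} \<times> {..<m}. f z * indicator (cell p i \<times> cell p j) z) =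
    (\<Sum>c\<in>{..<m} \<times> {..<m}. if c = ?c then f z else 0)"
    using z by (intro sum.cong) (auto simp: cell_def space_pair_measure indicator_def)
  also have "\<dots> = f z" using c by simp
  finally show ?thesis .
qed

lemma integral_sum_cells:
  fixes f :: "'a \<times> 'a \<Rightarrow> real"
  assumes p: "labelling p m" and f: "integrable M2 f"
  shows "(\<integral>z. f z \<partial>M2) =
    (\<Sum>(i, j)\<in>{..<m} \<times> {..<m}. \<integral>z. f z * indicator (cell p i \<times> cell p j) z \<partial>M2)"
proof -
  have "(\<integral>z. f z \<partial>M2) =
    (\<integral>z. (\<Sum>c\<in>{..<m} \<times> {..<m}. f z * indicator (cell p (fst c) \<times> cell p (snd c)) z) \<partial>M2)"
    using sum_cells[OF p, of _ f] by (intro Bochner_Integration.integral_cong) (simp_all add: split_beta')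
  also have "\<dots> = (\<Sum>c\<in>{..<m} \<times> {..<m}. \<integral>z. f z * indicator (cell p (fst c) \<times> cell p (snd c)) z \<partial>M2)"
    using f cell_sets[OF p] by (intro Bochner_Integration.integral_sum integrable_real_mult_indicator) auto
  finally show ?thesis by (simp add: split_beta')
qed

lemma measure_rect:
  assumes "A \<in> sets M" "B \<in> sets M"
  shows "measure M2 (A \<times> B) = prob A * prob B"
  using assms by (simp add: measure_def emeasure_pair_measure_Times enn2real_mult)

lemma integral_rect:
  assumes "A \<in> sets M" "B \<in> sets M"
  shows "(\<integral>z. indicator (A \<times> B) z \<partial>M2) = prob A * prob B"
  using measure_rect[OF assms] assms sets.sets_into_space[of "A \<times> B" M2]
  by (simp add: Int_absorb2)

context
  fixes g :: "'a \<times> 'a \<Rightarrow> real"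
  assumes g[measurable]: "g \<in> borel_measurable M2"
    and g01: "\<And>z. z \<in> space M2 \<Longrightarrow> 0 \<le> g z \<and> g z \<le> 1"
begin

lemma integrable_mult_labels:
  fixes h :: "nat \<Rightarrow> nat \<Rightarrow> real"
  assumes "labelling p m"
  shows "integrable M2 (\<lambda>z. g z * h (p (fst z)) (p (snd z)))"
proof -
  obtain B where B: "\<forall>z\<in>space M2. \<bar>h (p (fst z)) (p (snd z))\<bar> \<le> B"
    using labels_bounded[OF assms] by blast
  show ?thesis
  proof (rule integrable_bounded[where B="1 * B"])
    show "\<bar>g z * h (p (fst z)) (p (snd z))\<bar> \<le> 1 * B" if "z \<in> space M2" for z
      unfolding abs_mult using B g01[OF that] that by (intro mult_mono) auto
  qed (use measurable_labels[OF assms, of h] prob_space_pair in auto)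
qed

lemma integral_g_rect:
  assumes "A \<in> sets M" "B \<in> sets M"
  shows "0 \<le> (\<integral>z. g z * indicator (A \<times> B) z \<partial>M2)"
    "(\<integral>z. g z * indicator (A \<times> B) z \<partial>M2) \<le> prob A * prob B"
proof -
  show "0 \<le> (\<integral>z. g z * indicator (A \<times> B) z \<partial>M2)"
    using g01 by (intro Bochner_Integration.integral_nonneg) auto
  have "(\<integral>z. g z * indicator (A \<times> B) z \<partial>M2) \<le> (\<integral>z. indicator (A \<times> B) z \<partial>M2)"
    using g01 assms by (intro Bochner_Integration.integral_mono integrable_bounded[where B=1] prob_space_pair)
      (auto simp: indicator_def)
  then show "(\<integral>z. g z * indicator (A \<times> B) z \<partial>M2) \<le> prob A * prob B"
    using integral_rect[OF assms] by simp
qed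

lemma cell_density_01:
  assumes "labelling p m"
  shows "0 \<le> cell_density g p i j" "cell_density g p i j \<le> 1"
  using integral_g_rect[OF cell_sets[OF assms] cell_sets[OF assms], of i j]
  by (auto simp: cell_density_def divide_simps mult_nonneg_nonneg)

lemma cell_density_mult:
  assumes "labelling p m"
  shows "cell_density g p i j * (prob (cell p i) * prob (cell p j)) =
    (\<integral>z. g z * indicator (cell p i \<times> cell p j) z \<partial>M2)"
  using integral_g_rect[OF cell_sets[OF assms] cell_sets[OF assms], of i j]
  by (cases "prob (cell p i) * prob (cell p j) = 0") (auto simp: cell_density_def)

text \<open>On a pair of cells \<open>h\<close> is constant and \<open>step g p\<close> is the
  average of \<open>g\<close>, so the integrals agree pair by pair. This is the defining property of
  a conditional expectation.\<close>

lemma step_projection: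
  fixes h :: "nat \<Rightarrow> nat \<Rightarrow> real"
  assumes p: "labelling p m"
  shows "(\<integral>z. step g p z * h (p (fst z)) (p (snd z)) \<partial>M2) =
    (\<integral>z. g z * h (p (fst z)) (p (snd z)) \<partial>M2)"
proof -
  let ?d = "cell_density g p"
  obtain B where B: "\<forall>z\<in>space M2. \<bar>?d (p (fst z)) (p (snd z)) * h (p (fst z)) (p (snd z))\<bar> \<le> B"
    using labels_bounded[OF p, of "\<lambda>i j. ?d i j * h i j"] by blast
  have int: "integrable M2 (\<lambda>z. step g p z * h (p (fst z)) (p (snd z)))"
    unfolding step_def using B measurable_labels[OF p, of "\<lambda>i j. ?d i j * h i j"]
    by (intro integrable_bounded prob_space_pair) auto
  have "(\<integral>z. step g p z * h (p (fst z)) (p (snd z)) * indicator (cell p i \<times> cell p j) z \<partial>M2) =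
     (\<integral>z. g z * h (p (fst z)) (p (snd z)) * indicator (cell p i \<times> cell p j) z \<partial>M2)"
    (is "?l = ?r") for i j
  proof -
    have "?l = (\<integral>z. ?d i j * h i j * indicator (cell p i \<times> cell p j) z \<partial>M2)"
      by (intro Bochner_Integration.integral_cong) (auto simp: step_def cell_def indicator_def)
    also have "\<dots> = h i j * (?d i j * (prob (cell p i) * prob (cell p j)))"
      using integral_rect[OF cell_sets[OF p] cell_sets[OF p], of i j] by simp
    also have "\<dots> = (\<integral>z. h i j * (g z * indicator (cell p i \<times> cell p j) z) \<partial>M2)"
      by (simp add: cell_density_mult[OF p])
    also have "\<dots> = ?r"
      by (intro Bochner_Integration.integral_cong) (auto simp: cell_def indicator_def)
    finally show ?thesis .
  qed
  then show ?thesis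
    unfolding integral_sum_cells[OF p int] integral_sum_cells[OF p integrable_mult_labels[OF p]] by simp
qed

lemma step_measurable: "labelling p m \<Longrightarrow> step g p \<in> borel_measurable M2"
  unfolding step_def[abs_def] by (rule measurable_labels)

lemma step_01: "labelling p m \<Longrightarrow> 0 \<le> step g p z \<and> step g p z \<le> 1"
  unfolding step_def using cell_density_01 by blast

lemma energy_01:
  assumes p: "labelling p m" shows "0 \<le> energy g p" "energy g p \<le> 1"
proof -
  interpret MM: prob_space M2 by (rule prob_space_pair)
  note [measurable] = step_measurable[OF p]
  show "0 \<le> energy g p" unfolding energy_def by simp
  show "energy g p \<le> 1" unfolding energy_def
    using step_01[OF p]
    by (intro MM.integral_le_const integrable_bounded[where B=1] prob_space_pair)
       (auto simp: power_le_one)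
qed

text \<open>Pythagoras: since \<open>p\<close> is a function of \<open>q\<close>,
  \<open>step g p\<close> is the orthogonal projection of \<open>step g q\<close> to the functions
  of the coarser labels.\<close>

lemma energy_refinement:
  assumes p: "labelling p m" and q: "labelling q n" and r: "\<And>x. p x = r (q x)"
  shows "(\<integral>z. (step g q z - step g p z)\<^sup>2 \<partial>M2) = energy g q - energy g p"
proof -
  note [measurable] = step_measurable[OF p] step_measurable[OF q]
  have [simp]: "integrable M2 (\<lambda>z. step g p z * step g q z)"
    "integrable M2 (\<lambda>z. (step g p z)\<^sup>2)" "integrable M2 (\<lambda>z. (step g q z)\<^sup>2)"
    using step_01[OF p] step_01[OF q]
    by (auto intro!: integrable_bounded[where B=1] prob_space_pair simp: power_le_one mult_le_one)
  have a: "(\<integral>z. step g q z * step g p z \<partial>M2) = (\<integral>z. g z * step g p z \<partial>M2)"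
    using step_projection[OF q, of "\<lambda>i j. cell_density g p (r i) (r j)"]
    unfolding step_def[of g p] r[symmetric] .
  have b: "(\<integral>z. step g p z * step g p z \<partial>M2) = (\<integral>z. g z * step g p z \<partial>M2)"
    using step_projection[OF p, of "cell_density g p"] unfolding step_def[of g p] .
  have "(\<integral>z. (step g q z - step g p z)\<^sup>2 \<partial>M2) =
     (\<integral>z. ((step g q z)\<^sup>2 + (step g p z)\<^sup>2) - 2 * (step g p z * step g q z) \<partial>M2)"
    by (intro Bochner_Integration.integral_cong) (auto simp: power2_diff mult.commute)
  also have "\<dots> = energy g q + energy g p - 2 * (\<integral>z. step g p z * step g q z \<partial>M2)"
    by (simp add: energy_def)
  finally show ?thesis using a b by (simp add: energy_def mult.commute power2_eq_square)
qed

text \<open>Refining by witnesses of all irregular pairs gains on each of them at least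
  \<open>\<eta>\<^sup>2\<close> times its mass, by Cauchy-Schwarz. These pairs have total mass above
  \<eta>, hence the cube.\<close>

lemma energy_increment:
  assumes p: "labelling p m" and \<eta>: "\<eta> > 0"
    and irr: "\<eta> < irregular_mass g p m \<eta>"
  shows "\<exists>q. labelling q (m * 2 ^ (2 * m * m)) \<and> energy g p + \<eta> ^ 3 \<le> energy g q"
proof -
  let ?d = "cell_density g p" and ?\<mu> = "\<lambda>i j. prob (cell p i) * prob (cell p j)"
  let ?I = "{(i, j). i < m \<and> j < m \<and> irregular g p \<eta> i j}"
  obtain S T where ST: "\<And>i j. irregular g p \<eta> i j \<Longrightarrow>
      S i j \<subseteq> cell p i \<and> T i j \<subseteq> cell p j \<and> S i j \<in> sets M \<and> T i j \<in> sets M \<and>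
     \<eta> * ?\<mu> i j < \<bar>\<integral>z. (g z - ?d i j) * indicator (S i j \<times> T i j) z \<partial>M2\<bar>"
  proof -
    define P where "P i j S T \<longleftrightarrow> S \<subseteq> cell p i \<and> T \<subseteq> cell p j \<and> S \<in> sets M \<and> T \<in> sets M \<and>
       \<eta> * ?\<mu> i j < \<bar>\<integral>z. (g z - ?d i j) * indicator (S \<times> T) z \<partial>M2\<bar>" for i j S T
    have "\<exists>S T. P i j S T" if "irregular g p \<eta> i j" for i j
      using that unfolding irregular_def P_def by blast
    then obtain S T where "\<And>i j. irregular g p \<eta> i j \<Longrightarrow> P i j (S i j) (T i j)" by metis
    then show ?thesis using that unfolding P_def by blast
  qed
  \<comment> \<open>Pairs that are not irregular contribute the empty set, so that the length of the
    list, and with it the number of new labels, depends on \<open>m\<close> alone.\<close>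
  define L where "L A = map (\<lambda>(i, j). if irregular g p \<eta> i j then A i j else {}) (List.product [0..<m] [0..<m])"
    for A :: "nat \<Rightarrow> nat \<Rightarrow> 'a set"
  define q where "q = refine p (L S @ L T)"
  have q: "labelling q (m * 2 ^ (2 * m * m))"
  proof -
    have "set (L S @ L T) \<subseteq> sets M" using ST by (auto simp: L_def)
    moreover have "length (L S @ L T) = 2 * m * m" by (simp add: L_def)
    ultimately show ?thesis using labelling_refine[OF p, of "L S @ L T"] by (simp only: q_def)
  qed
  have pq: "p x = q x div 2 ^ length (L S @ L T)" for x unfolding q_def by (rule refine_div[symmetric])
  note [measurable] = step_measurable[OF p] step_measurable[OF q]
  define D where "D z = step g q z - step g p z" for z
  have [measurable]: "D \<in> borel_measurable M2" unfolding D_def[abs_def] by measurable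
  have D1: "\<bar>D z\<bar> \<le> 1" for z using step_01[OF p, of z] step_01[OF q, of z] by (auto simp: D_def)
  then have D2: "(D z)\<^sup>2 \<le> 1" for z by (simp add: abs_square_le_1)
  have intD2: "integrable M2 (\<lambda>z. (D z)\<^sup>2)"
    using D2 by (intro integrable_bounded[where B=1] prob_space_pair) auto
  have cellwise: "\<eta>\<^sup>2 * ?\<mu> i j \<le> (\<integral>z. (D z)\<^sup>2 * indicator (cell p i \<times> cell p j) z \<partial>M2)"
    if ij: "i < m" "j < m" "irregular g p \<eta> i j" for i j
  proof -
    note st = ST[OF ij(3)]
    have sets[measurable]: "S i j \<in> sets M" "T i j \<in> sets M" "cell p i \<in> sets M" "cell p j \<in> sets M"
      using st cell_sets[OF p] by auto
    have "A i j \<in> set (L A)" for A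
      unfolding L_def set_map by (rule image_eqI[of _ _ "(i, j)"]) (use ij in auto)
    then have mem: "S i j \<in> set (L S @ L T)" "T i j \<in> set (L S @ L T)" by auto
    obtain D1' where D1': "\<forall>x. x \<in> S i j \<longleftrightarrow> D1' (q x)"
      using refine_determines_mem[OF mem(1), of p] unfolding q_def by blast
    obtain D2' where D2': "\<forall>x. x \<in> T i j \<longleftrightarrow> D2' (q x)"
      using refine_determines_mem[OF mem(2), of p] unfolding q_def by blast
    have ind: "indicator (S i j \<times> T i j) z = (of_bool (D1' (q (fst z)) \<and> D2' (q (snd z))) :: real)" for z
      using D1' D2' by (cases z) (auto simp: indicator_def)
    \<comment> \<open>Both sets are determined by the refined label, so \<open>step g q\<close> and
      \<open>g\<close> have the same integral over their product.\<close>
    have c1: "(\<integral>z. step g q z * indicator (S i j \<times> T i j) z \<partial>M2) =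
        (\<integral>z. g z * indicator (S i j \<times> T i j) z \<partial>M2)"
      unfolding ind by (rule step_projection[OF q])
    have c2: "step g p z * indicator (S i j \<times> T i j) z = ?d i j * indicator (S i j \<times> T i j) z" for z
      using st by (cases z) (auto simp: step_def indicator_def cell_def)
    have c3: "integrable M2 (\<lambda>z. ?d i j * indicator (S i j \<times> T i j) z)"
      "integrable M2 (\<lambda>z. g z * indicator (S i j \<times> T i j) z)"
      "integrable M2 (\<lambda>z. step g q z * indicator (S i j \<times> T i j) z)"
      using step_01[OF q] cell_density_01[OF p, of i j] g01
      by (auto intro!: integrable_bounded[where B=1] prob_space_pair simp: indicator_def)
    have eq: "(\<integral>z. D z * indicator (S i j \<times> T i j) z \<partial>M2) =
        (\<integral>z. (g z - ?d i j) * indicator (S i j \<times> T i j) z \<partial>M2)"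
      unfolding D_def left_diff_distrib c2
      by (simp only: Bochner_Integration.integral_diff c1 c3)
    have sub: "S i j \<times> T i j \<subseteq> cell p i \<times> cell p j" using st by auto
    \<comment> \<open>Cauchy-Schwarz in linear form, which avoids dividing by a mass that may be
      zero. It comes from \<open>0 \<le> (D z - c)\<^sup>2\<close> on the rectangle and is trivial
      on the rest of the pair of cells. Later \<open>c\<close> is \<open>\<eta>\<close> or
      \<open>- \<eta>\<close>, according to the sign of the deviation.\<close>
    have lin: "2 * c * (\<integral>z. D z * indicator (S i j \<times> T i j) z \<partial>M2) - c\<^sup>2 * ?\<mu> i j \<le>
        (\<integral>z. (D z)\<^sup>2 * indicator (cell p i \<times> cell p j) z \<partial>M2)" for c :: real
    proof -
      have i1: "integrable M2 (\<lambda>z. D z * indicator (S i j \<times> T i j) z)"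
        "integrable M2 (\<lambda>z. indicator (cell p i \<times> cell p j) z :: real)"
        "integrable M2 (\<lambda>z. (D z)\<^sup>2 * indicator (cell p i \<times> cell p j) z)"
        using D1 D2 by (auto intro!: integrable_bounded[where B=1] prob_space_pair simp: indicator_def)
      have "2 * c * (\<integral>z. D z * indicator (S i j \<times> T i j) z \<partial>M2) - c\<^sup>2 * ?\<mu> i j =
        (\<integral>z. 2 * c * (D z * indicator (S i j \<times> T i j) z) - c\<^sup>2 * indicator (cell p i \<times> cell p j) z \<partial>M2)"
        using i1 integral_rect[OF sets(3,4)]
        by (subst Bochner_Integration.integral_diff) simp_all
      also have "\<dots> \<le> (\<integral>z. (D z)\<^sup>2 * indicator (cell p i \<times> cell p j) z \<partial>M2)"
      proof (intro Bochner_Integration.integral_mono)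
        fix z
        have "0 \<le> (D z - c)\<^sup>2" by simp
        then have "2 * c * D z - c\<^sup>2 \<le> (D z)\<^sup>2" by (simp add: power2_diff algebra_simps)
        then show "2 * c * (D z * indicator (S i j \<times> T i j) z) - c\<^sup>2 * indicator (cell p i \<times> cell p j) z
           \<le> (D z)\<^sup>2 * indicator (cell p i \<times> cell p j) z"
          using sub by (auto simp: indicator_def)
      qed (use i1 in auto)
      finally show ?thesis .
    qed
    let ?v = "\<integral>z. D z * indicator (S i j \<times> T i j) z \<partial>M2"
    have "\<eta> * ?\<mu> i j < \<bar>?v\<bar>" using st eq by simp
    then have "2 * \<eta> * (\<eta> * ?\<mu> i j) \<le> 2 * \<eta> * \<bar>?v\<bar>" using \<eta> by (intro mult_left_mono) auto
    also have "\<dots> - \<eta>\<^sup>2 * ?\<mu> i j \<le> (\<integral>z. (D z)\<^sup>2 * indicator (cell p i \<times> cell p j) z \<partial>M2)"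
      using lin[of \<eta>] lin[of "-\<eta>"] by (cases "?v \<ge> 0") auto
    finally show ?thesis by (simp add: power2_eq_square)
  qed
  have "\<eta> ^ 3 \<le> \<eta>\<^sup>2 * (\<Sum>(i, j)\<in>?I. ?\<mu> i j)"
    using irr \<eta> by (simp add: irregular_mass_def power3_eq_cube power2_eq_square mult.assoc)
  also have "\<dots> = (\<Sum>(i, j)\<in>?I. \<eta>\<^sup>2 * ?\<mu> i j)" by (simp add: sum_distrib_left split_beta')
  also have "\<dots> \<le> (\<Sum>(i, j)\<in>?I. \<integral>z. (D z)\<^sup>2 * indicator (cell p i \<times> cell p j) z \<partial>M2)"
    using cellwise by (intro sum_mono) auto
  also have "\<dots> \<le> (\<Sum>(i, j)\<in>{..<m} \<times> {..<m}. \<integral>z. (D z)\<^sup>2 * indicator (cell p i \<times> cell p j) z \<partial>M2)"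
    by (intro sum_mono2) (auto intro!: Bochner_Integration.integral_nonneg)
  also have "\<dots> = (\<integral>z. (D z)\<^sup>2 \<partial>M2)"
    by (rule integral_sum_cells[OF p intD2, symmetric])
  also have "\<dots> = energy g q - energy g p"
    unfolding D_def using pq by (intro energy_refinement[OF p q, of "\<lambda>n. n div 2 ^ length (L S @ L T)"]) auto
  finally show ?thesis using q by (intro exI[of _ q]) simp
qed

text \<open>Every round without a regular labelling raises the energy by \<open>\<eta> ^ 3\<close>.
  As the energy never exceeds 1, the first alternative is impossible for large
  \<open>n\<close>.\<close>

lemma regularity_or_energy:
  assumes \<eta>: "\<eta> > 0"
  shows "(\<exists>p. labelling p (tower n) \<and> real n * \<eta> ^ 3 \<le> energy g p)
    \<or> (\<exists>p. \<exists>l\<le>n. labelling p (tower l) \<and> irregular_mass g p (tower l) \<eta> \<le> \<eta>)"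
proof (induction n)
  case 0
  have "labelling (\<lambda>_. 0) (tower 0)" by (simp add: labelling_def)
  then show ?case using energy_01(1) by (intro disjI1 exI[of _ "\<lambda>_. 0"]) simp
next
  case (Suc n)
  show ?case
  proof (cases "\<exists>p. \<exists>l\<le>n. labelling p (tower l) \<and> irregular_mass g p (tower l) \<eta> \<le> \<eta>")
    case False
    then obtain p where p: "labelling p (tower n)" "real n * \<eta> ^ 3 \<le> energy g p" using Suc by blast
    have "\<eta> < irregular_mass g p (tower n) \<eta>" using False p(1) le_refl not_le by blast
    from energy_increment[OF p(1) \<eta> this] obtain q where
      "labelling q (tower (Suc n))" "energy g p + \<eta> ^ 3 \<le> energy g q" by auto
    then show ?thesis using p(2) by (intro disjI1 exI[of _ q]) (simp add: algebra_simps)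
  qed (meson le_SucI)
qed

end

text \<open>\<open>L\<close> is fixed before \<open>g\<close>: the constant of the removal lemma,
  and with it the time \<open>T\<close>, must not depend on the graphon.\<close>

theorem regularity:
  fixes \<eta> :: real
  assumes \<eta>: "\<eta> > 0"
  obtains L :: nat where "L > 0" "\<And>g :: 'a \<times> 'a \<Rightarrow> real. g \<in> borel_measurable M2 \<Longrightarrow>
    (\<And>z. z \<in> space M2 \<Longrightarrow> 0 \<le> g z \<and> g z \<le> 1) \<Longrightarrow>
    \<exists>p m. m \<le> L \<and> labelling p m \<and> irregular_mass g p m \<eta> \<le> \<eta>"
proof -
  obtain n :: nat where n: "1 / \<eta> ^ 3 < real n" using reals_Archimedean2 by blast
  have n1: "1 < real n * \<eta> ^ 3" using n \<eta> by (simp add: divide_simps)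
  \<comment> \<open>The sum bounds every \<open>tower l\<close> with \<open>l \<le> n\<close>
    without an appeal to monotonicity of \<open>tower\<close>.\<close>
  define L where "L = (\<Sum>l\<le>n. tower l) + 1"
  have le: "tower l \<le> L" if "l \<le> n" for l
    using member_le_sum[of l "{..n}" tower] that by (simp add: L_def)
  show ?thesis
  proof (rule that[of L])
    fix g :: "'a \<times> 'a \<Rightarrow> real" assume g: "g \<in> borel_measurable M2"
      "\<And>z. z \<in> space M2 \<Longrightarrow> 0 \<le> g z \<and> g z \<le> 1"
    have "\<not> (\<exists>p. labelling p (tower n) \<and> real n * \<eta> ^ 3 \<le> energy g p)"
      using energy_01(2)[OF g] n1 by (meson not_le order_trans)
    then obtain p l where "l \<le> n" "labelling p (tower l)" "irregular_mass g p (tower l) \<eta> \<le> \<eta>"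
      using regularity_or_energy[OF g \<eta>, of n] by blast
    then show "\<exists>p m. m \<le> L \<and> labelling p m \<and> irregular_mass g p m \<eta> \<le> \<eta>" using le by blast
  qed (simp add: L_def)
qed

end

section \<open>Counting and removal\<close>

text \<open>As \<open>a\<close> and \<open>b\<close> are not joined, every edge meets at most one of
  them. With the other vertices frozen, the weight is a function of \<open>x\<close> times a
  function of \<open>y\<close> times a constant, the shape that a regular pair controls.\<close>

lemma hom_weight_split:
  assumes "finite E" "(a, b) \<notin> E" "(b, a) \<notin> E" and False: "a \<noteq> b"
  shows "hom_weight E W (v(a := x, b := y)) =
    hom_weight {e\<in>E. fst e = a \<or> snd e = a} W (v(a := x)) *
    hom_weight {e\<in>E. fst e = b \<or> snd e = b} W (v(b := y)) *
    hom_weight {e\<in>E. fst e \<noteq> a \<and> snd e \<noteq> a \<and> fst e \<noteq> b \<and> snd e \<noteq> b} W v"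
proof -
  let ?w = "v(a := x, b := y)"
  let ?A = "{e\<in>E. fst e = a \<or> snd e = a}" and ?B = "{e\<in>E. fst e = b \<or> snd e = b}"
    and ?C = "{e\<in>E. fst e \<noteq> a \<and> snd e \<noteq> a \<and> fst e \<noteq> b \<and> snd e \<noteq> b}"
  have E: "E = ?A \<union> ?B \<union> ?C" by auto
  have AB: "?A \<inter> ?B = {}" using assms by force
  have "hom_weight E W ?w = hom_weight ?A W ?w * hom_weight ?B W ?w * hom_weight ?C W ?w"
    unfolding hom_weight_def using assms AB
    by (subst E, subst prod.union_disjoint, simp, simp, blast, subst prod.union_disjoint) auto
  also have "hom_weight ?A W ?w = hom_weight ?A W (v(a := x))"
    unfolding hom_weight_def using assms False by (intro prod.cong) auto
  also have "hom_weight ?B W ?w = hom_weight ?B W (v(b := y))"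
    unfolding hom_weight_def using assms False by (intro prod.cong) auto
  also have "hom_weight ?C W ?w = hom_weight ?C W v"
    unfolding hom_weight_def by (intro prod.cong) auto
  finally show ?thesis .
qed

section \<open>Rectangles against products of functions\<close>

context prob_space
begin

text \<open>The integral is linear in \<open>f\<close>, so it is smallest for an indicator, namely
  that of the set where the inner integral over the second variable is negative.\<close>

lemma cut_function_fst:
  fixes K :: "'a \<times> 'a \<Rightarrow> real"
  assumes [measurable]: "K \<in> borel_measurable M2" "f \<in> borel_measurable M"
    and K: "\<And>z. z \<in> space M2 \<Longrightarrow> \<bar>K z\<bar> \<le> B"
    and f: "\<And>x. x \<in> space M \<Longrightarrow> 0 \<le> f x \<and> f x \<le> 1"
  shows "\<exists>S\<in>sets M. (\<integral>z. K z * indicator S (fst z) \<partial>M2) \<le> (\<integral>z. K z * f (fst z) \<partial>M2)"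
proof -
  interpret MM: pair_prob_space M M ..
  define \<phi> where "\<phi> x = (\<integral>y. K (x, y) \<partial>M)" for x
  have [measurable]: "\<phi> \<in> borel_measurable M" unfolding \<phi>_def[abs_def] by measurable
  define S where "S = {x \<in> space M. \<phi> x < 0}"
  have [measurable]: "S \<in> sets M" unfolding S_def by measurable
  have fub: "(\<integral>z. K z * u (fst z) \<partial>M2) = (\<integral>x. \<phi> x * u x \<partial>M)"
    "integrable M (\<lambda>x. \<phi> x * u x)"
    if [measurable]: "u \<in> borel_measurable M" and u: "\<And>x. x \<in> space M \<Longrightarrow> 0 \<le> u x \<and> u x \<le> 1" for u
  proof -
    have int: "integrable M2 (\<lambda>(x, y). K (x, y) * u x)"
    proof (rule integrable_bounded[OF prob_space_pair, where B="B * 1"])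
      show "\<bar>(\<lambda>(x, y). K (x, y) * u x) z\<bar> \<le> B * 1" if "z \<in> space M2" for z
      proof -
        have "\<bar>K z * u (fst z)\<bar> \<le> B * 1"
          unfolding abs_mult using K[OF that] u[of "fst z"] that
          by (intro mult_mono) (auto simp: space_pair_measure)
        then show ?thesis by (simp add: split_beta')
      qed
    qed measurable
    from MM.integral_fst'[OF int] MM.integrable_fst'[OF int]
    show "(\<integral>z. K z * u (fst z) \<partial>M2) = (\<integral>x. \<phi> x * u x \<partial>M)"
      "integrable M (\<lambda>x. \<phi> x * u x)"
      by (simp_all add: \<phi>_def split_beta')
  qed
  have "(\<integral>x. \<phi> x * indicator S x \<partial>M) \<le> (\<integral>x. \<phi> x * f x \<partial>M)"
  proof (intro Bochner_Integration.integral_mono fub(2))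
    fix x assume x: "x \<in> space M"
    show "\<phi> x * indicator S x \<le> \<phi> x * f x"
    proof (cases "\<phi> x < 0")
      case True
      then show ?thesis using f[OF x] x mult_left_mono_neg[of "f x" 1 "\<phi> x"] by (simp add: S_def)
    next
      case False
      then show ?thesis using f[OF x] x by (simp add: S_def)
    qed
  qed (use f in \<open>auto simp: indicator_def\<close>)
  then have "(\<integral>z. K z * indicator S (fst z) \<partial>M2) \<le> (\<integral>z. K z * f (fst z) \<partial>M2)"
    by (subst fub(1), simp, simp add: indicator_def, subst fub(1)) (use f in auto)
  then show ?thesis by (intro bexI[of _ S]) auto
qed

lemma integral_swap:
  fixes f :: "'a \<times> 'a \<Rightarrow> real"
  assumes "f \<in> borel_measurable M2"
  shows "(\<integral>z. f (snd z, fst z) \<partial>M2) = (\<integral>z. f z \<partial>M2)"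
proof -
  interpret MM: pair_prob_space M M ..
  show ?thesis using MM.integral_product_swap[OF assms] by (simp add: split_beta')
qed

text \<open>The two factors are replaced by indicators one after the other; exchanging the
  coordinates reduces the second replacement to \<open>cut_function_fst\<close>.\<close>

lemma cut_function:
  fixes K :: "'a \<times> 'a \<Rightarrow> real"
  assumes [measurable]: "K \<in> borel_measurable M2" "f \<in> borel_measurable M" "h \<in> borel_measurable M"
    and K: "\<And>z. z \<in> space M2 \<Longrightarrow> \<bar>K z\<bar> \<le> B"
    and f: "\<And>x. x \<in> space M \<Longrightarrow> 0 \<le> f x \<and> f x \<le> 1"
    and h: "\<And>x. x \<in> space M \<Longrightarrow> 0 \<le> h x \<and> h x \<le> 1"
  shows "\<exists>S\<in>sets M. \<exists>T\<in>sets M. (\<integral>z. K z * indicator (S \<times> T) z \<partial>M2)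
    \<le> (\<integral>z. K z * (f (fst z) * h (snd z)) \<partial>M2)"
proof -
  have "\<exists>S\<in>sets M. (\<integral>z. (K z * h (snd z)) * indicator S (fst z) \<partial>M2) \<le>
      (\<integral>z. (K z * h (snd z)) * f (fst z) \<partial>M2)"
  proof (rule cut_function_fst[where B="B * 1"])
    show "\<bar>K z * h (snd z)\<bar> \<le> B * 1" if "z \<in> space M2" for z
      unfolding abs_mult using K[OF that] h[of "snd z"] that
      by (intro mult_mono) (auto simp: space_pair_measure)
  qed (use f in auto)
  then obtain S where [measurable]: "S \<in> sets M" and S:
    "(\<integral>z. K z * h (snd z) * indicator S (fst z) \<partial>M2) \<le> (\<integral>z. K z * h (snd z) * f (fst z) \<partial>M2)"
    by auto
  define K' where "K' z = K (snd z, fst z) * indicator S (snd z)" for z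
  have K'm[measurable]: "K' \<in> borel_measurable M2" unfolding K'_def[abs_def] by measurable
  have "\<exists>T\<in>sets M. (\<integral>z. K' z * indicator T (fst z) \<partial>M2) \<le> (\<integral>z. K' z * h (fst z) \<partial>M2)"
  proof (rule cut_function_fst[where B="B"])
    show "\<bar>K' z\<bar> \<le> B" if "z \<in> space M2" for z
      using K[of "(snd z, fst z)"] K[of z] that
      by (auto simp: K'_def indicator_def space_pair_measure)
  qed (use h in auto)
  then obtain T where [measurable]: "T \<in> sets M" and T:
    "(\<integral>z. K' z * indicator T (fst z) \<partial>M2) \<le> (\<integral>z. K' z * h (fst z) \<partial>M2)"
    by auto
  have "(\<integral>z. K z * indicator (S \<times> T) z \<partial>M2) =
      (\<integral>z. (\<lambda>z. K' z * indicator T (fst z)) (snd z, fst z) \<partial>M2)"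
    by (intro Bochner_Integration.integral_cong) (auto simp: K'_def indicator_def)
  also have "\<dots> = (\<integral>z. K' z * indicator T (fst z) \<partial>M2)" by (rule integral_swap) measurable
  also note T
  also have "(\<integral>z. K' z * h (fst z) \<partial>M2) = (\<integral>z. (\<lambda>z. K' z * h (fst z)) (snd z, fst z) \<partial>M2)"
    by (rule integral_swap[symmetric]) measurable
  also have "\<dots> = (\<integral>z. K z * h (snd z) * indicator S (fst z) \<partial>M2)"
    by (intro Bochner_Integration.integral_cong) (auto simp: K'_def)
  also note S
  finally show ?thesis by (intro bexI[of _ S] bexI[of _ T]) (auto simp: mult.assoc mult.commute[of "h _"])
qed

text \<open>Extends regularity from rectangles to products of functions with values in
  \<open>[0, 1]\<close>: by \<open>cut_function\<close> some rectangle does at least as badly. The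
  bound is from below because copies are to be counted from below.\<close>

lemma regular_bilinear:
  assumes g[measurable]: "g \<in> borel_measurable M2"
    and g01: "\<And>z. z \<in> space M2 \<Longrightarrow> 0 \<le> g z \<and> g z \<le> 1"
    and p: "labelling p m" and reg: "\<not> irregular g p \<eta> i j"
    and [measurable]: "f \<in> borel_measurable M" "h \<in> borel_measurable M"
    and f: "\<And>x. x \<in> space M \<Longrightarrow> 0 \<le> f x \<and> f x \<le> 1"
    and h: "\<And>x. x \<in> space M \<Longrightarrow> 0 \<le> h x \<and> h x \<le> 1"
  shows "- \<eta> * (prob (cell p i) * prob (cell p j)) \<le>
    (\<integral>z. (g z - cell_density g p i j) * indicator (cell p i \<times> cell p j) z * (f (fst z) * h (snd z)) \<partial>M2)"
proof -
  let ?d = "cell_density g p i j"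
  note [measurable] = cell_sets[OF p]
  have "\<exists>S\<in>sets M. \<exists>T\<in>sets M.
     (\<integral>z. (g z - ?d) * indicator (cell p i \<times> cell p j) z * indicator (S \<times> T) z \<partial>M2) \<le>
     (\<integral>z. (g z - ?d) * indicator (cell p i \<times> cell p j) z * (f (fst z) * h (snd z)) \<partial>M2)"
  proof (rule cut_function[where B=1])
    show "\<bar>(g z - ?d) * indicator (cell p i \<times> cell p j) z\<bar> \<le> 1" if "z \<in> space M2" for z
      using g01[OF that] cell_density_01[OF g g01 p, of i j] by (auto simp: indicator_def)
  qed (use f h in auto)
  then obtain S T where [measurable]: "S \<in> sets M" "T \<in> sets M" and ST:
    "(\<integral>z. (g z - ?d) * indicator (cell p i \<times> cell p j) z * indicator (S \<times> T) z \<partial>M2) \<le>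
     (\<integral>z. (g z - ?d) * indicator (cell p i \<times> cell p j) z * (f (fst z) * h (snd z)) \<partial>M2)"
    by blast
  let ?S = "S \<inter> cell p i" and ?T = "T \<inter> cell p j"
  have "?S \<in> sets M" "?T \<in> sets M" by measurable
  then have "\<bar>\<integral>z. (g z - ?d) * indicator (?S \<times> ?T) z \<partial>M2\<bar> \<le> \<eta> * (prob (cell p i) * prob (cell p j))"
    using reg unfolding irregular_def by (meson Int_lower2 not_le)
  moreover have "(\<integral>z. (g z - ?d) * indicator (?S \<times> ?T) z \<partial>M2) =
    (\<integral>z. (g z - ?d) * indicator (cell p i \<times> cell p j) z * indicator (S \<times> T) z \<partial>M2)"
    by (intro Bochner_Integration.integral_cong) (auto simp: indicator_def)
  ultimately show ?thesis using ST by (auto simp: abs_le_iff)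
qed

lemma integral_prod_indicator:
  fixes B :: "'i \<Rightarrow> 'a set"
  assumes "finite J" "\<And>l. l \<in> J \<Longrightarrow> B l \<in> sets M"
  shows "(\<integral>v. (\<Prod>l\<in>J. indicator (B l) (v l)) \<partial>Mpow J) = (\<Prod>l\<in>J. prob (B l))"
proof -
  interpret P: product_sigma_finite "\<lambda>_::'i. M" by unfold_locales
  have "(\<integral>v. (\<Prod>l\<in>J. indicator (B l) (v l)) \<partial>Mpow J) = (\<Prod>l\<in>J. \<integral>x. indicator (B l) x \<partial>M :: real)"
    using P.product_integral_prod[of J "\<lambda>l. indicator (B l) :: 'a \<Rightarrow> real"] assms
    by (simp add: emeasure_eq_measure)
  also have "\<dots> = (\<Prod>l\<in>J. prob (B l))"
    using assms sets.sets_into_space by (intro prod.cong) (auto simp: Int_absorb2)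
  finally show ?thesis .
qed

end

section \<open>The counting lemma\<close>

context prob_space
begin

lemma fun_upd_measurable_component:
  assumes "i \<noteq> a \<Longrightarrow> v i \<in> space M"
  shows "(\<lambda>x. (v(a := x)) i) \<in> M \<rightarrow>\<^sub>M M"
  using assms by (cases "i = a") simp_all

lemma hom_weight_section_measurable:
  assumes W: "(\<lambda>(x, y). W x y) \<in> borel_measurable M2"
    and v: "\<And>i j. (i, j) \<in> E \<Longrightarrow> (i \<noteq> a \<longrightarrow> v i \<in> space M) \<and> (j \<noteq> a \<longrightarrow> v j \<in> space M)"
  shows "(\<lambda>x. hom_weight E W (v(a := x))) \<in> borel_measurable M"
proof -
  have "(\<lambda>x. W ((v(a := x)) i) ((v(a := x)) j)) \<in> borel_measurable M" if "(i, j) \<in> E" for i j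
    using measurable_compose[OF measurable_Pair[OF fun_upd_measurable_component[of i a v]
        fun_upd_measurable_component[of j a v]] W] v[OF that] by simp
  then show ?thesis unfolding hom_weight_def by (intro borel_measurable_prod) auto
qed

lemma hom_weight_01:
  assumes "\<And>x y. x \<in> space M \<Longrightarrow> y \<in> space M \<Longrightarrow> 0 \<le> W x y \<and> W x y \<le> 1"
    and "v \<in> space (Mpow I)" "E \<subseteq> I \<times> I"
  shows "0 \<le> hom_weight E W v" "hom_weight E W v \<le> 1"
proof -
  have "0 \<le> W (v i) (v j) \<and> W (v i) (v j) \<le> 1" if "(i, j) \<in> E" for i j
    using that assms by (auto simp: space_PiM PiE_def Pi_iff)
  then show "0 \<le> hom_weight E W v" "hom_weight E W v \<le> 1" by (auto intro: hom_weight_unit)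
qed

text \<open>Induction over the edges. Replacing the factor of the new edge by its density costs at
  most \<eta> times the product of the measures, because the remaining factors split by
  \<open>hom_weight_split\<close>. Regularity is assumed for abstract sets \<open>B\<close> and
  densities \<open>d\<close>, so that vertices may share a cell and isolated ones may be given the
  whole space.\<close>

lemma counting:
  fixes I :: "'i set" and d :: "'i \<times> 'i \<Rightarrow> real" and \<eta> :: real
  assumes I: "finite I" "E \<subseteq> I \<times> I" and irr: "\<And>i. (i, i) \<notin> E"
    and asym: "\<And>i j. (i, j) \<in> E \<Longrightarrow> (j, i) \<notin> E"
    and W: "(\<lambda>(x, y). W x y) \<in> borel_measurable M2"
    and W01: "\<And>x y. x \<in> space M \<Longrightarrow> y \<in> space M \<Longrightarrow> 0 \<le> W x y \<and> W x y \<le> 1"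
    and B: "\<And>l. l \<in> I \<Longrightarrow> B l \<in> sets M"
    and d: "\<And>e. e \<in> E \<Longrightarrow> 0 \<le> d e \<and> d e \<le> 1" and \<eta>: "0 \<le> \<eta>"
    and reg: "\<And>i j f h. (i, j) \<in> E \<Longrightarrow> f \<in> borel_measurable M \<Longrightarrow> h \<in> borel_measurable M \<Longrightarrow>
      (\<And>x. x \<in> space M \<Longrightarrow> 0 \<le> f x \<and> f x \<le> 1) \<Longrightarrow> (\<And>x. x \<in> space M \<Longrightarrow> 0 \<le> h x \<and> h x \<le> 1) \<Longrightarrow>
      - \<eta> * (prob (B i) * prob (B j)) \<le>
      (\<integral>z. (W (fst z) (snd z) - d (i, j)) * indicator (B i \<times> B j) z * (f (fst z) * h (snd z)) \<partial>M2)"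
  shows "(prod d E - card E * \<eta>) * (\<Prod>l\<in>I. prob (B l)) \<le>
    (\<integral>v. hom_weight E W v * (\<Prod>l\<in>I. indicator (B l) (v l)) \<partial>Mpow I)"
proof -
  note W' [measurable] = W
  have indm [measurable]: "(\<lambda>v. \<Prod>l\<in>J. indicator (B l) (v l) :: real) \<in> borel_measurable (Mpow J)"
    if "J \<subseteq> I" for J
    using B that by (intro borel_measurable_prod measurable_compose[OF measurable_component_singleton borel_measurable_indicator]) auto
  have ind01: "0 \<le> (\<Prod>l\<in>J. indicator (B l) (v l) :: real)" "(\<Prod>l\<in>J. indicator (B l) (v l) :: real) \<le> 1"
    for J and v :: "'i \<Rightarrow> 'a"
    by (auto intro!: prod_nonneg prod_le_1)
  let ?P = "Mpow I"
  have "finite E" using I finite_subset by blast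
  then show ?thesis using I(2) irr asym d reg
  proof (induction E)
    case empty
    then show ?case using integral_prod_indicator[OF I(1) B] by (simp add: hom_weight_def)
  next
    case (insert e E)
    obtain a b where e: "e = (a, b)" by (cases e)
    have ab: "a \<in> I" "b \<in> I" "a \<noteq> b" "(a, b) \<notin> E" "(b, a) \<notin> E"
      using insert.prems(1) insert.prems(2)[of a] insert.prems(3)[of a b] insert.hyps(2) unfolding e by simp_all
    have EI: "E \<subseteq> I \<times> I" using insert.prems(1) by auto
    let ?J = "I - {a, b}"
    let ?ind = "\<lambda>v. \<Prod>l\<in>I. indicator (B l) (v l) :: real"
    let ?indJ = "\<lambda>v. \<Prod>l\<in>?J. indicator (B l) (v l) :: real"
    note [measurable] = hom_weight_measurable[OF W EI]
    have hw01: "0 \<le> hom_weight E W v" "hom_weight E W v \<le> 1" if "v \<in> space ?P" for v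
      using hom_weight_01[OF W01 that EI] by auto
    have IH: "(prod d E - card E * \<eta>) * (\<Prod>l\<in>I. prob (B l)) \<le> (\<integral>v. hom_weight E W v * ?ind v \<partial>?P)"
      using insert.prems(1-4) by (intro insert.IH insert.prems(5)) blast+
    have Wab: "(\<lambda>v. W (v a) (v b)) \<in> borel_measurable ?P"
      using measurable_compose[OF measurable_pair_component[OF ab(1,2)] W] by simp
    note [measurable] = Wab
    have Wab01: "0 \<le> W (v a) (v b) \<and> W (v a) (v b) \<le> 1" if "v \<in> space ?P" for v
      using W01 that ab by (auto simp: space_PiM PiE_def Pi_iff)
    have de: "0 \<le> d (a, b) \<and> d (a, b) \<le> 1" using insert.prems(4)[of "(a, b)"] e by simp
    \<comment> \<open>The error made by replacing the factor of the new edge by the constant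
      density.\<close>
    let ?f = "\<lambda>v. (W (v a) (v b) - d (a, b)) * (hom_weight E W v * ?ind v)"
    have int0: "integrable ?P (\<lambda>v. hom_weight E W v * ?ind v)"
    proof (rule integrable_bounded[OF prob_space_power, where B=1])
      show "\<bar>hom_weight E W v * ?ind v\<bar> \<le> 1" if "v \<in> space ?P" for v
        using hw01[OF that] ind01[of v I] by (auto simp: abs_mult intro!: mult_le_one)
    qed measurable
    have intf: "integrable ?P ?f"
    proof (rule integrable_bounded[OF prob_space_power, where B="1 * (1 * 1)"])
      show "\<bar>?f v\<bar> \<le> 1 * (1 * 1)" if "v \<in> space ?P" for v
        unfolding abs_mult using hw01[OF that] ind01[of v I] Wab01[OF that] de
        by (intro mult_mono) auto
    qed measurable
    have inner: "- \<eta> * (prob (B a) * prob (B b)) * ?indJ v \<le>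
        (\<integral>z. ?f (v(a := fst z, b := snd z)) \<partial>M2)" if v: "v \<in> space (Mpow ?J)" for v
    proof -
      have vs: "\<And>i. i \<in> I \<Longrightarrow> i \<noteq> a \<Longrightarrow> i \<noteq> b \<Longrightarrow> v i \<in> space M"
        using v by (auto simp: space_PiM PiE_def Pi_iff)
      let ?A = "{e\<in>E. fst e = a \<or> snd e = a}" and ?B = "{e\<in>E. fst e = b \<or> snd e = b}"
        and ?C = "{e\<in>E. fst e \<noteq> a \<and> snd e \<noteq> a \<and> fst e \<noteq> b \<and> snd e \<noteq> b}"
      have A': "i \<in> I \<and> j \<in> I \<and> i \<noteq> b \<and> j \<noteq> b" if "(i, j) \<in> ?A" for i j
        using that ab(3-5) EI by auto
      have B': "i \<in> I \<and> j \<in> I \<and> i \<noteq> a \<and> j \<noteq> a" if "(i, j) \<in> ?B" for i j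
        using that ab(3-5) EI by auto
      have m1: "(\<lambda>x. hom_weight ?A W (v(a := x))) \<in> borel_measurable M"
        by (rule hom_weight_section_measurable[OF W]) (use A' vs in blast)
      have m2: "(\<lambda>x. hom_weight ?B W (v(b := x))) \<in> borel_measurable M"
        by (rule hom_weight_section_measurable[OF W]) (use B' vs in blast)
      have b1: "0 \<le> hom_weight ?A W (v(a := x)) \<and> hom_weight ?A W (v(a := x)) \<le> 1" if "x \<in> space M" for x
      proof -
        have "(v(a := x)) i \<in> space M \<and> (v(a := x)) j \<in> space M" if "(i, j) \<in> ?A" for i j
          using A'[OF that] vs \<open>x \<in> space M\<close> by auto
        then show ?thesis using W01 hom_weight_unit[of ?A W "v(a := x)"] by blast
      qed
      have b2: "0 \<le> hom_weight ?B W (v(b := x)) \<and> hom_weight ?B W (v(b := x)) \<le> 1" if "x \<in> space M" for x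
      proof -
        have "(v(b := x)) i \<in> space M \<and> (v(b := x)) j \<in> space M" if "(i, j) \<in> ?B" for i j
          using B'[OF that] vs \<open>x \<in> space M\<close> by auto
        then show ?thesis using W01 hom_weight_unit[of ?B W "v(b := x)"] by blast
      qed
      have c: "0 \<le> hom_weight ?C W v" "hom_weight ?C W v \<le> 1"
      proof -
        have "v i \<in> space M \<and> v j \<in> space M" if "(i, j) \<in> ?C" for i j
          using vs EI that by auto
        then show "0 \<le> hom_weight ?C W v" "hom_weight ?C W v \<le> 1"
          using W01 hom_weight_unit[of ?C W v] by blast+
      qed
      let ?X = "\<integral>z. (W (fst z) (snd z) - d (a, b)) * indicator (B a \<times> B b) z *
          (hom_weight ?A W (v(a := fst z)) * hom_weight ?B W (v(b := snd z))) \<partial>M2"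
      have X: "- \<eta> * (prob (B a) * prob (B b)) \<le> ?X"
        using e by (intro insert.prems(5) m1 m2 b1 b2) auto
      have indI: "?ind (v(a := x, b := y)) = indicator (B a) x * indicator (B b) y * ?indJ v" for x y
      proof -
        have e: "I = insert a (insert b ?J)" using ab by auto
        have "?ind (v(a := x, b := y)) = indicator (B a) x * (indicator (B b) y *
           (\<Prod>l\<in>?J. indicator (B l) ((v(a := x, b := y)) l)))"
          using I(1) ab by (subst e) simp
        also have "(\<Prod>l\<in>?J. indicator (B l) ((v(a := x, b := y)) l) :: real) = ?indJ v"
          by (intro prod.cong) auto
        finally show ?thesis by (simp only: mult.assoc)
      qed
      have "(\<integral>z. ?f (v(a := fst z, b := snd z)) \<partial>M2) =
         (\<integral>z. (hom_weight ?C W v * ?indJ v) * ((W (fst z) (snd z) - d (a, b)) * indicator (B a \<times> B b) z *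
          (hom_weight ?A W (v(a := fst z)) * hom_weight ?B W (v(b := snd z)))) \<partial>M2)"
        unfolding indI hom_weight_split[OF insert.hyps(1) ab(4,5,3)]
        using ab(3) by (intro Bochner_Integration.integral_cong) (auto simp: indicator_def)
      also have "\<dots> = (hom_weight ?C W v * ?indJ v) * ?X" by simp
      finally have eq: "(\<integral>z. ?f (v(a := fst z, b := snd z)) \<partial>M2) = hom_weight ?C W v * ?indJ v * ?X" .
      have "(hom_weight ?C W v * ?indJ v) * (- \<eta> * (prob (B a) * prob (B b))) \<le> hom_weight ?C W v * ?indJ v * ?X"
        using X c ind01[of v "?J"] by (intro mult_left_mono) auto
      moreover have "?indJ v * (- \<eta> * (prob (B a) * prob (B b))) \<le>
          (hom_weight ?C W v * ?indJ v) * (- \<eta> * (prob (B a) * prob (B b)))"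
        using c ind01[of v "?J"] \<eta>
        by (intro mult_right_mono_neg) (auto intro!: mult_left_le_one_le)
      ultimately show ?thesis unfolding eq by (simp add: mult.commute)
    qed
    have intJ: "integrable (Mpow ?J) ?indJ"
      using ind01[of _ "?J"] by (intro integrable_bounded[where B=1] prob_space_power) auto
    have prodI: "prob (B a) * prob (B b) * (\<Prod>l\<in>?J. prob (B l)) = (\<Prod>l\<in>I. prob (B l))"
    proof -
      have e: "I = insert a (insert b ?J)" using ab by auto
      show ?thesis using I(1) ab by (subst (2) e) simp
    qed
    have "- \<eta> * (\<Prod>l\<in>I. prob (B l)) = - \<eta> * (prob (B a) * prob (B b)) * (\<Prod>l\<in>?J. prob (B l))"
      using prodI by simp
    also have "\<dots> = (\<integral>v. - \<eta> * (prob (B a) * prob (B b)) * ?indJ v \<partial>Mpow ?J)"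
      using integral_prod_indicator[of ?J B] I(1) B by simp
    also have "\<dots> \<le> (\<integral>v. (\<integral>z. ?f (v(a := fst z, b := snd z)) \<partial>M2) \<partial>Mpow ?J)"
      using intJ integral_PiM_pair(4)[OF I(1) ab(1-3) intf]
      by (intro Bochner_Integration.integral_mono inner) auto
    also have "\<dots> = (\<integral>v. ?f v \<partial>?P)"
      by (rule integral_PiM_pair(2)[OF I(1) ab(1-3) intf, symmetric])
    finally have swap: "- \<eta> * (\<Prod>l\<in>I. prob (B l)) \<le> (\<integral>v. ?f v \<partial>?P)" .
    have hwi: "hom_weight (insert e E) W v * ?ind v = ?f v + d (a, b) * (hom_weight E W v * ?ind v)" for v
      using insert.hyps e by (simp add: hom_weight_def algebra_simps)
    have "(\<integral>v. hom_weight (insert e E) W v * ?ind v \<partial>?P) =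
        (\<integral>v. ?f v \<partial>?P) + d (a, b) * (\<integral>v. hom_weight E W v * ?ind v \<partial>?P)"
      unfolding hwi using intf int0 by (subst Bochner_Integration.integral_add) auto
    moreover have "d (a, b) * ((prod d E - card E * \<eta>) * (\<Prod>l\<in>I. prob (B l))) \<le>
        d (a, b) * (\<integral>v. hom_weight E W v * ?ind v \<partial>?P)"
      using IH de by (intro mult_left_mono) auto
    moreover have "(prod d (insert e E) - card (insert e E) * \<eta>) * (\<Prod>l\<in>I. prob (B l)) \<le>
      - \<eta> * (\<Prod>l\<in>I. prob (B l)) + d (a, b) * ((prod d E - card E * \<eta>) * (\<Prod>l\<in>I. prob (B l)))"
    proof -
      \<comment> \<open>The density of the new edge is at most 1, so the error of the smaller graph
        does not grow and each edge adds one \<eta>.\<close>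
      have "d (a, b) * (card E * \<eta>) \<le> card E * \<eta>" using de \<eta> by (intro mult_left_le_one_le) auto
      then have "prod d (insert e E) - card (insert e E) * \<eta> \<le> - \<eta> + d (a, b) * (prod d E - card E * \<eta>)"
        using insert.hyps e by (simp add: algebra_simps)
      from mult_right_mono[OF this, of "\<Prod>l\<in>I. prob (B l)"]
      show ?thesis by (simp add: algebra_simps prod_nonneg)
    qed
    ultimately show ?case using swap by linarith
  qed
qed

end

section \<open>The removal lemma\<close>

context prob_space
begin

lemma integral_labels:
  fixes h :: "nat \<Rightarrow> nat \<Rightarrow> real"
  assumes p: "labelling p m"
  shows "(\<integral>z. h (p (fst z)) (p (snd z)) \<partial>M2) =
    (\<Sum>(i, j)\<in>{..<m} \<times> {..<m}. h i j * (prob (cell p i) * prob (cell p j)))"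
proof -
  have int: "integrable M2 (\<lambda>z. h (p (fst z)) (p (snd z)))"
    using integrable_mult_labels[OF _ _ p, of "\<lambda>_. 1" h] by simp
  have "(\<integral>z. h (p (fst z)) (p (snd z)) * indicator (cell p i \<times> cell p j) z \<partial>M2) =
     h i j * (prob (cell p i) * prob (cell p j))" for i j
  proof -
    have "(\<integral>z. h (p (fst z)) (p (snd z)) * indicator (cell p i \<times> cell p j) z \<partial>M2) =
      (\<integral>z. h i j * indicator (cell p i \<times> cell p j) z \<partial>M2)"
      by (intro Bochner_Integration.integral_cong) (auto simp: cell_def indicator_def)
    then show ?thesis using integral_rect[OF cell_sets[OF p] cell_sets[OF p], of i j] by simp
  qed
  then show ?thesis unfolding integral_sum_cells[OF p int] by simp
qed

text \<open>A union bound. Irregular pairs count with their mass; on pairs of density below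
  \<open>c\<close> the integral of \<open>g\<close> is that of its averages, all below
  \<open>c\<close>; small cells cost at most \<open>2 * \<beta>\<close> for each of the
  \<open>m * m\<close> pairs.\<close>

lemma bad_cells_mass:
  assumes g[measurable]: "g \<in> borel_measurable M2"
    and g01: "\<And>z. z \<in> space M2 \<Longrightarrow> 0 \<le> g z \<and> g z \<le> 1"
    and p: "labelling p m" and \<beta>: "0 \<le> \<beta>" and c: "0 \<le> c"
  shows "(\<integral>z. g z * of_bool (irregular g p \<eta> (p (fst z)) (p (snd z)) \<or>
      cell_density g p (p (fst z)) (p (snd z)) < c \<or> prob (cell p (p (fst z))) < \<beta> \<or>
      prob (cell p (p (snd z))) < \<beta>) \<partial>M2) \<le>
    irregular_mass g p m \<eta> + c + 2 * (real m)\<^sup>2 * \<beta>"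
    (is "?lhs \<le> _")
proof -
  interpret MM: prob_space M2 by (rule prob_space_pair)
  let ?d = "cell_density g p" and ?\<mu> = "\<lambda>i. prob (cell p i)"
  let ?h1 = "\<lambda>i j. of_bool (irregular g p \<eta> i j) :: real" and ?h2 = "\<lambda>i j. of_bool (?d i j < c) :: real"
    and ?h3 = "\<lambda>i j. of_bool (?\<mu> i < \<beta>) + of_bool (?\<mu> j < \<beta>) :: real"
  have int: "integrable M2 (\<lambda>z. h (p (fst z)) (p (snd z)))" for h :: "nat \<Rightarrow> nat \<Rightarrow> real"
    using integrable_mult_labels[OF _ _ p, of "\<lambda>_. 1" h] by simp
  have "?lhs \<le> (\<integral>z. ?h1 (p (fst z)) (p (snd z)) + g z * ?h2 (p (fst z)) (p (snd z)) +
      ?h3 (p (fst z)) (p (snd z)) \<partial>M2)"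
  proof (intro Bochner_Integration.integral_mono)
    show "integrable M2 (\<lambda>z. g z * of_bool (irregular g p \<eta> (p (fst z)) (p (snd z)) \<or>
      ?d (p (fst z)) (p (snd z)) < c \<or> ?\<mu> (p (fst z)) < \<beta> \<or> ?\<mu> (p (snd z)) < \<beta>))"
      by (rule integrable_mult_labels[OF g g01 p])
    show "integrable M2 (\<lambda>z. ?h1 (p (fst z)) (p (snd z)) + g z * ?h2 (p (fst z)) (p (snd z)) +
      ?h3 (p (fst z)) (p (snd z)))"
      by (intro Bochner_Integration.integrable_add int[of ?h1] int[of ?h3]
        integrable_mult_labels[OF g g01 p, of ?h2])
    fix z assume z: "z \<in> space M2"
    have "0 \<le> g z" "g z \<le> 1" using g01[OF z] by auto
    then show "g z * of_bool (irregular g p \<eta> (p (fst z)) (p (snd z)) \<or>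
      ?d (p (fst z)) (p (snd z)) < c \<or> ?\<mu> (p (fst z)) < \<beta> \<or> ?\<mu> (p (snd z)) < \<beta>) \<le>
      ?h1 (p (fst z)) (p (snd z)) + g z * ?h2 (p (fst z)) (p (snd z)) + ?h3 (p (fst z)) (p (snd z))"
      by (auto simp: of_bool_def)
  qed
  also have "\<dots> = (\<integral>z. ?h1 (p (fst z)) (p (snd z)) \<partial>M2) +
      (\<integral>z. g z * ?h2 (p (fst z)) (p (snd z)) \<partial>M2) + (\<integral>z. ?h3 (p (fst z)) (p (snd z)) \<partial>M2)"
    using int[of ?h1] int[of ?h3] integrable_mult_labels[OF g g01 p, of ?h2]
    by (simp only: Bochner_Integration.integral_add Bochner_Integration.integrable_add)
  also have "(\<integral>z. ?h1 (p (fst z)) (p (snd z)) \<partial>M2) = irregular_mass g p m \<eta>"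
    unfolding integral_labels[OF p, of ?h1] irregular_mass_def
    by (rule sum.mono_neutral_cong_right) auto
  also have "(\<integral>z. g z * ?h2 (p (fst z)) (p (snd z)) \<partial>M2) \<le> c"
  proof -
    have "(\<integral>z. g z * ?h2 (p (fst z)) (p (snd z)) \<partial>M2) =
      (\<integral>z. step g p z * ?h2 (p (fst z)) (p (snd z)) \<partial>M2)"
      by (rule step_projection[OF g g01 p, symmetric])
    also have "\<dots> \<le> c"
      using int[of "\<lambda>i j. ?d i j * ?h2 i j"] c unfolding step_def
      by (intro MM.integral_le_const) auto
    finally show ?thesis .
  qed
  also have "(\<integral>z. ?h3 (p (fst z)) (p (snd z)) \<partial>M2) \<le> 2 * (real m)\<^sup>2 * \<beta>"
  proof -
    have "?h3 i j * (?\<mu> i * ?\<mu> j) \<le> 2 * \<beta>" for i j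
    proof -
      have a: "?\<mu> i * ?\<mu> j \<le> ?\<mu> i" "?\<mu> i * ?\<mu> j \<le> ?\<mu> j"
        by (auto intro!: mult_left_le mult_left_le_one_le)
      show ?thesis
      proof (cases "?\<mu> i < \<beta> \<or> ?\<mu> j < \<beta>")
        case True
        then have "?\<mu> i * ?\<mu> j \<le> \<beta>" using a by auto
        moreover have "0 \<le> ?\<mu> i * ?\<mu> j" by simp
        ultimately show ?thesis using \<beta> by (auto simp: of_bool_def)
      qed (use \<beta> in auto)
    qed
    then have "(\<Sum>(i, j)\<in>{..<m} \<times> {..<m}. ?h3 i j * (?\<mu> i * ?\<mu> j)) \<le> (\<Sum>_\<in>{..<m} \<times> {..<m}. 2 * \<beta>)"
      by (intro sum_mono) auto
    then show ?thesis unfolding integral_labels[OF p, of ?h3] by (simp add: power2_eq_square algebra_simps)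
  qed
  finally show ?thesis by simp
qed

text \<open>\<open>A\<close> consists of the pairs whose cells are regular, dense and large. A
  single \<open>v\<close> with all edges in \<open>A\<close> forces a density of at least \<delta>
  by counting. This is why \<open>A\<close> is free of copies at every point and not merely almost
  everywhere.\<close>

theorem removal_lemma:
  fixes I :: "'i set" and \<epsilon> :: real
  assumes I: "finite I" "E \<subseteq> I \<times> I" and irr: "\<And>i. (i, i) \<notin> E"
    and asym: "\<And>i j. (i, j) \<in> E \<Longrightarrow> (j, i) \<notin> E" and \<epsilon>: "\<epsilon> > 0"
  shows "\<exists>\<delta>>0. \<forall>W. graphon M W \<longrightarrow> (\<integral>v. hom_weight E W v \<partial>Mpow I) < \<delta> \<longrightarrow>
    (\<exists>A\<in>sets M2. (\<integral>z. W (fst z) (snd z) * indicator (- A) z \<partial>M2) < \<epsilon> \<and>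
      (\<forall>v\<in>space (Mpow I). \<exists>(i, j)\<in>E. (v i, v j) \<notin> A))"
proof -
  \<comment> \<open>Sparse, irregular and small pairs are each allowed \<epsilon> / 4, which leaves
    the final inequality strict.\<close>
  define c where "c = \<epsilon> / 4"
  \<comment> \<open>The second bound keeps the counting error \<open>card E * \<eta>\<close> at most
    half of the main term \<open>c ^ card E\<close>; adding 1 covers an empty
    \<open>E\<close>.\<close>
  define \<eta> where "\<eta> = min (\<epsilon> / 4) (c ^ card E / (2 * (card E + 1)))"
  have c0: "c > 0" using \<epsilon> by (simp add: c_def)
  have \<eta>4: "\<eta> \<le> \<epsilon> / 4" unfolding \<eta>_def by (rule min.cobounded1)
  have \<eta>0: "\<eta> > 0" using \<epsilon> c0 by (auto simp: \<eta>_def)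
  have "card E * \<eta> \<le> card E * (c ^ card E / (2 * (card E + 1)))"
    by (intro mult_left_mono) (auto simp: \<eta>_def)
  also have "\<dots> \<le> c ^ card E / 2" using c0 by (simp add: divide_simps)
  finally have \<eta>E: "c ^ card E / 2 \<le> c ^ card E - card E * \<eta>" by simp
  obtain L where L: "L > 0" "\<And>g :: 'a \<times> 'a \<Rightarrow> real. g \<in> borel_measurable M2 \<Longrightarrow>
    (\<And>z. z \<in> space M2 \<Longrightarrow> 0 \<le> g z \<and> g z \<le> 1) \<Longrightarrow>
    \<exists>p m. m \<le> L \<and> labelling p m \<and> irregular_mass g p m \<eta> \<le> \<eta>"
    using regularity[OF \<eta>0] by blast
  \<comment> \<open>The minimum with 1 ensures that the whole space, which serves isolated vertices
    below, also has measure at least \<beta>.\<close>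
  define \<beta> where "\<beta> = min 1 (\<epsilon> / (8 * (real L)\<^sup>2))"
  have \<beta>: "0 < \<beta>" "\<beta> \<le> 1" using \<epsilon> L(1) by (auto simp: \<beta>_def)
  define \<delta> where "\<delta> = c ^ card E / 2 * \<beta> ^ card I"
  show ?thesis
  proof (intro exI[of _ \<delta>] conjI allI impI)
    show "\<delta> > 0" using c0 \<beta> by (simp add: \<delta>_def)
  next
    fix W :: "'a \<Rightarrow> 'a \<Rightarrow> real"
    assume graphon: "graphon M W" and small: "(\<integral>v. hom_weight E W v \<partial>Mpow I) < \<delta>"
    have W[measurable]: "(\<lambda>(x, y). W x y) \<in> borel_measurable M2"
      and W01: "\<And>x y. x \<in> space M \<Longrightarrow> y \<in> space M \<Longrightarrow> 0 \<le> W x y \<and> W x y \<le> 1"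
      using graphon unfolding graphon_def kernel_def by blast+
    define g where "g z = W (fst z) (snd z)" for z
    have g[measurable]: "g \<in> borel_measurable M2"
      using W by (simp add: g_def[abs_def] split_beta')
    have g01: "0 \<le> g z \<and> g z \<le> 1" if "z \<in> space M2" for z
      using W01 that by (auto simp: g_def space_pair_measure)
    obtain p m where mL: "m \<le> L" and p: "labelling p m" and mass: "irregular_mass g p m \<eta> \<le> \<eta>"
      using L(2)[OF g g01] by blast
    let ?d = "cell_density g p" and ?\<mu> = "\<lambda>i. prob (cell p i)"
    define bad where "bad i j \<longleftrightarrow> irregular g p \<eta> i j \<or> ?d i j < c \<or> ?\<mu> i < \<beta> \<or> ?\<mu> j < \<beta>" for i j
    define A where "A = {z \<in> space M2. \<not> bad (p (fst z)) (p (snd z))}"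
    have A: "A \<in> sets M2"
    proof -
      have "(\<lambda>z. of_bool (bad (p (fst z)) (p (snd z))) :: real) \<in> borel_measurable M2"
        by (rule measurable_labels[OF p])
      then have "{z \<in> space M2. (of_bool (bad (p (fst z)) (p (snd z))) :: real) = 0} \<in> sets M2"
        by measurable
      then show ?thesis by (simp add: A_def)
    qed
    have "(\<integral>z. W (fst z) (snd z) * indicator (- A) z \<partial>M2) =
        (\<integral>z. g z * of_bool (bad (p (fst z)) (p (snd z))) \<partial>M2)"
      by (intro Bochner_Integration.integral_cong) (auto simp: A_def g_def indicator_def)
    also have "\<dots> \<le> irregular_mass g p m \<eta> + c + 2 * (real m)\<^sup>2 * \<beta>"
      unfolding bad_def using \<beta> c0 by (intro bad_cells_mass[OF g g01 p]) auto
    also have "\<dots> < \<epsilon>"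
    proof -
      have "2 * (real m)\<^sup>2 * \<beta> \<le> 2 * (real L)\<^sup>2 * (\<epsilon> / (8 * (real L)\<^sup>2))"
        using mL \<beta>(1) \<epsilon> by (intro mult_mono power_mono) (auto simp: \<beta>_def)
      also have "\<dots> = \<epsilon> / 4" using L(1) by simp
      finally show ?thesis using mass \<eta>4 \<epsilon> by (simp add: c_def)
    qed
    finally have le: "(\<integral>z. W (fst z) (snd z) * indicator (- A) z \<partial>M2) < \<epsilon>" .
    have "\<exists>(i, j)\<in>E. (v i, v j) \<notin> A" if v: "v \<in> space (Mpow I)" for v
    proof (rule ccontr)
      assume "\<not> ?thesis"
      then have good: "\<not> bad (p (v i)) (p (v j))" if "(i, j) \<in> E" for i j
        using that by (auto simp: A_def)
      \<comment> \<open>An endpoint of an edge lies in a large cell, as its pair is not bad. An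
        isolated vertex may lie in a small cell and then takes the whole space.\<close>
      define B where "B l = (if \<beta> \<le> ?\<mu> (p (v l)) then cell p (p (v l)) else space M)" for l
      have B: "B l \<in> sets M" for l using cell_sets[OF p] by (auto simp: B_def)
      have B\<beta>: "\<beta> \<le> prob (B l)" for l using \<beta>(2) by (auto simp: B_def prob_space)
      have BE: "B i = cell p (p (v i))" "B j = cell p (p (v j))" if "(i, j) \<in> E" for i j
        using good[OF that] by (auto simp: bad_def B_def)
      define d where "d e = ?d (p (v (fst e))) (p (v (snd e)))" for e
      have d01: "0 \<le> d e \<and> d e \<le> 1" for e using cell_density_01[OF g g01 p] by (auto simp: d_def)
      have dc: "c \<le> d e" if "e \<in> E" for e
        using good[of "fst e" "snd e"] that by (auto simp: bad_def d_def)
      have "(prod d E - card E * \<eta>) * (\<Prod>l\<in>I. prob (B l)) \<le>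
        (\<integral>v. hom_weight E W v * (\<Prod>l\<in>I. indicator (B l) (v l)) \<partial>Mpow I)"
      proof (rule counting[OF I irr asym W W01])
        fix i j and f h :: "'a \<Rightarrow> real"
        assume ij: "(i, j) \<in> E" and fh: "f \<in> borel_measurable M" "h \<in> borel_measurable M"
          "\<And>x. x \<in> space M \<Longrightarrow> 0 \<le> f x \<and> f x \<le> 1" "\<And>x. x \<in> space M \<Longrightarrow> 0 \<le> h x \<and> h x \<le> 1"
        have "\<not> irregular g p \<eta> (p (v i)) (p (v j))" using good[OF ij] by (simp add: bad_def)
        from regular_bilinear[OF g g01 p this fh]
        show "- \<eta> * (prob (B i) * prob (B j)) \<le> (\<integral>z. (W (fst z) (snd z) - d (i, j)) *
            indicator (B i \<times> B j) z * (f (fst z) * h (snd z)) \<partial>M2)"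
          by (simp add: BE[OF ij] d_def g_def)
      qed (use B d01 \<eta>0 in auto)
      moreover have "\<delta> \<le> (prod d E - card E * \<eta>) * (\<Prod>l\<in>I. prob (B l))"
      proof -
        have "c ^ card E \<le> prod d E" using prod_mono[of E "\<lambda>_. c" d] dc c0 by simp
        then have "c ^ card E / 2 \<le> prod d E - card E * \<eta>" using \<eta>E by linarith
        moreover have "\<beta> ^ card I \<le> (\<Prod>l\<in>I. prob (B l))"
          using prod_mono[of I "\<lambda>_. \<beta>" "\<lambda>l. prob (B l)"] B\<beta> \<beta> by simp
        moreover have "0 \<le> c ^ card E / 2" "0 \<le> \<beta> ^ card I" using c0 \<beta> by simp_all
        ultimately show ?thesis unfolding \<delta>_def by (intro mult_mono) linarith+
      qed
      moreover have "(\<integral>v. hom_weight E W v * (\<Prod>l\<in>I. indicator (B l) (v l)) \<partial>Mpow I) \<le>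
        (\<integral>v. hom_weight E W v \<partial>Mpow I)"
      proof -
        have m[measurable]: "hom_weight E W \<in> borel_measurable (Mpow I)"
          "(\<lambda>v. \<Prod>l\<in>I. indicator (B l) (v l) :: real) \<in> borel_measurable (Mpow I)"
          using hom_weight_measurable[OF W I(2)] B
          by (auto intro!: borel_measurable_prod measurable_compose[OF measurable_component_singleton borel_measurable_indicator])
        have i01: "0 \<le> (\<Prod>l\<in>I. indicator (B l) (v l) :: real)" "(\<Prod>l\<in>I. indicator (B l) (v l) :: real) \<le> 1"
          for v :: "'i \<Rightarrow> 'a" by (auto intro!: prod_nonneg prod_le_1)
        have hw: "0 \<le> hom_weight E W v" "hom_weight E W v \<le> 1" if "v \<in> space (Mpow I)" for v
          using hom_weight_01[OF W01 that I(2)] by auto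
        show ?thesis
        proof (intro Bochner_Integration.integral_mono)
          show "integrable (Mpow I) (hom_weight E W)"
            using hw by (intro integrable_bounded[where B=1] prob_space_power) (auto simp: m)
          show "integrable (Mpow I) (\<lambda>v. hom_weight E W v * (\<Prod>l\<in>I. indicator (B l) (v l)))"
          proof (rule integrable_bounded[where B=1, OF prob_space_power])
            show "\<bar>hom_weight E W v * (\<Prod>l\<in>I. indicator (B l) (v l))\<bar> \<le> 1" if "v \<in> space (Mpow I)" for v
              using hw[OF that] i01[of v] by (auto simp: abs_mult intro!: mult_le_one)
          qed measurable
          show "hom_weight E W v * (\<Prod>l\<in>I. indicator (B l) (v l)) \<le> hom_weight E W v" if "v \<in> space (Mpow I)" for v
            using hw[OF that] i01[of v] by (intro mult_left_le) auto
        qed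
      qed
      ultimately show False using small by linarith
    qed
    then show "\<exists>A\<in>sets M2. (\<integral>z. W (fst z) (snd z) * indicator (- A) z \<partial>M2) < \<epsilon> \<and>
      (\<forall>v\<in>space (Mpow I). \<exists>(i, j)\<in>E. (v i, v j) \<notin> A)"
      using A le by blast
  qed
qed

end

section \<open>The velocity of the removal rule\<close>

text \<open>Orienting every edge upwards matches the condition \<open>i < j\<close> in
  \<open>ind_weight\<close>, so that each factor is taken once.\<close>

definition edge_pairs :: "nat \<Rightarrow> nat set set \<Rightarrow> (nat \<times> nat) set" where
  "edge_pairs k G = {(i, j). i \<in> {1..k} \<and> j \<in> {1..k} \<and> i < j \<and> {i, j} \<in> G}"

lemma edge_pairs_subset: "edge_pairs k G \<subseteq> {1..k} \<times> {1..k}"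
  by (auto simp: edge_pairs_def)

lemma finite_edge_pairs: "finite (edge_pairs k G)"
  using edge_pairs_subset finite_subset by blast

lemma edge_pairs_irrefl: "(i, i) \<notin> edge_pairs k G"
  by (auto simp: edge_pairs_def)

lemma edge_pairs_asym: "(i, j) \<in> edge_pairs k G \<Longrightarrow> (j, i) \<notin> edge_pairs k G"
  by (auto simp: edge_pairs_def)

lemma edge_pairs_UN_converse:
  "edge_pairs k G \<union> (edge_pairs k G)\<inverse> = {(a, b). a \<in> {1..k} \<and> b \<in> {1..k} - {a} \<and> {a, b} \<in> G}"
  by (auto simp: edge_pairs_def insert_commute)

lemma graph_eq_image_edge_pairs:
  assumes "G \<in> graphs k"
  shows "(\<lambda>(i, j). {i, j}) ` edge_pairs k G = G"
proof (intro equalityI subsetI)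
  fix e assume e: "e \<in> G"
  then have "e \<subseteq> {1..k}" "card e = 2" using assms by (auto simp: graphs_def)
  then obtain i j where "e = {i, j}" "i \<noteq> j" "i \<in> {1..k}" "j \<in> {1..k}"
    by (metis card_2_iff insert_subset)
  then have "(i, j) \<in> edge_pairs k G \<or> (j, i) \<in> edge_pairs k G" "e = {i, j}" "e = {j, i}"
    using e by (auto simp: edge_pairs_def insert_commute)
  then show "e \<in> (\<lambda>(i, j). {i, j}) ` edge_pairs k G" by (metis (mono_tags, lifting) case_prod_conv image_eqI)
qed (auto simp: edge_pairs_def)

lemma edge_pairs_image:
  assumes "D \<subseteq> edge_pairs k (Pow {1..k})"
  shows "edge_pairs k ((\<lambda>(i, j). {i, j}) ` D) = D"
  using assms by (fastforce simp: edge_pairs_def doubleton_eq_iff)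

lemma ind_weight_eq:
  "ind_weight k G W v = hom_weight (edge_pairs k G) W v *
     hom_weight (edge_pairs k (Pow {1..k}) - edge_pairs k G) (\<lambda>x y. 1 - W x y) v"
proof -
  have "{(i, j). i \<in> {1..k} \<and> j \<in> {1..k} \<and> i < j \<and> {i, j} \<notin> G} =
    edge_pairs k (Pow {1..k}) - edge_pairs k G"
    by (auto simp: edge_pairs_def)
  then show ?thesis unfolding ind_weight_def hom_weight_def edge_pairs_def by simp
qed

text \<open>Expand the product of \<open>W + (1 - W)\<close> over all pairs outside
  \<open>F\<close>: its terms correspond to the graphs that contain \<open>F\<close>, and each of
  its factors is 1.\<close>

lemma sum_ind_weight:
  assumes F: "F \<in> graphs k"
  shows "(\<Sum>G | G \<in> graphs k \<and> F \<subseteq> G. ind_weight k G W v) = hom_weight (edge_pairs k F) W v"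
proof -
  let ?A = "edge_pairs k (Pow {1..k})" and ?E = "edge_pairs k F" and ?u = "\<lambda>(i, j). {i, j} :: nat set"
  let ?w = "\<lambda>(i, j). W (v i) (v j)"
  have EA: "?E \<subseteq> ?A" by (auto simp: edge_pairs_def)
  have fin: "finite ?A" by (rule finite_edge_pairs)
  have "(\<Sum>G | G \<in> graphs k \<and> F \<subseteq> G. ind_weight k G W v) =
    (\<Sum>H\<in>Pow (?A - ?E). prod ?w ?E * (prod ?w H * prod (\<lambda>e. 1 - ?w e) (?A - ?E - H)))"
  proof (rule sum.reindex_bij_witness[where i = "\<lambda>H. F \<union> ?u ` H" and j = "\<lambda>G. edge_pairs k G - ?E"])
    fix G assume G: "G \<in> {G. G \<in> graphs k \<and> F \<subseteq> G}"
    have EG: "?E \<subseteq> edge_pairs k G" using G by (auto simp: edge_pairs_def)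
    have "?u ` (edge_pairs k G - ?E) \<union> ?u ` ?E = ?u ` edge_pairs k G" using EG by blast
    then show "F \<union> ?u ` (edge_pairs k G - ?E) = G"
      using graph_eq_image_edge_pairs[OF F] graph_eq_image_edge_pairs[of G k] G by auto
    show "edge_pairs k G - ?E \<in> Pow (?A - ?E)" by (auto simp: edge_pairs_def)
    have "prod ?w (edge_pairs k G) = prod ?w ?E * prod ?w (edge_pairs k G - ?E)"
      using EG finite_edge_pairs[of k G] by (simp add: prod.subset_diff mult.commute)
    moreover have "?A - ?E - (edge_pairs k G - ?E) = ?A - edge_pairs k G" using EG by blast
    ultimately show "prod ?w ?E * (prod ?w (edge_pairs k G - ?E) *
        prod (\<lambda>e. 1 - ?w e) (?A - ?E - (edge_pairs k G - ?E))) = ind_weight k G W v"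
      unfolding ind_weight_eq hom_weight_def by (simp add: split_beta' mult.assoc)
  next
    fix H assume H: "H \<in> Pow (?A - ?E)"
    have "edge_pairs k (F \<union> ?u ` H) = ?E \<union> edge_pairs k (?u ` H)" by (auto simp: edge_pairs_def)
    also have "edge_pairs k (?u ` H) = H" using H by (intro edge_pairs_image) auto
    finally show "edge_pairs k (F \<union> ?u ` H) - ?E = H" using H by auto
    have "?u e \<subseteq> {1..k} \<and> card (?u e) = 2" if "e \<in> H" for e
      using H that by (auto simp: edge_pairs_def)
    then show "F \<union> ?u ` H \<in> {G. G \<in> graphs k \<and> F \<subseteq> G}"
      using F by (auto simp: graphs_def)
  qed
  also have "\<dots> = prod ?w ?E * (\<Prod>e\<in>?A - ?E. ?w e + (1 - ?w e))"
    using fin by (subst prod_add) (auto simp: sum_distrib_left)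
  finally show ?thesis by (simp add: hom_weight_def)
qed

context prob_space
begin

lemma upd2_section_measurable:
  assumes "a \<in> I" "b \<in> I" "a \<noteq> b" "x \<in> space M" "y \<in> space M"
  shows "(\<lambda>v. v(a := x, b := y)) \<in> Mpow (I - {a, b}) \<rightarrow>\<^sub>M Mpow I"
  using measurable_compose[OF measurable_Pair1' measurable_upd2_PiM[OF assms(1-3)], of "(x, y)" M]
    assms(4,5) by (simp add: space_pair_measure)

lemma integrable_upd2_section:
  fixes f :: "('i \<Rightarrow> 'a) \<Rightarrow> real"
  assumes ab: "a \<in> I" "b \<in> I" "a \<noteq> b" "x \<in> space M" "y \<in> space M"
    and "f \<in> borel_measurable (Mpow I)" "\<And>v. v \<in> space (Mpow I) \<Longrightarrow> \<bar>f v\<bar> \<le> B"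
  shows "integrable (Mpow (I - {a, b})) (\<lambda>v. f (v(a := x, b := y)))"
proof (rule integrable_bounded[OF prob_space_power])
  show "\<bar>f (v(a := x, b := y))\<bar> \<le> B" if "v \<in> space (Mpow (I - {a, b}))" for v
    using measurable_space[OF upd2_section_measurable[OF ab] that] by (rule assms(7))
qed (rule measurable_compose[OF upd2_section_measurable[OF ab] assms(6)])

lemma hom_weight_bounded:
  assumes "finite E" "E \<subseteq> I \<times> I" "v \<in> space (Mpow I)" "1 \<le> B"
    and "\<And>x y. x \<in> space M \<Longrightarrow> y \<in> space M \<Longrightarrow> \<bar>W x y\<bar> \<le> B"
  shows "\<bar>hom_weight E W v\<bar> \<le> B ^ card E"
proof -
  have "\<bar>hom_weight E W v\<bar> = (\<Prod>(i, j)\<in>E. \<bar>W (v i) (v j)\<bar>)"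
    unfolding hom_weight_def by (simp add: abs_prod split_beta')
  also have "\<dots> \<le> (\<Prod>e\<in>E. B)"
    using assms by (intro prod_mono) (auto simp: space_PiM PiE_def Pi_iff)
  finally show ?thesis by simp
qed

text \<open>\<open>rate\<close> counts each edge in both orientations, as the velocity does.\<close>

definition rate :: "'i set \<Rightarrow> ('i \<times> 'i) set \<Rightarrow> ('a \<Rightarrow> 'a \<Rightarrow> real) \<Rightarrow> 'a \<Rightarrow> 'a \<Rightarrow> real" where
  "rate I E W x y = (\<Sum>(a, b)\<in>E \<union> E\<inverse>.
     \<integral>v. hom_weight E W (v(a := x, b := y)) \<partial>Mpow (I - {a, b}))"

text \<open>Stated for all kernels and not only for graphons, since a competing trajectory might
  leave \<open>[0, 1]\<close>; the identity \<open>W + (1 - W) = 1\<close> behind it asks for no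
  bounds.\<close>

lemma velocity_removal_rule:
  assumes F: "F \<in> graphs k" and W: "kernel M W" and xy: "x \<in> space M" "y \<in> space M"
  shows "velocity M k (removal_rule F) W x y = - rate {1..k} (edge_pairs k F) W x y"
proof -
  have Wm: "(\<lambda>(x, y). W x y) \<in> borel_measurable M2" using W by (simp add: kernel_def)
  obtain B0 where B0: "\<And>x y. x \<in> space M \<Longrightarrow> y \<in> space M \<Longrightarrow> \<bar>W x y\<bar> \<le> B0"
    using W unfolding kernel_def by blast
  define B where "B = 1 + \<bar>B0\<bar>"
  have B: "\<bar>W x y\<bar> \<le> B" "\<bar>1 - W x y\<bar> \<le> B" if "x \<in> space M" "y \<in> space M" for x y
    using B0[OF that] by (auto simp: B_def)
  have B1: "1 \<le> B" by (simp add: B_def)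
  let ?J = "\<lambda>a b. Mpow ({1..k} - {a, b})"
  let ?A = "edge_pairs k (Pow {1..k})"
  have int: "integrable (?J a b) (\<lambda>v. ind_weight k G W (v(a := x, b := y)))"
    if "a \<in> {1..k}" "b \<in> {1..k} - {a}" for a b G
  proof (rule integrable_upd2_section)
    have "(\<lambda>(x, y). 1 - W x y) \<in> borel_measurable M2" using Wm by (simp add: split_beta')
    then show "ind_weight k G W \<in> borel_measurable (Mpow {1..k})"
      unfolding ind_weight_eq[abs_def]
      by (intro borel_measurable_times hom_weight_measurable Wm) (use edge_pairs_subset in auto)
    show "\<bar>ind_weight k G W v\<bar> \<le> B ^ card (edge_pairs k G) * B ^ card (?A - edge_pairs k G)"
      if "v \<in> space (Mpow {1..k})" for v
    proof -
      have s: "edge_pairs k G \<subseteq> {1..k} \<times> {1..k}" "?A - edge_pairs k G \<subseteq> {1..k} \<times> {1..k}"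
        using edge_pairs_subset by blast+
      have f: "finite (edge_pairs k G)" "finite (?A - edge_pairs k G)" using finite_edge_pairs by blast+
      show ?thesis unfolding ind_weight_eq abs_mult
        using hom_weight_bounded[OF f(1) s(1) that B1 B(1)] hom_weight_bounded[OF f(2) s(2) that B1 B(2)] B1
        by (intro mult_mono) auto
    qed
  qed (use that xy in auto)
  let ?c = "\<lambda>G H a b. (of_bool ({a, b} \<in> H - G) - of_bool ({a, b} \<in> G - H)) :: real"
  have "velocity M k (removal_rule F) W x y =
    (\<Sum>G\<in>graphs k. \<Sum>H\<in>graphs k. removal_rule F G H *
      (\<Sum>a\<in>{1..k}. \<Sum>b\<in>{1..k} - {a}. t_ind M k G a b W x y * ?c G H a b))"
    unfolding velocity_def by (simp add: sum_distrib_left mult.assoc)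
  also have "\<dots> = (\<Sum>G\<in>graphs k. if F \<subseteq> G then
      (\<Sum>a\<in>{1..k}. \<Sum>b\<in>{1..k} - {a}. t_ind M k G a b W x y * ?c G (G - F) a b) else 0)"
  proof (intro sum.cong refl)
    fix G assume G: "G \<in> graphs k"
    then have GF: "G - F \<in> graphs k" by (auto simp: graphs_def)
    show "(\<Sum>H\<in>graphs k. removal_rule F G H *
      (\<Sum>a\<in>{1..k}. \<Sum>b\<in>{1..k} - {a}. t_ind M k G a b W x y * ?c G H a b)) = (if F \<subseteq> G then
      (\<Sum>a\<in>{1..k}. \<Sum>b\<in>{1..k} - {a}. t_ind M k G a b W x y * ?c G (G - F) a b) else 0)"
      (is "(\<Sum>H\<in>graphs k. removal_rule F G H * ?X H) = _")
    proof (cases "F \<subseteq> G")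
      case True
      then have "(\<Sum>H\<in>graphs k. removal_rule F G H * ?X H) = (\<Sum>H\<in>graphs k. if H = G - F then ?X (G - F) else 0)"
        by (intro sum.cong) (auto simp: removal_rule_def)
      then show ?thesis using True GF finite_graphs by simp
    next
      case False
      then have "(\<Sum>H\<in>graphs k. removal_rule F G H * ?X H) = (\<Sum>H\<in>graphs k. 0)"
        by (intro sum.cong) (auto simp: removal_rule_def)
      then show ?thesis using False by simp
    qed
  qed
  also have "\<dots> = (\<Sum>G | G \<in> graphs k \<and> F \<subseteq> G.
      \<Sum>a\<in>{1..k}. \<Sum>b\<in>{1..k} - {a}. t_ind M k G a b W x y * ?c G (G - F) a b)"
    by (subst sum.inter_filter[symmetric]) (auto simp: finite_graphs intro!: sum.cong)
  \<comment> \<open>\<open>G - F\<close> has no edge outside \<open>G\<close>, and since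
    \<open>F \<subseteq> G\<close> it misses exactly the edges of \<open>F\<close>.\<close>
  also have "\<dots> = (\<Sum>G | G \<in> graphs k \<and> F \<subseteq> G.
      \<Sum>a\<in>{1..k}. \<Sum>b\<in>{1..k} - {a}. - (of_bool ({a, b} \<in> F) * t_ind M k G a b W x y))"
    by (intro sum.cong refl) auto
  also have "\<dots> = (\<Sum>a\<in>{1..k}. \<Sum>b\<in>{1..k} - {a}. \<Sum>G | G \<in> graphs k \<and> F \<subseteq> G.
      - (of_bool ({a, b} \<in> F) * t_ind M k G a b W x y))"
    by (subst sum.swap, intro sum.cong refl, subst sum.swap) simp
  also have "\<dots> = (\<Sum>a\<in>{1..k}. \<Sum>b\<in>{1..k} - {a}. - (of_bool ({a, b} \<in> F) *
      (\<integral>v. hom_weight (edge_pairs k F) W (v(a := x, b := y)) \<partial>?J a b)))"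
  proof (intro sum.cong refl)
    fix a b assume ab: "a \<in> {1..k}" "b \<in> {1..k} - {a}"
    have "(\<Sum>G | G \<in> graphs k \<and> F \<subseteq> G. t_ind M k G a b W x y) =
      (\<integral>v. (\<Sum>G | G \<in> graphs k \<and> F \<subseteq> G. ind_weight k G W (v(a := x, b := y))) \<partial>?J a b)"
      unfolding t_ind_def using int[OF ab] by (intro Bochner_Integration.integral_sum[symmetric])
    then show "(\<Sum>G | G \<in> graphs k \<and> F \<subseteq> G. - (of_bool ({a, b} \<in> F) * t_ind M k G a b W x y)) =
      - (of_bool ({a, b} \<in> F) * (\<integral>v. hom_weight (edge_pairs k F) W (v(a := x, b := y)) \<partial>?J a b))"
      unfolding sum_ind_weight[OF F] by (simp add: sum_negf sum_distrib_left[symmetric])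
  qed
  also have "\<dots> = - (\<Sum>(a, b)\<in>(SIGMA a:{1..k}. {1..k} - {a}). of_bool ({a, b} \<in> F) *
      (\<integral>v. hom_weight (edge_pairs k F) W (v(a := x, b := y)) \<partial>?J a b))"
    by (subst sum.Sigma[symmetric]) (auto simp: sum_negf)
  also have "(\<Sum>(a, b)\<in>(SIGMA a:{1..k}. {1..k} - {a}). of_bool ({a, b} \<in> F) *
      (\<integral>v. hom_weight (edge_pairs k F) W (v(a := x, b := y)) \<partial>?J a b)) =
      rate {1..k} (edge_pairs k F) W x y"
    unfolding rate_def edge_pairs_UN_converse
    by (intro sum.mono_neutral_cong_right) auto
  finally show ?thesis .
qed

end

text \<open>Dividing by \<open>B\<close> brings all factors into \<open>[-1, 1]\<close>, where a
  difference of products is at most the sum of the differences of the factors.\<close>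

lemma hom_weight_diff_le:
  assumes "finite E" "\<And>i j. (i, j) \<in> E \<Longrightarrow> \<bar>U (v i) (v j)\<bar> \<le> B \<and> \<bar>V (v i) (v j)\<bar> \<le> B" "1 \<le> B"
  shows "\<bar>hom_weight E U v - hom_weight E V v\<bar> \<le>
    B ^ card E * (\<Sum>(i, j)\<in>E. \<bar>U (v i) (v j) - V (v i) (v j)\<bar>)"
proof -
  let ?u = "\<lambda>(i, j). U (v i) (v j)" and ?w = "\<lambda>(i, j). V (v i) (v j)"
  have sc: "prod f E = B ^ card E * (\<Prod>e\<in>E. f e / B)" for f :: "_ \<Rightarrow> real"
    using assms(3) by (simp add: prod_dividef)
  have "\<bar>(\<Prod>e\<in>E. ?u e / B) - (\<Prod>e\<in>E. ?w e / B)\<bar> \<le> (\<Sum>e\<in>E. \<bar>?u e / B - ?w e / B\<bar>)"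
    using norm_prod_diff[of E "\<lambda>e. ?u e / B" "\<lambda>e. ?w e / B"] assms(2,3) by (fastforce simp: divide_simps)
  also have "\<dots> \<le> (\<Sum>e\<in>E. \<bar>?u e - ?w e\<bar>)"
  proof (intro sum_mono)
    fix e
    have "\<bar>?u e - ?w e\<bar> / B \<le> \<bar>?u e - ?w e\<bar> / 1" using assms(3) by (intro divide_left_mono) auto
    then show "\<bar>?u e / B - ?w e / B\<bar> \<le> \<bar>?u e - ?w e\<bar>"
      using assms(3) by (simp add: diff_divide_distrib[symmetric] abs_divide)
  qed
  finally have "B ^ card E * \<bar>(\<Prod>e\<in>E. ?u e / B) - (\<Prod>e\<in>E. ?w e / B)\<bar> \<le>
      B ^ card E * (\<Sum>e\<in>E. \<bar>?u e - ?w e\<bar>)"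
    using assms(3) by (intro mult_left_mono) auto
  then show ?thesis
    using assms(3) unfolding hom_weight_def sc[of ?u] sc[of ?w] right_diff_distrib[symmetric]
    by (simp add: abs_mult split_beta')
qed

section \<open>Estimates for the rate\<close>

context prob_space
begin

context
  fixes I :: "'i set" and E :: "('i \<times> 'i) set"
  assumes I: "finite I" "E \<subseteq> I \<times> I" and irr: "\<And>i. (i, i) \<notin> E"
begin

lemma finite_edges: "finite E" "finite (E \<union> E\<inverse>)"
  using I finite_subset by (auto intro: finite_subset)

lemma oriented_edge: "(a, b) \<in> E \<union> E\<inverse> \<Longrightarrow> a \<in> I \<and> b \<in> I \<and> a \<noteq> b"
  using I irr by auto

text \<open>Exchanging \<open>a\<close> and \<open>b\<close> permutes the oriented edges. Through
  this the solution remains symmetric at all times.\<close>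

lemma rate_sym: "rate I E W x y = rate I E W y x"
  unfolding rate_def
proof (rule sum.reindex_bij_witness[of _ prod.swap prod.swap])
  fix e assume "e \<in> E \<union> E\<inverse>"
  then obtain a b where "e = (a, b)" "a \<noteq> b" using oriented_edge by (cases e) blast
  then show "(case prod.swap e of (a, b) \<Rightarrow>
      \<integral>v. hom_weight E W (v(a := y, b := x)) \<partial>Mpow (I - {a, b})) =
    (case e of (a, b) \<Rightarrow> \<integral>v. hom_weight E W (v(a := x, b := y)) \<partial>Mpow (I - {a, b}))"
    by (simp add: insert_commute fun_upd_twist)
qed auto

lemma upd2_in_space:
  assumes "(a, b) \<in> E \<union> E\<inverse>" "x \<in> space M" "y \<in> space M" "v \<in> space (Mpow (I - {a, b}))"
  shows "v(a := x, b := y) \<in> space (Mpow I)"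
  using oriented_edge[OF assms(1)] assms(2-) by (intro measurable_space[OF upd2_section_measurable]) auto

lemma integrable_hom_weight_section:
  assumes ab: "(a, b) \<in> E \<union> E\<inverse>" and xy: "x \<in> space M" "y \<in> space M"
    and W: "(\<lambda>(x, y). W x y) \<in> borel_measurable M2" and "1 \<le> B"
    and "\<And>x y. x \<in> space M \<Longrightarrow> y \<in> space M \<Longrightarrow> \<bar>W x y\<bar> \<le> B"
  shows "integrable (Mpow (I - {a, b})) (\<lambda>v. hom_weight E W (v(a := x, b := y)))"
  using oriented_edge[OF ab] xy hom_weight_bounded[OF finite_edges(1) I(2) _ assms(5,6)]
  by (intro integrable_upd2_section[where B="B ^ card E"] hom_weight_measurable[OF W I(2)]) auto

lemma rate_bounds:
  assumes W: "(\<lambda>(x, y). W x y) \<in> borel_measurable M2" and xy: "x \<in> space M" "y \<in> space M"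
    and W01: "\<And>x y. x \<in> space M \<Longrightarrow> y \<in> space M \<Longrightarrow> 0 \<le> W x y \<and> W x y \<le> 1"
  shows "0 \<le> rate I E W x y" "rate I E W x y \<le> card (E \<union> E\<inverse>)"
proof -
  have a: "0 \<le> (\<integral>v. hom_weight E W (v(a := x, b := y)) \<partial>Mpow (I - {a, b}))"
    "(\<integral>v. hom_weight E W (v(a := x, b := y)) \<partial>Mpow (I - {a, b})) \<le> 1"
    if ab: "(a, b) \<in> E \<union> E\<inverse>" for a b
  proof -
    interpret J: prob_space "Mpow (I - {a, b})" by (rule prob_space_power)
    have h: "0 \<le> hom_weight E W (v(a := x, b := y))" "hom_weight E W (v(a := x, b := y)) \<le> 1"
      if "v \<in> space (Mpow (I - {a, b}))" for v
      using hom_weight_01[OF W01 upd2_in_space[OF ab xy that] I(2)] by auto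
    show "0 \<le> (\<integral>v. hom_weight E W (v(a := x, b := y)) \<partial>Mpow (I - {a, b}))"
      using h by (intro Bochner_Integration.integral_nonneg) auto
    show "(\<integral>v. hom_weight E W (v(a := x, b := y)) \<partial>Mpow (I - {a, b})) \<le> 1"
      using h W01 by (intro J.integral_le_const integrable_hom_weight_section[OF ab xy W, of 1]) (auto intro!: AE_I2 simp del: fun_upd_apply)
  qed
  show "0 \<le> rate I E W x y" unfolding rate_def using a by (intro sum_nonneg) auto
  have "rate I E W x y \<le> (\<Sum>e\<in>E \<union> E\<inverse>. 1)" unfolding rate_def using a by (intro sum_mono) auto
  then show "rate I E W x y \<le> card (E \<union> E\<inverse>)" by simp
qed

text \<open>Values in \<open>[0, 1]\<close> make the constant independent of the kernels: there is
  one term for each oriented edge, and in it \<open>card E\<close> factors change by at most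
  \<open>c\<close>.\<close>

lemma rate_lipschitz:
  assumes U: "(\<lambda>(x, y). U x y) \<in> borel_measurable M2" and V: "(\<lambda>(x, y). V x y) \<in> borel_measurable M2"
    and U01: "\<And>x y. x \<in> space M \<Longrightarrow> y \<in> space M \<Longrightarrow> 0 \<le> U x y \<and> U x y \<le> 1"
    and V01: "\<And>x y. x \<in> space M \<Longrightarrow> y \<in> space M \<Longrightarrow> 0 \<le> V x y \<and> V x y \<le> 1"
    and c: "\<And>x y. x \<in> space M \<Longrightarrow> y \<in> space M \<Longrightarrow> \<bar>U x y - V x y\<bar> \<le> c"
    and xy: "x \<in> space M" "y \<in> space M"
  shows "\<bar>rate I E U x y - rate I E V x y\<bar> \<le> real (card (E \<union> E\<inverse>) * card E) * c"
proof -
  have a: "\<bar>(\<integral>v. hom_weight E U (v(a := x, b := y)) \<partial>Mpow (I - {a, b})) -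
     (\<integral>v. hom_weight E V (v(a := x, b := y)) \<partial>Mpow (I - {a, b}))\<bar> \<le> card E * c"
    if ab: "(a, b) \<in> E \<union> E\<inverse>" for a b
  proof -
    interpret J: prob_space "Mpow (I - {a, b})" by (rule prob_space_power)
    note i = integrable_hom_weight_section[OF ab xy U, of 1] integrable_hom_weight_section[OF ab xy V, of 1]
    have i': "integrable (Mpow (I - {a, b})) (\<lambda>v. hom_weight E U (v(a := x, b := y)))"
      "integrable (Mpow (I - {a, b})) (\<lambda>v. hom_weight E V (v(a := x, b := y)))"
      using i U01 V01 by (simp_all add: abs_le_iff)
    have h: "\<bar>hom_weight E U (v(a := x, b := y)) - hom_weight E V (v(a := x, b := y))\<bar> \<le> card E * c"
      if v: "v \<in> space (Mpow (I - {a, b}))" for v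
    proof -
      define w where "w = v(a := x, b := y)"
      have s: "w i \<in> space M" if "i \<in> I" for i
        using upd2_in_space[OF ab xy v] that unfolding w_def[symmetric] by (auto simp: space_PiM PiE_def Pi_iff)
      then have s': "\<bar>U (w i) (w j)\<bar> \<le> 1 \<and> \<bar>V (w i) (w j)\<bar> \<le> 1 \<and> \<bar>U (w i) (w j) - V (w i) (w j)\<bar> \<le> c"
        if "(i, j) \<in> E" for i j
        using U01[of "w i" "w j"] V01[of "w i" "w j"] c[of "w i" "w j"] s[of i] s[of j] that I(2) by auto
      have "\<bar>hom_weight E U w - hom_weight E V w\<bar> \<le> 1 ^ card E * (\<Sum>(i, j)\<in>E. \<bar>U (w i) (w j) - V (w i) (w j)\<bar>)"
        using s' by (intro hom_weight_diff_le finite_edges) auto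
      also have "\<dots> \<le> 1 ^ card E * (\<Sum>e\<in>E. c)" using s' by (intro mult_left_mono sum_mono) auto
      finally show ?thesis by (simp add: w_def)
    qed
    have "\<bar>\<integral>v. hom_weight E U (v(a := x, b := y)) - hom_weight E V (v(a := x, b := y)) \<partial>Mpow (I - {a, b})\<bar> \<le>
       (\<integral>v. \<bar>hom_weight E U (v(a := x, b := y)) - hom_weight E V (v(a := x, b := y))\<bar> \<partial>Mpow (I - {a, b}))"
      by (rule integral_abs_bound)
    also have "\<dots> \<le> card E * c"
      using h i' by (intro J.integral_le_const integrable_abs Bochner_Integration.integrable_diff) (auto intro!: AE_I2 simp del: fun_upd_apply)
    finally show ?thesis using i' by simp
  qed
  have "\<bar>rate I E U x y - rate I E V x y\<bar> \<le> (\<Sum>e\<in>E \<union> E\<inverse>. card E * c)"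
    unfolding rate_def sum_subtractf[symmetric]
    by (rule order_trans[OF sum_abs sum_mono]) (use a in auto)
  then show ?thesis by (simp add: mult.assoc)
qed

text \<open>Every copy through \<open>(x, y)\<close> has a factor at this pair in one of its two
  orders. This is what stops the flow at zero.\<close>

lemma rate_eq_0:
  assumes "W x y = 0" "W y x = 0"
  shows "rate I E W x y = 0"
proof -
  have "hom_weight E W (v(a := x, b := y)) = 0" if "(a, b) \<in> E \<union> E\<inverse>" for a b v
  proof -
    have ne: "a \<noteq> b" using oriented_edge[OF that] by simp
    have "\<exists>e\<in>E. (case e of (i, j) \<Rightarrow> W ((v(a := x, b := y)) i) ((v(a := x, b := y)) j)) = 0"
      using that
    proof
      assume "(a, b) \<in> E" then show ?thesis using ne assms by (intro bexI[of _ "(a, b)"]) auto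
    next
      assume "(a, b) \<in> E\<inverse>" then show ?thesis using ne assms by (intro bexI[of _ "(b, a)"]) auto
    qed
    then show ?thesis unfolding hom_weight_def by (intro prod_zero finite_edges)
  qed
  then show ?thesis unfolding rate_def by (intro sum.neutral) auto
qed

text \<open>The parameter will be time: the Picard operator integrates the rate over time, and the
  result is measurable in the points only if the integrand is jointly measurable.\<close>

lemma rate_measurable_param:
  assumes U: "(\<lambda>(t, z). U t (fst z) (snd z)) \<in> borel_measurable (N \<Otimes>\<^sub>M M2)"
  shows "(\<lambda>(t, z). rate I E (U t) (fst z) (snd z)) \<in> borel_measurable (N \<Otimes>\<^sub>M M2)"
proof -
  have "(\<lambda>w. \<integral>v. hom_weight E (U (fst w)) (v(a := fst (snd w), b := snd (snd w))) \<partial>Mpow (I - {a, b}))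
     \<in> borel_measurable (N \<Otimes>\<^sub>M M2)" if ab: "(a, b) \<in> E \<union> E\<inverse>" for a b
  proof -
    let ?J = "Mpow (I - {a, b})"
    let ?v = "\<lambda>q. (snd q)(a := fst (snd (fst q)), b := snd (snd (fst q)))"
    interpret J: prob_space ?J by (rule prob_space_power)
    have "(\<lambda>q. (snd (fst q), snd q)) \<in> (N \<Otimes>\<^sub>M M2) \<Otimes>\<^sub>M ?J \<rightarrow>\<^sub>M M2 \<Otimes>\<^sub>M ?J" by measurable
    from measurable_compose[OF this measurable_upd2_PiM] oriented_edge[OF ab]
    have v: "?v \<in> (N \<Otimes>\<^sub>M M2) \<Otimes>\<^sub>M ?J \<rightarrow>\<^sub>M Mpow I" by (simp add: split_beta' del: fun_upd_apply)
    have "(\<lambda>q. U (fst (fst q)) (?v q i) (?v q j)) \<in> borel_measurable ((N \<Otimes>\<^sub>M M2) \<Otimes>\<^sub>M ?J)"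
      if "(i, j) \<in> E" for i j
    proof -
      have ij: "i \<in> I" "j \<in> I" using that I(2) by auto
      have "(\<lambda>q. (fst (fst q), (?v q i, ?v q j))) \<in> (N \<Otimes>\<^sub>M M2) \<Otimes>\<^sub>M ?J \<rightarrow>\<^sub>M N \<Otimes>\<^sub>M M2"
        by (intro measurable_Pair measurable_compose[OF v measurable_component_singleton] ij) measurable
      from measurable_compose[OF this U] show ?thesis by (simp del: fun_upd_apply)
    qed
    then have "(\<lambda>q. hom_weight E (U (fst (fst q))) (?v q)) \<in> borel_measurable ((N \<Otimes>\<^sub>M M2) \<Otimes>\<^sub>M ?J)"
      unfolding hom_weight_def by (intro borel_measurable_prod) (auto simp del: fun_upd_apply)
    then show ?thesis
      by (intro J.borel_measurable_lebesgue_integral) (simp add: split_beta' del: fun_upd_apply)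
  qed
  then show ?thesis unfolding rate_def split_beta' by (intro borel_measurable_sum) auto
qed

lemma rate_measurable:
  assumes W: "(\<lambda>(x, y). W x y) \<in> borel_measurable M2"
  shows "(\<lambda>z. rate I E W (fst z) (snd z)) \<in> borel_measurable M2"
proof -
  have "(\<lambda>(t, z). rate I E W (fst z) (snd z)) \<in> borel_measurable ((borel :: real measure) \<Otimes>\<^sub>M M2)"
    using W by (intro rate_measurable_param) (simp add: split_beta')
  from measurable_compose[OF measurable_Pair1'[of "0::real"] this] show ?thesis by simp
qed

text \<open>Double counting: a copy occurs once for each of its oriented edges, with the weight
  \<phi> of that edge. Different weights later give the total loss and its comparison with the loss
  outside a set.\<close>

lemma integral_rate:
  assumes W: "(\<lambda>(x, y). W x y) \<in> borel_measurable M2" and B: "1 \<le> B"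
    "\<And>x y. x \<in> space M \<Longrightarrow> y \<in> space M \<Longrightarrow> \<bar>W x y\<bar> \<le> B"
    and \<phi>: "\<phi> \<in> borel_measurable M2" "\<And>z. z \<in> space M2 \<Longrightarrow> \<bar>\<phi> z\<bar> \<le> C"
  shows "(\<integral>z. \<phi> z * rate I E W (fst z) (snd z) \<partial>M2) =
      (\<Sum>(a, b)\<in>E \<union> E\<inverse>. \<integral>v. \<phi> (v a, v b) * hom_weight E W v \<partial>Mpow I)"
    and "integrable M2 (\<lambda>z. \<phi> z * rate I E W (fst z) (snd z))"
    and "(a, b) \<in> E \<union> E\<inverse> \<Longrightarrow> integrable (Mpow I) (\<lambda>v. \<phi> (v a, v b) * hom_weight E W v)"
proof -
  have int: "integrable (Mpow I) (\<lambda>v. \<phi> (v a, v b) * hom_weight E W v)"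
    if ab: "(a, b) \<in> E \<union> E\<inverse>" for a b
  proof (rule integrable_bounded[OF prob_space_power])
    show "(\<lambda>v. \<phi> (v a, v b) * hom_weight E W v) \<in> borel_measurable (Mpow I)"
      using oriented_edge[OF ab]
      by (intro borel_measurable_times hom_weight_measurable[OF W I(2)]
        measurable_compose[OF measurable_pair_component \<phi>(1)]) auto
    show "\<bar>\<phi> (v a, v b) * hom_weight E W v\<bar> \<le> C * B ^ card E" if v: "v \<in> space (Mpow I)" for v
    proof -
      have "(v a, v b) \<in> space M2"
        using v oriented_edge[OF ab] by (auto simp: space_PiM space_pair_measure PiE_def Pi_iff)
      then show ?thesis unfolding abs_mult
        using \<phi>(2) hom_weight_bounded[OF finite_edges(1) I(2) v B] abs_ge_zero[of "\<phi> (v a, v b)"]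
        by (intro mult_mono) (auto intro: order_trans[OF abs_ge_zero])
    qed
  qed
  then show "(a, b) \<in> E \<union> E\<inverse> \<Longrightarrow> integrable (Mpow I) (\<lambda>v. \<phi> (v a, v b) * hom_weight E W v)" .
  let ?T = "\<lambda>e z. \<integral>v. \<phi> z * hom_weight E W (v(fst e := fst z, snd e := snd z)) \<partial>Mpow (I - {fst e, snd e})"
  have eq: "\<phi> z * rate I E W (fst z) (snd z) = (\<Sum>e\<in>E \<union> E\<inverse>. ?T e z)" for z
    unfolding rate_def by (simp add: sum_distrib_left split_beta' del: fun_upd_apply)
  have T: "integrable M2 (?T e)"
    "(\<integral>z. ?T e z \<partial>M2) = (\<integral>v. \<phi> (v (fst e), v (snd e)) * hom_weight E W v \<partial>Mpow I)"
    if e: "e \<in> E \<union> E\<inverse>" for e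
  proof -
    have e': "fst e \<in> I" "snd e \<in> I" "fst e \<noteq> snd e" "(fst e, snd e) \<in> E \<union> E\<inverse>"
      using oriented_edge[of "fst e" "snd e"] e by auto
    show "integrable M2 (?T e)"
      using integral_PiM_pair(3)[OF I(1) e'(1-3) int[OF e'(4)]] e'(3) by simp
    show "(\<integral>z. ?T e z \<partial>M2) = (\<integral>v. \<phi> (v (fst e), v (snd e)) * hom_weight E W v \<partial>Mpow I)"
      using integral_PiM_pair(1)[OF I(1) e'(1-3) int[OF e'(4)]] e'(3) by simp
  qed
  show "integrable M2 (\<lambda>z. \<phi> z * rate I E W (fst z) (snd z))"
    unfolding eq using T(1) by (rule Bochner_Integration.integrable_sum)
  show "(\<integral>z. \<phi> z * rate I E W (fst z) (snd z) \<partial>M2) =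
      (\<Sum>(a, b)\<in>E \<union> E\<inverse>. \<integral>v. \<phi> (v a, v b) * hom_weight E W v \<partial>Mpow I)"
    unfolding eq using T by (subst Bochner_Integration.integral_sum) (auto simp: split_beta')
qed

end
end

section \<open>Existence of the removal flow\<close>

text \<open>The equation is first solved with the kernel clipped to \<open>[0, 1]\<close>, where the rate is globally
  Lipschitz; the solution then turns out to stay in \<open>[0, 1]\<close>, so clipping has no effect.\<close>

definition clip :: "real \<Rightarrow> real" where
  "clip r = max 0 (min 1 r)"

lemma clip_bounds: "0 \<le> clip r" "clip r \<le> 1"
  by (auto simp: clip_def)

lemma clip_id: "0 \<le> r \<Longrightarrow> r \<le> 1 \<Longrightarrow> clip r = r"
  by (auto simp: clip_def)

lemma clip_nonpos: "r \<le> 0 \<Longrightarrow> clip r = 0"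
  by (auto simp: clip_def)

lemma clip_diff_le: "\<bar>clip r - clip s\<bar> \<le> \<bar>r - s\<bar>"
  by (auto simp: clip_def)

lemma clip_measurable[measurable]: "clip \<in> borel_measurable borel"
  unfolding clip_def[abs_def] by measurable

lemma integrable_Icc_bounded:
  fixes f :: "real \<Rightarrow> real"
  assumes "f \<in> borel_measurable lborel" "\<And>s. \<bar>f s\<bar> \<le> B"
  shows "integrable lborel (\<lambda>s. indicator {0..t} s * f s)"
proof (rule Bochner_Integration.integrable_bound[where f="\<lambda>s. B * indicator {0..t} s"])
  have "integrable lborel (indicator {0..t} :: real \<Rightarrow> real)"
    by (rule integrable_real_indicator) (auto simp: emeasure_lborel_Icc_eq)
  then show "integrable lborel (\<lambda>s. B * indicator {0..t} s)" by simp
  show "AE s in lborel. norm (indicator {0..t} s * f s) \<le> norm (B * indicator {0..t} s)"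
  proof (rule AE_I2)
    show "norm (indicator {0..t} s * f s) \<le> norm (B * indicator {0..t} s)" for s
      using assms(2)[of s] by (auto simp: indicator_def)
  qed
qed (use assms in measurable)

lemma integral_exp_Icc:
  assumes "0 \<le> t" "0 < L"
  shows "(\<integral>s. indicator {0..t} s * (c * exp (L * s)) \<partial>lborel) = c * (exp (L * t) - 1) / (L::real)"
    "integrable lborel (\<lambda>s. indicator {0..t} s * (c * exp (L * s)))"
proof -
  have "has_bochner_integral lborel (\<lambda>s. c * exp (L * s) * indicator {0..t} s) (c * exp (L * t) / L - c * exp (L * 0) / L)"
    using assms by (intro has_bochner_integral_FTC_Icc_real) (auto intro!: derivative_eq_intros continuous_intros)
  then show "(\<integral>s. indicator {0..t} s * (c * exp (L * s)) \<partial>lborel) = c * (exp (L * t) - 1) / (L::real)"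
    "integrable lborel (\<lambda>s. indicator {0..t} s * (c * exp (L * s)))"
    by (auto simp: has_bochner_integral_iff mult.commute right_diff_distrib diff_divide_distrib)
qed

text \<open>A mean value estimate for an integrand that is merely measurable. Its centre
  \<open>c\<close> will be 0 for Lipschitz bounds, the midpoint of the range for monotonicity and
  the present rate for differentiability.\<close>

lemma integral_increment_le:
  fixes f :: "real \<Rightarrow> real"
  assumes f: "f \<in> borel_measurable lborel" "\<And>s. \<bar>f s\<bar> \<le> B" and ab: "0 \<le> a" "a \<le> b"
    and c: "\<And>s. a \<le> s \<Longrightarrow> s \<le> b \<Longrightarrow> \<bar>f s - c\<bar> \<le> D"
  shows "\<bar>(\<integral>s. indicator {0..b} s * f s \<partial>lborel) - (\<integral>s. indicator {0..a} s * f s \<partial>lborel) - c * (b - a)\<bar> \<le> D * (b - a)"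
proof -
  have i: "integrable lborel (\<lambda>s. indicator {0..t} s * f s)" for t
    using integrable_Icc_bounded[OF f] .
  have e: "(\<lambda>s. indicator {0..b} s * f s - indicator {0..a} s * f s - c * indicator {a<..b} s) =
     (\<lambda>s. indicator {a<..b} s * (f s - c))"
    using ab by (auto simp: indicator_def fun_eq_iff)
  have i2: "integrable lborel (\<lambda>s. indicator {a<..b} s * (f s - c))"
    unfolding e[symmetric] using i ab by (intro Bochner_Integration.integrable_diff) auto
  have "(\<integral>s. indicator {0..b} s * f s \<partial>lborel) - (\<integral>s. indicator {0..a} s * f s \<partial>lborel) - c * (b - a) =
     (\<integral>s. indicator {0..b} s * f s - indicator {0..a} s * f s - c * indicator {a<..b} s \<partial>lborel)"
    using i ab by (subst Bochner_Integration.integral_diff, auto)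
  also have "\<bar>\<dots>\<bar> \<le> (\<integral>s. \<bar>indicator {a<..b} s * (f s - c)\<bar> \<partial>lborel)"
    unfolding e by (rule integral_abs_bound)
  also have "\<dots> \<le> (\<integral>s. D * indicator {a<..b} s \<partial>lborel)"
  proof (intro Bochner_Integration.integral_mono integrable_abs i2)
    have "integrable lborel (indicator {a<..b} :: real \<Rightarrow> real)"
      using ab by (intro integrable_real_indicator) auto
    then show "integrable lborel (\<lambda>s. D * indicator {a<..b} s)" by simp
  qed (use c in \<open>auto simp: indicator_def\<close>)
  also have "\<dots> = D * (b - a)" using ab by simp
  finally show ?thesis .
qed

section \<open>The Picard operator\<close>

context prob_space
begin

lemma rate_cong:
  assumes I: "E \<subseteq> I \<times> I" "\<And>i. (i, i) \<notin> E" and xy: "x \<in> space M" "y \<in> space M"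
    and eq: "\<And>x y. x \<in> space M \<Longrightarrow> y \<in> space M \<Longrightarrow> U x y = V x y"
  shows "rate I E U x y = rate I E V x y"
  unfolding rate_def
proof (intro sum.cong refl, clarify, intro Bochner_Integration.integral_cong refl)
  fix a b v assume ab: "(a, b) \<in> E \<union> E\<inverse>" and v: "v \<in> space (Mpow (I - {a, b}))"
  have "v(a := x, b := y) \<in> space (Mpow I)"
    using ab I xy by (intro measurable_space[OF upd2_section_measurable v]) auto
  then have "(v(a := x, b := y)) i \<in> space M" if "i \<in> I" for i
    using that by (auto simp: space_PiM PiE_def Pi_iff)
  then show "hom_weight E U (v(a := x, b := y)) = hom_weight E V (v(a := x, b := y))"
    unfolding hom_weight_def using I by (intro prod.cong refl) (auto intro!: eq simp del: fun_upd_apply)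
qed

definition jointly_measurable :: "(real \<Rightarrow> 'a \<Rightarrow> 'a \<Rightarrow> real) \<Rightarrow> bool" where
  "jointly_measurable U \<longleftrightarrow> (\<lambda>(t, z). U t (fst z) (snd z)) \<in> borel_measurable (lborel \<Otimes>\<^sub>M M2)"

definition clipped :: "(real \<Rightarrow> 'a \<Rightarrow> 'a \<Rightarrow> real) \<Rightarrow> real \<Rightarrow> 'a \<Rightarrow> 'a \<Rightarrow> real" where
  "clipped U t x y = clip (U t x y)"

text \<open>The sign is that of the velocity. Clipping acts inside the rate only, while the path
  itself is unrestricted.\<close>

definition picard_op :: "'i set \<Rightarrow> ('i \<times> 'i) set \<Rightarrow> ('a \<Rightarrow> 'a \<Rightarrow> real) \<Rightarrow> (real \<Rightarrow> 'a \<Rightarrow> 'a \<Rightarrow> real) \<Rightarrow>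
    real \<Rightarrow> 'a \<Rightarrow> 'a \<Rightarrow> real" where
  "picard_op I E W U t x y = W x y - (\<integral>s. indicator {0..t} s * rate I E (clipped U s) x y \<partial>lborel)"

lemma jointly_measurable_section:
  assumes "jointly_measurable U"
  shows "(\<lambda>(x, y). U t x y) \<in> borel_measurable M2"
  using measurable_compose[OF measurable_Pair1'[of t lborel M2] assms[unfolded jointly_measurable_def]]
  by (simp add: split_beta')

lemma jointly_measurable_clipped:
  assumes "jointly_measurable U"
  shows "jointly_measurable (clipped U)"
  using measurable_compose[OF assms[unfolded jointly_measurable_def] clip_measurable]
  by (simp add: jointly_measurable_def clipped_def split_beta')

context
  fixes I :: "'i set" and E :: "('i \<times> 'i) set"
  assumes I: "finite I" "E \<subseteq> I \<times> I" and irr: "\<And>i. (i, i) \<notin> E"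
begin

lemma clipped_rate_measurable:
  assumes U: "jointly_measurable U" and xy: "x \<in> space M" "y \<in> space M"
  shows "(\<lambda>s. rate I E (clipped U s) x y) \<in> borel_measurable lborel"
proof -
  have "(\<lambda>(t, z). rate I E (clipped U t) (fst z) (snd z)) \<in> borel_measurable (lborel \<Otimes>\<^sub>M M2)"
    using jointly_measurable_clipped[OF U] unfolding jointly_measurable_def
    by (rule rate_measurable_param[OF I irr])
  from measurable_compose[OF measurable_Pair2'[of "(x, y)"] this] xy show ?thesis
    by (simp add: space_pair_measure)
qed

lemma clipped_rate_bounds:
  assumes U: "jointly_measurable U" and xy: "x \<in> space M" "y \<in> space M"
  shows "0 \<le> rate I E (clipped U s) x y" "rate I E (clipped U s) x y \<le> card (E \<union> E\<inverse>)"
    "\<bar>rate I E (clipped U s) x y\<bar> \<le> card (E \<union> E\<inverse>)"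
proof -
  have "0 \<le> clipped U s x y \<and> clipped U s x y \<le> 1" for x y by (simp add: clipped_def clip_bounds)
  note b = rate_bounds[OF I irr jointly_measurable_section[OF jointly_measurable_clipped[OF U]] xy this]
  show "0 \<le> rate I E (clipped U s) x y" "rate I E (clipped U s) x y \<le> card (E \<union> E\<inverse>)"
    "\<bar>rate I E (clipped U s) x y\<bar> \<le> card (E \<union> E\<inverse>)" using b by auto
qed

lemma clipped_rate_lipschitz:
  assumes U: "jointly_measurable U" and V: "jointly_measurable V" and xy: "x \<in> space M" "y \<in> space M"
    and c: "\<And>x y. x \<in> space M \<Longrightarrow> y \<in> space M \<Longrightarrow> \<bar>U s x y - V t x y\<bar> \<le> c"
  shows "\<bar>rate I E (clipped U s) x y - rate I E (clipped V t) x y\<bar> \<le> real (card (E \<union> E\<inverse>) * card E) * c"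
proof (rule rate_lipschitz[OF I irr _ _ _ _ _ xy])
  show "(\<lambda>(x, y). clipped U s x y) \<in> borel_measurable M2" "(\<lambda>(x, y). clipped V t x y) \<in> borel_measurable M2"
    using jointly_measurable_section jointly_measurable_clipped U V by blast+
  show "\<bar>clipped U s x y - clipped V t x y\<bar> \<le> c" if "x \<in> space M" "y \<in> space M" for x y
    using clip_diff_le[of "U s x y" "V t x y"] c[OF that] by (simp add: clipped_def)
qed (auto simp: clipped_def clip_bounds)

lemma jointly_measurable_picard_op:
  assumes U: "jointly_measurable U" and W: "(\<lambda>(x, y). W x y) \<in> borel_measurable M2"
  shows "jointly_measurable (picard_op I E W U)"
proof -
  have R: "(\<lambda>(t, z). rate I E (clipped U t) (fst z) (snd z)) \<in> borel_measurable (lborel \<Otimes>\<^sub>M M2)"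
    using jointly_measurable_clipped[OF U] unfolding jointly_measurable_def
    by (rule rate_measurable_param[OF I irr])
  have "(\<lambda>q. (snd q, snd (fst q))) \<in> (lborel \<Otimes>\<^sub>M M2) \<Otimes>\<^sub>M lborel \<rightarrow>\<^sub>M (lborel :: real measure) \<Otimes>\<^sub>M M2"
    by measurable
  from measurable_compose[OF this R]
  have R': "(\<lambda>q. rate I E (clipped U (snd q)) (fst (snd (fst q))) (snd (snd (fst q)))) \<in>
     borel_measurable ((lborel \<Otimes>\<^sub>M M2) \<Otimes>\<^sub>M lborel)" by simp
  have "(\<lambda>q::(real \<times> 'a \<times> 'a) \<times> real. indicator {0..fst (fst q)} (snd q) :: real) \<in> borel_measurable ((lborel \<Otimes>\<^sub>M M2) \<Otimes>\<^sub>M lborel)"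
  proof -
    have e: "(\<lambda>q. indicator {0..fst (fst q)} (snd q) :: real) =
      (\<lambda>q::(real \<times> 'a \<times> 'a) \<times> real. indicator {0..} (snd q) * indicator {0..} (fst (fst q) - snd q))"
      by (auto simp: indicator_def fun_eq_iff)
    have m: "(\<lambda>q. fst (fst q)) \<in> borel_measurable ((lborel \<Otimes>\<^sub>M M2) \<Otimes>\<^sub>M lborel)"
      "(\<lambda>q. snd q) \<in> borel_measurable ((lborel \<Otimes>\<^sub>M M2) \<Otimes>\<^sub>M lborel)"
      using measurable_compose[OF measurable_fst measurable_fst[of "lborel :: real measure" M2], of lborel]
        measurable_snd[of "lborel \<Otimes>\<^sub>M M2" "lborel :: real measure"] by simp_all
    show ?thesis unfolding e
      by (intro borel_measurable_times measurable_compose[OF _ borel_measurable_indicator[where M="borel :: real measure"]] borel_measurable_diff m) auto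
  qed
  from borel_measurable_times[OF this R']
  have "(\<lambda>w. \<integral>s. indicator {0..fst w} s * rate I E (clipped U s) (fst (snd w)) (snd (snd w)) \<partial>lborel)
     \<in> borel_measurable (lborel \<Otimes>\<^sub>M M2)"
    by (intro lborel.borel_measurable_lebesgue_integral) (simp add: split_beta')
  moreover have "(\<lambda>w. W (fst (snd w)) (snd (snd w))) \<in> borel_measurable ((lborel :: real measure) \<Otimes>\<^sub>M M2)"
    using measurable_compose[OF measurable_snd W] by (simp add: split_beta')
  ultimately show ?thesis unfolding jointly_measurable_def picard_op_def split_beta'
    by (intro borel_measurable_diff)
qed

text \<open>The weight \<open>exp (2 * L * t)\<close> makes the operator a contraction by 1/2 on the
  whole half-line at once, so that no solutions on short intervals have to be glued. The summand 1
  keeps \<open>L\<close> positive if there are no edges.\<close>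

lemma picard_op_contraction:
  fixes c :: real
  defines "L \<equiv> real (card (E \<union> E\<inverse>) * card E) + 1"
  assumes U: "jointly_measurable U" and V: "jointly_measurable V"
    and c: "\<And>s x y. 0 \<le> s \<Longrightarrow> x \<in> space M \<Longrightarrow> y \<in> space M \<Longrightarrow> \<bar>U s x y - V s x y\<bar> \<le> c * exp (2 * L * s)"
    and t: "0 \<le> t" and xy: "x \<in> space M" "y \<in> space M"
  shows "\<bar>picard_op I E W U t x y - picard_op I E W V t x y\<bar> \<le> c / 2 * exp (2 * L * t)"
proof -
  have L: "L > 0" unfolding L_def by (rule add_nonneg_pos) simp_all
  have c0: "0 \<le> c" using c[of 0 x y] xy by (simp add: order_trans[OF abs_ge_zero])
  let ?f = "\<lambda>U s. indicator {0..t} s * rate I E (clipped U s) x y"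
  have i: "integrable lborel (?f U)" "integrable lborel (?f V)"
    using U V xy by (auto intro!: integrable_Icc_bounded clipped_rate_measurable clipped_rate_bounds)
  have "\<bar>picard_op I E W U t x y - picard_op I E W V t x y\<bar> = \<bar>\<integral>s. ?f V s - ?f U s \<partial>lborel\<bar>"
    using i by (simp add: picard_op_def)
  also have "\<dots> \<le> (\<integral>s. \<bar>?f V s - ?f U s\<bar> \<partial>lborel)" by (rule integral_abs_bound)
  also have "\<dots> \<le> (\<integral>s. indicator {0..t} s * (L * c * exp (2 * L * s)) \<partial>lborel)"
  proof (intro Bochner_Integration.integral_mono integral_exp_Icc(2))
    fix s :: real
    show "\<bar>?f V s - ?f U s\<bar> \<le> indicator {0..t} s * (L * c * exp (2 * L * s))"
    proof (cases "s \<in> {0..t}")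
      case True
      have "\<bar>rate I E (clipped U s) x y - rate I E (clipped V s) x y\<bar> \<le> real (card (E \<union> E\<inverse>) * card E) * (c * exp (2 * L * s))"
        using True c by (intro clipped_rate_lipschitz[OF U V xy]) auto
      also have "\<dots> \<le> L * (c * exp (2 * L * s))" using c0 by (intro mult_right_mono) (auto simp: L_def)
      finally show ?thesis using True by (simp add: abs_minus_commute mult.assoc)
    qed simp
  qed (use i L t in auto)
  also have "\<dots> = L * c * (exp (2 * L * t) - 1) / (2 * L)" using L t by (intro integral_exp_Icc) auto
  also have "\<dots> \<le> c / 2 * exp (2 * L * t)" using L c0 by (simp add: field_simps)
  finally show ?thesis .
qed

end
end

lemma integral_Icc_same:
  fixes f :: "real \<Rightarrow> real"
  assumes "f \<in> borel_measurable lborel"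
  shows "(\<integral>s. indicator {c..c} s * f s \<partial>lborel) = 0"
proof -
  have "AE s in lborel. indicator {c..c} s * f s = 0"
    using AE_lborel_singleton[of c] by eventually_elim (auto simp: indicator_def)
  then show ?thesis by (rule integral_eq_zero_AE)
qed

context prob_space
begin

context
  fixes I :: "'i set" and E :: "('i \<times> 'i) set"
  assumes I: "finite I" "E \<subseteq> I \<times> I" and irr: "\<And>i. (i, i) \<notin> E"
begin

text \<open>Picard iteration at each point separately, starting from the constant path
  \<open>W\<close>. The solution is a pointwise limit of a sequence, which preserves joint
  measurability.\<close>

lemma picard_fixpoint:
  assumes W: "(\<lambda>(x, y). W x y) \<in> borel_measurable M2"
  obtains U where "jointly_measurable U"
    "\<And>t x y. 0 \<le> t \<Longrightarrow> x \<in> space M \<Longrightarrow> y \<in> space M \<Longrightarrow> U t x y = picard_op I E W U t x y"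
proof -
  define L where "L = real (card (E \<union> E\<inverse>) * card E) + 1"
  define K where "K = real (card (E \<union> E\<inverse>))"
  have L1: "L \<ge> 1" unfolding L_def by simp
  have K0: "K \<ge> 0" by (simp add: K_def)
  define X where "X n = (picard_op I E W ^^ n) (\<lambda>_. W)" for n
  have X_Suc: "X (Suc n) = picard_op I E W (X n)" for n by (simp add: X_def)
  have jm: "jointly_measurable (X n)" for n
  proof (induction n)
    case 0
    have "(\<lambda>(t::real, z). W (fst z) (snd z)) \<in> borel_measurable (lborel \<Otimes>\<^sub>M M2)"
      using measurable_compose[OF measurable_snd W] by (simp add: split_beta')
    then show ?case by (simp add: X_def jointly_measurable_def)
  next
    case (Suc n)
    then show ?case unfolding X_Suc by (intro jointly_measurable_picard_op[OF I irr] W)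
  qed
  \<comment> \<open>The first step is at most \<open>K * t\<close>, and \<open>t\<close> is below
    the exponential weight; every further iteration halves the difference.\<close>
  have diff: "\<bar>X (Suc n) t x y - X n t x y\<bar> \<le> K / 2 ^ n * exp (2 * L * t)"
    if "0 \<le> t" "x \<in> space M" "y \<in> space M" for n t x y
    using that
  proof (induction n arbitrary: t x y)
    case 0
    let ?f = "\<lambda>s. rate I E (clipped (X 0) s) x y"
    have f: "?f \<in> borel_measurable lborel" "\<bar>?f s\<bar> \<le> K" for s
      using clipped_rate_measurable[OF I irr jm] clipped_rate_bounds(3)[OF I irr jm] 0 by (auto simp: K_def)
    have "\<bar>\<integral>s. indicator {0..t} s * ?f s \<partial>lborel\<bar> \<le> K * t"
    proof -
      have "\<bar>(\<integral>s. indicator {0..t} s * ?f s \<partial>lborel) - (\<integral>s. indicator {0..0} s * ?f s \<partial>lborel) - 0 * (t - 0)\<bar> \<le> K * (t - 0)"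
        using f 0 by (intro integral_increment_le[where B=K]) auto
      then show ?thesis using integral_Icc_same[OF f(1)] by simp
    qed
    also have "\<dots> \<le> K * exp (2 * L * t)"
    proof (rule mult_left_mono[OF _ K0])
      have "t \<le> 2 * L * t" using L1 0(1) mult_right_mono[of 1 "2 * L" t] by simp
      also have "\<dots> \<le> exp (2 * L * t)" using exp_ge_add_one_self[of "2 * L * t"] by linarith
      finally show "t \<le> exp (2 * L * t)" .
    qed
    finally show ?case by (simp add: X_def picard_op_def)
  next
    case (Suc n)
    have "\<bar>picard_op I E W (X (Suc n)) t x y - picard_op I E W (X n) t x y\<bar> \<le>
        K / 2 ^ n / 2 * exp (2 * L * t)"
      unfolding L_def using Suc.IH
      by (intro picard_op_contraction[OF I irr jm jm _ Suc.prems]) (simp add: L_def)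
    then show ?case by (simp add: X_Suc[symmetric] mult.commute)
  qed
  \<comment> \<open>\<open>lim\<close> has some value also at negative times, where convergence is
    not claimed; measurability holds there nevertheless.\<close>
  define U where "U t x y = lim (\<lambda>n. X n t x y)" for t x y
  have U: "jointly_measurable U"
    using borel_measurable_lim_metric[of "\<lambda>n (t, z). X n t (fst z) (snd z)" "lborel \<Otimes>\<^sub>M M2"] jm
    by (simp add: jointly_measurable_def U_def split_beta')
  have conv: "(\<lambda>n. X n t x y) \<longlonglongrightarrow> U t x y" "\<bar>U t x y - X n t x y\<bar> \<le> 2 * K / 2 ^ n * exp (2 * L * t)"
    if txy: "0 \<le> t" "x \<in> space M" "y \<in> space M" for t x y n
  proof -
    let ?C = "K * exp (2 * L * t)"
    have d: "\<bar>X (Suc n) t x y - X n t x y\<bar> \<le> ?C * (1 / 2) ^ n" for n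
      using diff[OF txy, of n] by (simp add: power_one_over field_simps)
    have g: "\<bar>X (n + k) t x y - X n t x y\<bar> \<le> 2 * ?C * (1 / 2) ^ n" for n k
    proof -
      \<comment> \<open>The geometric series is bounded with its tail subtracted, since this is the
        form that the induction over \<open>k\<close> preserves.\<close>
      have "\<bar>X (n + k) t x y - X n t x y\<bar> \<le> 2 * ?C * (1 / 2) ^ n - 2 * ?C * (1 / 2) ^ (n + k)"
      proof (induction k)
        case (Suc k)
        then show ?case using d[of "n + k"] by simp
      qed simp
      also have "\<dots> \<le> 2 * ?C * (1 / 2) ^ n" using K0 by simp
      finally show ?thesis .
    qed
    have lim0: "(\<lambda>n. 2 * ?C * (1 / 2) ^ n) \<longlonglongrightarrow> 2 * ?C * 0"
      by (intro tendsto_mult_left LIMSEQ_realpow_zero) auto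
    have "Cauchy (\<lambda>n. X n t x y)"
      unfolding Cauchy_altdef
    proof (intro allI impI)
      fix e :: real assume "0 < e"
      then have "\<forall>\<^sub>F n in sequentially. 2 * ?C * (1 / 2) ^ n < e"
        using order_tendstoD(2)[OF lim0] by simp
      then obtain N where N: "\<And>n. n \<ge> N \<Longrightarrow> 2 * ?C * (1 / 2) ^ n < e" by (auto simp: eventually_sequentially)
      have "dist (X m t x y) (X n t x y) < e" if "N \<le> m" "m < n" for m n
        using g[of m "n - m"] N[OF that(1)] that by (simp add: dist_real_def abs_minus_commute)
      then show "\<exists>M. \<forall>m\<ge>M. \<forall>n>m. dist (X m t x y) (X n t x y) < e" by blast
    qed
    then show c: "(\<lambda>n. X n t x y) \<longlonglongrightarrow> U t x y"
      unfolding U_def by (simp add: Cauchy_convergent_iff convergent_LIMSEQ_iff)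
    have "(\<lambda>k. X (n + k) t x y) \<longlonglongrightarrow> U t x y" using LIMSEQ_ignore_initial_segment[OF c, of n] by (simp add: add.commute)
    then have "(\<lambda>k. \<bar>X (n + k) t x y - X n t x y\<bar>) \<longlonglongrightarrow> \<bar>U t x y - X n t x y\<bar>"
      by (intro tendsto_intros)
    then have "\<bar>U t x y - X n t x y\<bar> \<le> 2 * ?C * (1 / 2) ^ n"
      using g by (intro LIMSEQ_le_const2) auto
    then show "\<bar>U t x y - X n t x y\<bar> \<le> 2 * K / 2 ^ n * exp (2 * L * t)"
      by (simp add: power_one_over field_simps)
  qed
  show ?thesis
  proof (rule that[OF U])
    fix t :: real and x y assume txy: "0 \<le> t" "x \<in> space M" "y \<in> space M"
    have le: "\<bar>picard_op I E W U t x y - X (Suc n) t x y\<bar> \<le> K * exp (2 * L * t) * (1 / 2) ^ n" for n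
    proof -
      have "\<bar>picard_op I E W U t x y - picard_op I E W (X n) t x y\<bar> \<le> 2 * K / 2 ^ n / 2 * exp (2 * L * t)"
        unfolding L_def using conv(2)
        by (intro picard_op_contraction[OF I irr U jm _ txy]) (simp add: L_def)
      then show ?thesis by (simp add: X_Suc power_one_over field_simps)
    qed
    have "(\<lambda>n. picard_op I E W U t x y - X (Suc n) t x y) \<longlonglongrightarrow> 0"
    proof (rule Lim_null_comparison)
      show "\<forall>\<^sub>F n in sequentially. norm (picard_op I E W U t x y - X (Suc n) t x y) \<le> K * exp (2 * L * t) * (1 / 2) ^ n"
        using le by simp
      show "(\<lambda>n. K * exp (2 * L * t) * (1 / 2) ^ n) \<longlonglongrightarrow> 0"
        by (rule tendsto_mult_right_zero[OF LIMSEQ_realpow_zero]) auto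
    qed
    moreover have "(\<lambda>n. picard_op I E W U t x y - X (Suc n) t x y) \<longlonglongrightarrow> picard_op I E W U t x y - U t x y"
      using LIMSEQ_Suc[OF conv(1)[OF txy]] by (intro tendsto_intros)
    ultimately show "U t x y = picard_op I E W U t x y" using LIMSEQ_unique by fastforce
  qed
qed

text \<open>All properties hold at every point and not just almost everywhere. The error in the last
  one is uniform in the points, so it can be used in the supremum norm and under integrals
  alike.\<close>

theorem removal_flow_exists:
  assumes W: "graphon M W"
  obtains U C where "\<And>t. 0 \<le> t \<Longrightarrow> graphon M (U t)"
    "\<And>x y. x \<in> space M \<Longrightarrow> y \<in> space M \<Longrightarrow> U 0 x y = W x y"
    "\<And>s t x y. 0 \<le> s \<Longrightarrow> s \<le> t \<Longrightarrow> x \<in> space M \<Longrightarrow> y \<in> space M \<Longrightarrow> U t x y \<le> U s x y"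
    "\<And>s t x y. 0 \<le> s \<Longrightarrow> 0 \<le> t \<Longrightarrow> x \<in> space M \<Longrightarrow> y \<in> space M \<Longrightarrow>
      \<bar>U s x y - U t x y + (s - t) * rate I E (U t) x y\<bar> \<le> C * (s - t)\<^sup>2"
proof -
  have Wm: "(\<lambda>(x, y). W x y) \<in> borel_measurable M2"
    and Wsym: "\<And>x y. x \<in> space M \<Longrightarrow> y \<in> space M \<Longrightarrow> W x y = W y x"
    and W01: "\<And>x y. x \<in> space M \<Longrightarrow> y \<in> space M \<Longrightarrow> 0 \<le> W x y \<and> W x y \<le> 1"
    using W unfolding graphon_def kernel_def by blast+
  obtain U where U: "jointly_measurable U"
    and fix': "\<And>t x y. 0 \<le> t \<Longrightarrow> x \<in> space M \<Longrightarrow> y \<in> space M \<Longrightarrow> U t x y = picard_op I E W U t x y"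
    using picard_fixpoint[OF Wm] by blast
  define r where "r x y s = rate I E (clipped U s) x y" for x y s
  define K where "K = real (card (E \<union> E\<inverse>))"
  define L where "L = real (card (E \<union> E\<inverse>) * card E)"
  have L0: "L \<ge> 0" and K0: "K \<ge> 0" by (auto simp: L_def K_def)
  have r: "r x y \<in> borel_measurable lborel" "0 \<le> r x y s" "r x y s \<le> K" "\<bar>r x y s\<bar> \<le> K"
    if "x \<in> space M" "y \<in> space M" for x y s
    using clipped_rate_measurable[OF I irr U that] clipped_rate_bounds[OF I irr U that]
    by (auto simp: r_def[abs_def] K_def)
  have Ueq: "U t x y = W x y - (\<integral>s. indicator {0..t} s * r x y s \<partial>lborel)"
    if "0 \<le> t" "x \<in> space M" "y \<in> space M" for t x y
    using fix'[OF that] by (simp add: picard_op_def r_def)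
  have incr: "\<bar>U s x y - U t x y - c * (t - s)\<bar> \<le> D * (t - s)"
    if st: "0 \<le> s" "s \<le> t" and xy: "x \<in> space M" "y \<in> space M"
      and c: "\<And>u. s \<le> u \<Longrightarrow> u \<le> t \<Longrightarrow> \<bar>r x y u - c\<bar> \<le> D" for s t x y c D
    using integral_increment_le[OF r(1)[OF xy] r(4)[OF xy] st c] Ueq[OF _ xy, of s] Ueq[OF _ xy, of t] st
    by simp
  have lip': "\<bar>U s x y - U t x y\<bar> \<le> K * (t - s)"
    if "0 \<le> s" "s \<le> t" and xy: "x \<in> space M" "y \<in> space M" for s t x y
    using incr[OF that, of 0 K] r(4)[OF xy] by simp
  have lip: "\<bar>U s x y - U t x y\<bar> \<le> K * \<bar>s - t\<bar>"
    if "0 \<le> s" "0 \<le> t" and xy: "x \<in> space M" "y \<in> space M" for s t x y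
    using lip'[of s t x y] lip'[of t s x y] that by (cases "s \<le> t") (auto simp: abs_minus_commute)
  have anti: "U t x y \<le> U s x y"
    if "0 \<le> s" "s \<le> t" and xy: "x \<in> space M" "y \<in> space M" for s t x y
  proof -
    \<comment> \<open>Centring the rate, which lies in \<open>[0, K]\<close>, at
      \<open>K / 2\<close> turns the two-sided increment bound into monotonicity.\<close>
    have "\<bar>r x y u - K / 2\<bar> \<le> K / 2" for u using r(2,3)[OF xy, of u] unfolding abs_le_iff by linarith
    then have "\<bar>U s x y - U t x y - K / 2 * (t - s)\<bar> \<le> K / 2 * (t - s)" by (intro incr that)
    then show ?thesis unfolding abs_le_iff by linarith
  qed
  have sym: "U t x y = U t y x" if "0 \<le> t" "x \<in> space M" "y \<in> space M" for t x y
    using Ueq[OF that] Ueq[OF that(1,3,2)] Wsym[OF that(2,3)] rate_sym[OF I irr, of _ x y] by (simp add: r_def)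
  have U0: "U 0 x y = W x y" if "x \<in> space M" "y \<in> space M" for x y
    using Ueq[OF order.refl that] integral_Icc_same[OF r(1)[OF that]] by simp
  have nonneg: "0 \<le> U t x y" if t: "0 \<le> t" and xy: "x \<in> space M" "y \<in> space M" for t x y
  proof (rule ccontr)
    assume neg: "\<not> 0 \<le> U t x y"
    have "K-lipschitz_on {0..t} (\<lambda>s. U s x y)"
      using lip xy K0 by (intro lipschitz_onI) (auto simp: dist_real_def)
    then have "continuous_on {0..t} (\<lambda>s. U s x y)" by (rule lipschitz_on_continuous_on)
    then obtain t0 where t0: "0 \<le> t0" "t0 \<le> t" "U t0 x y = 0"
      using IVT2'[of "\<lambda>s. U s x y" t 0 0] neg U0[OF xy] W01[OF xy] t by auto
    \<comment> \<open>After a zero the path is not positive, by monotonicity. Clipping then makes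
      the kernel vanish at this pair in both orders, the rate is 0, and the path stays at
      zero.\<close>
    have "\<bar>r x y u - 0\<bar> \<le> 0" if u: "t0 \<le> u" "u \<le> t" for u
    proof -
      have "U u x y \<le> 0" using anti[OF t0(1) u(1) xy] t0 by simp
      moreover have "U u y x = U u x y" using sym[of u x y] xy t0 u by simp
      ultimately show ?thesis unfolding r_def
        using rate_eq_0[OF I irr, of "clipped U u" x y] by (simp add: clipped_def clip_nonpos)
    qed
    from incr[OF t0(1,2) xy this] show False using t0 neg by simp
  qed
  have le1: "U t x y \<le> 1" if t: "0 \<le> t" and xy: "x \<in> space M" "y \<in> space M" for t x y
    using anti[OF order.refl t xy] U0[OF xy] W01[OF xy] by simp
  have rU: "r x y t = rate I E (U t) x y" if "0 \<le> t" "x \<in> space M" "y \<in> space M" for t x y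
    unfolding r_def using that nonneg le1
    by (intro rate_cong[OF I(2) irr]) (auto simp: clipped_def clip_id)
  \<comment> \<open>The path is Lipschitz in time with constant \<open>K\<close>, the rate in the
    kernel with constant \<open>L\<close>, both uniformly in the points. Integrated over time, this
    gives the quadratic error.\<close>
  have quad: "\<bar>r x y u - r x y t\<bar> \<le> L * (K * D)"
    if "0 \<le> u" "0 \<le> t" "\<bar>u - t\<bar> \<le> D" and xy: "x \<in> space M" "y \<in> space M" for u t D x y
    unfolding r_def L_def
  proof (rule clipped_rate_lipschitz[OF I irr U U xy])
    fix x y assume "x \<in> space M" "y \<in> space M"
    from lip[OF that(1,2) this] show "\<bar>U u x y - U t x y\<bar> \<le> K * D"
      using mult_left_mono[OF that(3) K0] by linarith
  qed
  show ?thesis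
  proof (rule that[of U "L * K"])
    show "graphon M (U t)" if "0 \<le> t" for t
      unfolding graphon_def kernel_def using jointly_measurable_section[OF U] sym nonneg le1 that
      by (auto intro!: exI[of _ 1])
  next
    fix s t :: real and x y assume st: "0 \<le> s" "0 \<le> t" and xy: "x \<in> space M" "y \<in> space M"
    show "\<bar>U s x y - U t x y + (s - t) * rate I E (U t) x y\<bar> \<le> L * K * (s - t)\<^sup>2"
    proof (cases "s \<le> t")
      case True
      have "\<bar>U s x y - U t x y - r x y t * (t - s)\<bar> \<le> L * (K * (t - s)) * (t - s)"
        using st by (intro incr[OF st(1) True xy] quad[OF _ _ _ xy]) auto
      then show ?thesis
        by (simp add: rU[OF st(2) xy] power2_eq_square algebra_simps)
    next
      case False
      have "\<bar>U t x y - U s x y - r x y t * (s - t)\<bar> \<le> L * (K * (s - t)) * (s - t)"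
        using st False by (intro incr[OF st(2) _ xy] quad[OF _ _ _ xy]) auto
      then show ?thesis
        by (simp add: rU[OF st(2) xy] power2_eq_square algebra_simps abs_le_iff)
    qed
  qed (use U0 anti in auto)
qed

end
end

section \<open>Uniqueness of trajectories\<close>

text \<open>\<open>N t * exp (- c * t)\<close> does not increase, starts at 0 and is not negative.
  Derivatives are taken within \<open>{0..}\<close> to match the one-sided derivative of a
  trajectory at time 0.\<close>

lemma gronwall_zero:
  fixes N :: "real \<Rightarrow> real"
  assumes T: "0 \<le> T" and N0: "N 0 = 0" and pos: "\<And>t. 0 \<le> N t"
    and der: "\<And>t. 0 \<le> t \<Longrightarrow> t \<le> T \<Longrightarrow> (N has_real_derivative N' t) (at t within {0..})"
    and le: "\<And>t. 0 \<le> t \<Longrightarrow> t \<le> T \<Longrightarrow> N' t \<le> c * N t"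
  shows "N T = 0"
proof (cases "T = 0")
  case False
  let ?g = "\<lambda>t. N t * exp (- c * t)"
  have dg: "(?g has_real_derivative N' t * exp (- c * t) + (exp (- c * t) * - c) * N t) (at t within {0..})"
    if "0 \<le> t" "t \<le> T" for t
    by (rule DERIV_mult'[OF der[OF that], THEN DERIV_cong]) (auto intro!: derivative_eq_intros)
  have "?g T \<le> ?g 0"
  proof (rule DERIV_nonpos_imp_decreasing_open[of 0 T ?g])
    fix t assume t: "0 < t" "t < T"
    have "at t within {0..} = at t" using t by (intro at_within_interior) (simp add: interior_real_atLeast)
    moreover have "N' t * exp (- c * t) + (exp (- c * t) * - c) * N t = (N' t - c * N t) * exp (- c * t)"
      by (simp add: algebra_simps)
    moreover have "\<dots> \<le> 0" using le[of t] t by (simp add: mult_le_0_iff)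
    ultimately show "\<exists>y. (?g has_real_derivative y) (at t) \<and> y \<le> 0" using dg[of t] t by auto
  next
    show "continuous_on {0..T} ?g"
    proof (rule DERIV_continuous_on)
      show "(?g has_real_derivative N' t * exp (- c * t) + (exp (- c * t) * - c) * N t) (at t within {0..T})"
        if "t \<in> {0..T}" for t
        using that by (intro DERIV_subset[OF dg]) auto
    qed
  qed (use T False in auto)
  then show ?thesis using N0 pos[of T] by (simp add: mult_le_0_iff)
qed (use N0 in simp)

lemma has_derivative_integral_square:
  fixes D :: "real \<Rightarrow> 'b \<Rightarrow> real"
  assumes N: "prob_space N"
    and Dm: "\<And>s. 0 \<le> s \<Longrightarrow> D s \<in> borel_measurable N" "\<And>s. 0 \<le> s \<Longrightarrow> \<exists>B. \<forall>z\<in>space N. \<bar>D s z\<bar> \<le> B"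
    and D': "D' \<in> borel_measurable N" "\<And>z. z \<in> space N \<Longrightarrow> \<bar>D' z\<bar> \<le> B'" and t: "0 \<le> t"
    and ev: "\<And>e. 0 < e \<Longrightarrow> \<forall>\<^sub>F s in at t within {0..}. AE z in N. \<bar>D s z - D t z - (s - t) * D' z\<bar> \<le> e * \<bar>s - t\<bar>"
  shows "((\<lambda>s. \<integral>z. (D s z)\<^sup>2 \<partial>N) has_real_derivative 2 * (\<integral>z. D t z * D' z \<partial>N)) (at t within {0..})"
proof -
  interpret N: prob_space N by fact
  obtain B0 where B0: "\<And>z. z \<in> space N \<Longrightarrow> \<bar>D t z\<bar> \<le> B0" using Dm(2)[OF t] by blast
  define B where "B = \<bar>B0\<bar>"
  have B: "\<bar>D t z\<bar> \<le> B" if "z \<in> space N" for z using B0[OF that] by (simp add: B_def)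
  have "B \<ge> 0" by (simp add: B_def)
  have "((\<lambda>s. ((\<integral>z. (D s z)\<^sup>2 \<partial>N) - (\<integral>z. (D t z)\<^sup>2 \<partial>N)) / (s - t)) \<longlongrightarrow> 2 * (\<integral>z. D t z * D' z \<partial>N)) (at t within {0..})"
  proof (rule tendstoI)
    fix \<epsilon> :: real assume \<epsilon>: "0 < \<epsilon>"
    define C where "C = (\<bar>B'\<bar> + 1)\<^sup>2 + 1"
    have C: "C > 0" "(\<bar>B'\<bar> + 1)\<^sup>2 \<le> C" by (auto simp: C_def add_nonneg_pos)
    \<comment> \<open>This choice makes the linear part of the error at most \<epsilon> / 2; the
      condition on \<open>\<bar>s - t\<bar>\<close> below puts the quadratic part under \<epsilon> /
      2.\<close>
    define e where "e = min 1 (\<epsilon> / (4 * (B + 1)))"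
    have e: "0 < e" "e \<le> 1" using \<epsilon> \<open>B \<ge> 0\<close> by (auto simp: e_def)
    have "2 * B * e \<le> 2 * B * (\<epsilon> / (4 * (B + 1)))" using \<open>B \<ge> 0\<close> by (intro mult_left_mono) (auto simp: e_def)
    also have "\<dots> \<le> \<epsilon> / 2" using \<open>B \<ge> 0\<close> \<epsilon> by (simp add: field_simps)
    finally have e2: "2 * B * e \<le> \<epsilon> / 2" .
    have near: "\<forall>\<^sub>F s in at t within {0..}. \<bar>s - t\<bar> < \<epsilon> / (2 * C)"
      using C \<epsilon> by (auto simp: eventually_at dist_real_def intro!: exI[of _ "\<epsilon> / (2 * C)"])
    have ge: "\<forall>\<^sub>F s in at t within {0..}. 0 \<le> s \<and> s \<noteq> t" by (auto simp: eventually_at intro!: exI[of _ 1])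
    show "\<forall>\<^sub>F s in at t within {0..}. dist (((\<integral>z. (D s z)\<^sup>2 \<partial>N) - (\<integral>z. (D t z)\<^sup>2 \<partial>N)) / (s - t)) (2 * (\<integral>z. D t z * D' z \<partial>N)) < \<epsilon>"
      using near ge ev[OF e(1)]
    proof eventually_elim
      case (elim s)
      then have s: "0 \<le> s" "s \<noteq> t" by auto
      obtain Bs where Bs: "\<And>z. z \<in> space N \<Longrightarrow> \<bar>D s z\<bar> \<le> Bs" using Dm(2)[OF s(1)] by blast
      note [measurable] = Dm(1)[OF s(1)] Dm(1)[OF t] D'(1)
      let ?h = "\<bar>s - t\<bar>"
      let ?G = "\<lambda>z. (D s z)\<^sup>2 - (D t z)\<^sup>2 - 2 * (s - t) * (D t z * D' z)"
      have sq: "a\<^sup>2 \<le> b\<^sup>2" if "\<bar>a\<bar> \<le> b" for a b :: real using that abs_le_square_iff[of a b] by auto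
      have i1: "integrable N (\<lambda>z. (D s z)\<^sup>2)"
        using Bs sq by (intro integrable_bounded[OF N, where B="Bs\<^sup>2"]) auto
      have i2: "integrable N (\<lambda>z. (D t z)\<^sup>2)"
        using B sq by (intro integrable_bounded[OF N, where B="B\<^sup>2"]) auto
      have i3: "integrable N (\<lambda>z. D t z * D' z)"
        using B D'(2) \<open>B \<ge> 0\<close> by (intro integrable_bounded[OF N, where B="B * B'"]) (auto simp: abs_mult intro!: mult_mono)
      have bound: "AE z in N. \<bar>?G z\<bar> \<le> 2 * B * e * ?h + C * ?h\<^sup>2"
        using elim(3) AE_space
      proof eventually_elim
        case (elim z)
        define q where "q = D s z - D t z"
        define r where "r = q - (s - t) * D' z"
        have r: "\<bar>r\<bar> \<le> e * ?h" using elim by (simp add: r_def q_def)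
        have "\<bar>q\<bar> \<le> \<bar>r\<bar> + \<bar>(s - t) * D' z\<bar>" unfolding r_def by linarith
        also have "\<bar>r\<bar> \<le> 1 * ?h" using r mult_right_mono[OF e(2), of ?h] by linarith
        also have "\<bar>(s - t) * D' z\<bar> \<le> ?h * \<bar>B'\<bar>"
          unfolding abs_mult using D'(2)[OF elim(2)] by (intro mult_left_mono) auto
        finally have q: "\<bar>q\<bar> \<le> (\<bar>B'\<bar> + 1) * ?h" by (simp add: algebra_simps)
        \<comment> \<open>\<open>r\<close> is the error of the linearisation and \<open>q\<close>
          the full increment, whose square is of second order in \<open>s - t\<close>.\<close>
        have "?G z = 2 * D t z * r + q\<^sup>2" by (simp add: r_def q_def power2_eq_square algebra_simps)
        then have "\<bar>?G z\<bar> \<le> \<bar>2 * D t z * r\<bar> + q\<^sup>2"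
          using abs_triangle_ineq[of "2 * D t z * r" "q\<^sup>2"] by simp
        also have "\<bar>2 * D t z * r\<bar> \<le> 2 * B * (e * ?h)"
          unfolding abs_mult using B[OF elim(2)] r by (intro mult_mono) auto
        also have "q\<^sup>2 \<le> ((\<bar>B'\<bar> + 1) * ?h)\<^sup>2" using q by (rule sq)
        also have "\<dots> = (\<bar>B'\<bar> + 1)\<^sup>2 * ?h\<^sup>2" by (rule power_mult_distrib)
        also have "\<dots> \<le> C * ?h\<^sup>2" using C(2) by (intro mult_right_mono) auto
        finally show ?case by (simp add: mult.assoc)
      qed
      have eq: "(\<integral>z. ?G z \<partial>N) = (\<integral>z. (D s z)\<^sup>2 \<partial>N) - (\<integral>z. (D t z)\<^sup>2 \<partial>N) - 2 * (s - t) * (\<integral>z. D t z * D' z \<partial>N)"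
        using i1 i2 i3 by simp
      have "\<bar>\<integral>z. ?G z \<partial>N\<bar> \<le> (\<integral>z. \<bar>?G z\<bar> \<partial>N)" by (rule integral_abs_bound)
      also have "\<dots> \<le> 2 * B * e * ?h + C * ?h\<^sup>2"
        using bound i1 i2 i3 by (intro N.integral_le_const integrable_abs Bochner_Integration.integrable_diff) auto
      finally have "\<bar>(\<integral>z. (D s z)\<^sup>2 \<partial>N) - (\<integral>z. (D t z)\<^sup>2 \<partial>N) - 2 * (s - t) * (\<integral>z. D t z * D' z \<partial>N)\<bar> / ?h
         \<le> (2 * B * e * ?h + C * ?h\<^sup>2) / ?h"
        unfolding eq by (intro divide_right_mono) auto
      also have "\<dots> = 2 * B * e + C * ?h" using s(2) by (simp add: power2_eq_square add_divide_distrib del: power2_abs abs_mult_self_eq)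
      also have "\<dots> < \<epsilon>"
      proof -
        have "C * ?h < C * (\<epsilon> / (2 * C))" using elim(1) C(1) by (intro mult_strict_left_mono)
        then show ?thesis using e2 C(1) by simp
      qed
      also have "\<bar>(\<integral>z. (D s z)\<^sup>2 \<partial>N) - (\<integral>z. (D t z)\<^sup>2 \<partial>N) - 2 * (s - t) * (\<integral>z. D t z * D' z \<partial>N)\<bar> / ?h =
        dist (((\<integral>z. (D s z)\<^sup>2 \<partial>N) - (\<integral>z. (D t z)\<^sup>2 \<partial>N)) / (s - t)) (2 * (\<integral>z. D t z * D' z \<partial>N))"
      proof -
        have "(p - q - 2 * (s - t) * r) / (s - t) = (p - q) / (s - t) - 2 * r" for p q r :: real
          using s(2) by (simp add: field_simps)
        then show ?thesis by (simp only: dist_real_def abs_divide[symmetric])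
      qed
      finally show ?case .
    qed
  qed
  then show ?thesis by (simp add: has_field_derivative_iff)
qed

context prob_space
begin

context
  fixes I :: "'i set" and E :: "('i \<times> 'i) set"
  assumes I: "finite I" "E \<subseteq> I \<times> I" and irr: "\<And>i. (i, i) \<notin> E"
begin

text \<open>The difference of the rates is tested against \<open>D\<close> itself, so products of
  \<open>D\<close> at two edges of a copy appear. They are at most half the sum of the squares, and
  each edge of a random copy has the law \<open>M2\<close>. The bounds \<open>BU\<close> and
  \<open>BV\<close> provide integrability; the constant involves \<open>B\<close>, which is assumed
  almost everywhere and can be chosen uniformly in time.\<close>

lemma rate_L2_lipschitz:
  assumes U: "(\<lambda>(x, y). U x y) \<in> borel_measurable M2" and V: "(\<lambda>(x, y). V x y) \<in> borel_measurable M2"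
    and Ub: "\<And>x y. x \<in> space M \<Longrightarrow> y \<in> space M \<Longrightarrow> \<bar>U x y\<bar> \<le> BU"
    and Vb: "\<And>x y. x \<in> space M \<Longrightarrow> y \<in> space M \<Longrightarrow> \<bar>V x y\<bar> \<le> BV"
    and B: "1 \<le> B" "AE z in M2. \<bar>U (fst z) (snd z)\<bar> \<le> B" "AE z in M2. \<bar>V (fst z) (snd z)\<bar> \<le> B"
  defines "D \<equiv> \<lambda>z. U (fst z) (snd z) - V (fst z) (snd z)"
  shows "\<bar>\<integral>z. D z * (rate I E U (fst z) (snd z) - rate I E V (fst z) (snd z)) \<partial>M2\<bar> \<le>
    real (card (E \<union> E\<inverse>) * card E) * B ^ card E * (\<integral>z. (D z)\<^sup>2 \<partial>M2)"
proof -
  let ?P = "Mpow I"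
  interpret P: prob_space ?P by (rule prob_space_power)
  define BB where "BB = 1 + \<bar>BU\<bar> + \<bar>BV\<bar>"
  have BB: "1 \<le> BB" "\<bar>U x y\<bar> \<le> BB" "\<bar>V x y\<bar> \<le> BB" if "x \<in> space M" "y \<in> space M" for x y
    using Ub[OF that] Vb[OF that] by (auto simp: BB_def)
  have BB1: "1 \<le> BB" by (simp add: BB_def)
  have Dm[measurable]: "D \<in> borel_measurable M2" unfolding D_def using U V by (simp add: split_beta')
  have Db: "\<bar>D z\<bar> \<le> 2 * BB" if "z \<in> space M2" for z
    using BB(2,3)[of "fst z" "snd z"] that by (auto simp: D_def space_pair_measure)
  have D2: "integrable M2 (\<lambda>z. (D z)\<^sup>2)"
  proof (rule integrable_bounded[OF prob_space_pair])
    show "\<bar>(D z)\<^sup>2\<bar> \<le> (2 * BB)\<^sup>2" if "z \<in> space M2" for z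
      using Db[OF that] abs_le_square_iff[of "D z" "2 * BB"] by simp
  qed measurable
  note rU = integral_rate[OF I irr U BB1 BB(2) Dm Db] and rV = integral_rate[OF I irr V BB1 BB(3) Dm Db]
  have r3: "integrable ?P (\<lambda>v. D (v a, v b) * hom_weight E U v)" "integrable ?P (\<lambda>v. D (v a, v b) * hom_weight E V v)"
    if "(a, b) \<in> E \<union> E\<inverse>" for a b
    using rU(3) rV(3) that by blast+
  have D2c: "integrable ?P (\<lambda>v. (D (v i, v j))\<^sup>2)" "(\<integral>v. (D (v i, v j))\<^sup>2 \<partial>?P) = (\<integral>z. (D z)\<^sup>2 \<partial>M2)"
    if "(i, j) \<in> E \<union> E\<inverse>" for i j
  proof -
    have ij: "i \<in> I" "j \<in> I" "i \<noteq> j" using oriented_edge[OF I irr that] by auto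
    show "(\<integral>v. (D (v i, v j))\<^sup>2 \<partial>?P) = (\<integral>z. (D z)\<^sup>2 \<partial>M2)"
      using integral_pair_component[OF I(1) ij, of "\<lambda>z. (D z)\<^sup>2"] by simp
    show "integrable ?P (\<lambda>v. (D (v i, v j))\<^sup>2)"
      using integrable_distr[OF measurable_pair_component[of i I j M], of "\<lambda>z. (D z)\<^sup>2"] ij D2
      by (simp add: distr_pair_component[OF I(1) ij])
  qed
  \<comment> \<open>There are finitely many edges, so the bounds hold at all of them for almost
    every copy.\<close>
  have ae: "AE v in ?P. \<forall>(i, j)\<in>E. \<bar>U (v i) (v j)\<bar> \<le> B \<and> \<bar>V (v i) (v j)\<bar> \<le> B"
  proof -
    have "AE v in ?P. \<bar>U (v i) (v j)\<bar> \<le> B \<and> \<bar>V (v i) (v j)\<bar> \<le> B" if "(i, j) \<in> E" for i j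
      using AE_pair_component[OF I(1), of i j "\<lambda>z. \<bar>U (fst z) (snd z)\<bar> \<le> B \<and> \<bar>V (fst z) (snd z)\<bar> \<le> B"]
        oriented_edge[OF I irr, of i j] that B by auto
    then show ?thesis
      by (subst AE_ball_countable) (auto intro: countable_finite finite_edges[OF I irr])
  qed
  have one: "\<bar>(\<integral>v. D (v a, v b) * hom_weight E U v \<partial>?P) - (\<integral>v. D (v a, v b) * hom_weight E V v \<partial>?P)\<bar> \<le>
      card E * B ^ card E * (\<integral>z. (D z)\<^sup>2 \<partial>M2)" if ab: "(a, b) \<in> E \<union> E\<inverse>" for a b
  proof -
    let ?R = "\<lambda>v. B ^ card E * (\<Sum>(i, j)\<in>E. ((D (v a, v b))\<^sup>2 + (D (v i, v j))\<^sup>2) / 2)"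
    have iR: "integrable ?P (\<lambda>v. case e of (i, j) \<Rightarrow> ((D (v a, v b))\<^sup>2 + (D (v i, v j))\<^sup>2) / 2)" if "e \<in> E" for e
      using D2c(1)[OF ab] D2c(1)[of "fst e" "snd e"] that by (auto simp: split_beta')
    have "\<bar>\<integral>v. D (v a, v b) * hom_weight E U v - D (v a, v b) * hom_weight E V v \<partial>?P\<bar> \<le>
      (\<integral>v. \<bar>D (v a, v b) * hom_weight E U v - D (v a, v b) * hom_weight E V v\<bar> \<partial>?P)"
      by (rule integral_abs_bound)
    also have "\<dots> \<le> (\<integral>v. ?R v \<partial>?P)"
    proof (rule integral_mono_AE)
      show "integrable ?P ?R" using iR by (intro integrable_mult_right Bochner_Integration.integrable_sum)
      show "AE v in ?P. \<bar>D (v a, v b) * hom_weight E U v - D (v a, v b) * hom_weight E V v\<bar> \<le> ?R v"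
        using ae
      proof eventually_elim
        case (elim v)
        have "\<bar>hom_weight E U v - hom_weight E V v\<bar> \<le> B ^ card E * (\<Sum>(i, j)\<in>E. \<bar>U (v i) (v j) - V (v i) (v j)\<bar>)"
          using elim B by (intro hom_weight_diff_le finite_edges[OF I irr]) auto
        then have "\<bar>D (v a, v b)\<bar> * \<bar>hom_weight E U v - hom_weight E V v\<bar> \<le>
          \<bar>D (v a, v b)\<bar> * (B ^ card E * (\<Sum>(i, j)\<in>E. \<bar>D (v i, v j)\<bar>))"
          by (intro mult_left_mono) (auto simp: D_def)
        also have "\<dots> = B ^ card E * (\<Sum>(i, j)\<in>E. \<bar>D (v a, v b)\<bar> * \<bar>D (v i, v j)\<bar>)"
          by (simp add: sum_distrib_left split_beta' mult_ac)
        also have "\<dots> \<le> ?R v"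
        proof (intro mult_left_mono sum_mono)
          fix e
          have "\<bar>p\<bar> * \<bar>q\<bar> \<le> (p\<^sup>2 + q\<^sup>2) / 2" for p q :: real
            using sum_squares_bound[of "\<bar>p\<bar>" "\<bar>q\<bar>"] by simp
          then show "(case e of (i, j) \<Rightarrow> \<bar>D (v a, v b)\<bar> * \<bar>D (v i, v j)\<bar>) \<le>
             (case e of (i, j) \<Rightarrow> ((D (v a, v b))\<^sup>2 + (D (v i, v j))\<^sup>2) / 2)"
            by (simp add: split_beta')
        qed (use B in auto)
        finally show ?case by (simp add: abs_mult[symmetric] right_diff_distrib)
      qed
    qed (use r3[OF ab] in auto)
    also have "\<dots> = B ^ card E * (\<Sum>e\<in>E. \<integral>v. (case e of (i, j) \<Rightarrow> ((D (v a, v b))\<^sup>2 + (D (v i, v j))\<^sup>2) / 2) \<partial>?P)"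
      using iR by simp
    also have "\<dots> = B ^ card E * (\<Sum>e\<in>E. \<integral>z. (D z)\<^sup>2 \<partial>M2)"
    proof -
      have "(\<integral>v. (case e of (i, j) \<Rightarrow> ((D (v a, v b))\<^sup>2 + (D (v i, v j))\<^sup>2) / 2) \<partial>?P) = (\<integral>z. (D z)\<^sup>2 \<partial>M2)"
        if "e \<in> E" for e
        using D2c[OF ab] D2c[of "fst e" "snd e"] that by (simp add: split_beta')
      then show ?thesis by simp
    qed
    finally show ?thesis using r3[OF ab] by (simp add: mult_ac)
  qed
  have "(\<integral>z. D z * (rate I E U (fst z) (snd z) - rate I E V (fst z) (snd z)) \<partial>M2) =
    (\<Sum>(a, b)\<in>E \<union> E\<inverse>. (\<integral>v. D (v a, v b) * hom_weight E U v \<partial>?P) - (\<integral>v. D (v a, v b) * hom_weight E V v \<partial>?P))"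
    using rU(1,2) rV(1,2) by (simp add: right_diff_distrib sum_subtractf split_beta')
  also have "\<bar>\<dots>\<bar> \<le> (\<Sum>e\<in>E \<union> E\<inverse>. card E * B ^ card E * (\<integral>z. (D z)\<^sup>2 \<partial>M2))"
    by (rule order_trans[OF sum_abs sum_mono]) (use one in auto)
  finally show ?thesis by (simp add: mult_ac)
qed

end
end

section \<open>Trajectories of the removal rule\<close>

context prob_space
begin

lemma kernel_measurable: "kernel M W \<Longrightarrow> (\<lambda>(x, y). W x y) \<in> borel_measurable M2"
  by (simp add: kernel_def)

lemma kernel_measurable': "kernel M W \<Longrightarrow> (\<lambda>z. W (fst z) (snd z)) \<in> borel_measurable M2"
  by (simp add: kernel_def split_beta')

lemma kernel_bounded:
  assumes "kernel M W"
  obtains B where "1 \<le> B" "\<And>x y. x \<in> space M \<Longrightarrow> y \<in> space M \<Longrightarrow> \<bar>W x y\<bar> \<le> B"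
proof -
  obtain B where "\<forall>x\<in>space M. \<forall>y\<in>space M. \<bar>W x y\<bar> \<le> B" using assms unfolding kernel_def by blast
  then show ?thesis using that[of "max 1 B"] by force
qed

context
  fixes k :: nat and F :: "nat set set"
  assumes F: "F \<in> graphs k"
begin

abbreviation removal_rate :: "('a \<Rightarrow> 'a \<Rightarrow> real) \<Rightarrow> 'a \<Rightarrow> 'a \<Rightarrow> real" where
  "removal_rate \<equiv> rate {1..k} (edge_pairs k F)"

lemmas edge_pairs_context = finite_atLeastAtMost[of 1 k] edge_pairs_subset[of k F] edge_pairs_irrefl[of _ k F]

lemma removal_rate_bounded:
  assumes "kernel M W"
  obtains B where "0 \<le> B" "\<And>z. z \<in> space M2 \<Longrightarrow> \<bar>removal_rate W (fst z) (snd z)\<bar> \<le> B"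
proof -
  obtain B where B: "1 \<le> B" "\<And>x y. x \<in> space M \<Longrightarrow> y \<in> space M \<Longrightarrow> \<bar>W x y\<bar> \<le> B"
    using kernel_bounded[OF assms] by blast
  let ?E = "edge_pairs k F"
  have "\<bar>removal_rate W x y\<bar> \<le> (\<Sum>e\<in>?E \<union> ?E\<inverse>. B ^ card ?E)" if xy: "x \<in> space M" "y \<in> space M" for x y
    unfolding rate_def
  proof (rule order_trans[OF sum_abs sum_mono], clarify)
    fix a b assume ab: "(a, b) \<in> ?E \<union> ?E\<inverse>"
    let ?J = "Mpow ({1..k} - {a, b})"
    interpret J: prob_space ?J by (rule prob_space_power)
    have "\<bar>\<integral>v. hom_weight ?E W (v(a := x, b := y)) \<partial>?J\<bar> \<le> (\<integral>v. \<bar>hom_weight ?E W (v(a := x, b := y))\<bar> \<partial>?J)"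
      by (rule integral_abs_bound)
    also have "\<dots> \<le> B ^ card ?E"
    proof (rule J.integral_le_const)
      show "integrable ?J (\<lambda>v. \<bar>hom_weight ?E W (v(a := x, b := y))\<bar>)"
        using integrable_hom_weight_section[OF edge_pairs_context ab xy kernel_measurable[OF assms] B] by simp
      show "AE v in ?J. \<bar>hom_weight ?E W (v(a := x, b := y))\<bar> \<le> B ^ card ?E"
        using upd2_in_space[OF edge_pairs_context ab xy]
        by (intro AE_I2 hom_weight_bounded[OF finite_edge_pairs edge_pairs_subset _ B])
    qed
    finally show "\<bar>\<integral>v. hom_weight ?E W (v(a := x, b := y)) \<partial>?J\<bar> \<le> B ^ card ?E" .
  qed
  then show ?thesis using B(1) by (intro that[of "\<Sum>e\<in>?E \<union> ?E\<inverse>. B ^ card ?E"]) (auto simp: space_pair_measure intro!: sum_nonneg)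
qed

lemma velocity_measurable:
  assumes "kernel M W"
  shows "(\<lambda>z. velocity M k (removal_rule F) W (fst z) (snd z)) \<in> borel_measurable M2"
proof -
  have "(\<lambda>z. - removal_rate W (fst z) (snd z)) \<in> borel_measurable M2"
    using rate_measurable[OF edge_pairs_context kernel_measurable[OF assms]] by simp
  moreover have "velocity M k (removal_rule F) W (fst z) (snd z) = - removal_rate W (fst z) (snd z)"
    if "z \<in> space M2" for z
    using that by (intro velocity_removal_rule[OF F assms]) (auto simp: space_pair_measure)
  ultimately show ?thesis by (simp cong: measurable_cong)
qed

lemma is_trajectory_removal:
  assumes U: "\<And>t. 0 \<le> t \<Longrightarrow> kernel M (U t)"
    and U0: "\<And>x y. x \<in> space M \<Longrightarrow> y \<in> space M \<Longrightarrow> U 0 x y = W x y"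
    and C: "\<And>s t x y. 0 \<le> s \<Longrightarrow> 0 \<le> t \<Longrightarrow> x \<in> space M \<Longrightarrow> y \<in> space M \<Longrightarrow>
      \<bar>U s x y - U t x y + (s - t) * removal_rate (U t) x y\<bar> \<le> C * (s - t)\<^sup>2"
  shows "is_trajectory M k (removal_rule F) W U"
  unfolding is_trajectory_def
proof (intro conjI allI impI U)
  show "AE (x, y) in M2. U 0 x y = W x y"
    using U0 by (auto simp: space_pair_measure intro!: AE_I2)
  fix t :: real assume t: "0 \<le> t"
  let ?q = "\<lambda>s x y. (U s x y - U t x y) / (s - t) - velocity M k (removal_rule F) (U t) x y"
  have ev: "\<forall>\<^sub>F s in at t within {0..}. 0 \<le> s \<and> s \<noteq> t" by (auto simp: eventually_at intro!: exI[of _ 1])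
  have m: "(\<lambda>(x, y). ereal \<bar>?q s x y\<bar>) \<in> borel_measurable M2" if "0 \<le> s" for s
    using kernel_measurable'[OF U[OF that]] kernel_measurable'[OF U[OF t]] velocity_measurable[OF U[OF t]]
    unfolding split_beta' by measurable
  have up: "Linf_norm M (?q s) \<le> ereal (C * \<bar>s - t\<bar>)" if s: "0 \<le> s" "s \<noteq> t" for s
    unfolding Linf_norm_def
  proof (rule esssup_I[OF m[OF s(1)] AE_I2], clarify)
    fix x y assume "(x, y) \<in> space M2"
    then have xy: "x \<in> space M" "y \<in> space M" by (auto simp: space_pair_measure)
    have "?q s x y = (U s x y - U t x y + (s - t) * removal_rate (U t) x y) / (s - t)"
      using s(2) velocity_removal_rule[OF F U[OF t] xy] by (simp add: add_divide_distrib)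
    also have "\<bar>\<dots>\<bar> \<le> C * (s - t)\<^sup>2 / \<bar>s - t\<bar>"
      unfolding abs_divide using C[OF s(1) t xy] by (intro divide_right_mono) auto
    also have "C * (s - t)\<^sup>2 = C * \<bar>s - t\<bar> * \<bar>s - t\<bar>" by (simp add: power2_eq_square)
    finally show "ereal \<bar>?q s x y\<bar> \<le> ereal (C * \<bar>s - t\<bar>)" using s(2) by simp
  qed
  \<comment> \<open>Over a null space an essential supremum would be negative infinity.
    \<open>M2\<close> has mass 1, so that of a function with non-negative values is at least
    0.\<close>
  have low: "0 \<le> Linf_norm M (?q s)" if "0 \<le> s" for s
  proof -
    interpret MM: prob_space M2 by (rule prob_space_pair)
    have "esssup M2 (\<lambda>_. 0 :: ereal) \<le> Linf_norm M (?q s)"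
      unfolding Linf_norm_def by (rule esssup_mono) auto
    then show ?thesis by (simp add: esssup_const MM.emeasure_space_1)
  qed
  have "((\<lambda>s. ereal (C * \<bar>s - t\<bar>)) \<longlongrightarrow> ereal (C * \<bar>t - t\<bar>)) (at t within {0..})"
    by (intro tendsto_intros)
  then have lim: "((\<lambda>s. ereal (C * \<bar>s - t\<bar>)) \<longlongrightarrow> 0) (at t within {0..})" by (simp add: zero_ereal_def)
  show "((\<lambda>s. Linf_norm M (?q s)) \<longlongrightarrow> 0) (at t within {0..})"
    by (rule tendsto_sandwich[OF _ _ tendsto_const lim])
      (use ev low up in \<open>auto elim: eventually_mono\<close>)
qed

text \<open>The exceptional null set may depend on \<open>s\<close>. The path at a fixed point is
  thus out of reach, and only integrals over all points can be followed in time.\<close>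

lemma trajectory_increment:
  assumes V: "is_trajectory M k (removal_rule F) W V" and t: "0 \<le> t" and e: "0 < e"
  shows "\<forall>\<^sub>F s in at t within {0..}. AE z in M2.
    \<bar>V s (fst z) (snd z) - V t (fst z) (snd z) + (s - t) * removal_rate (V t) (fst z) (snd z)\<bar> \<le> e * \<bar>s - t\<bar>"
proof -
  let ?q = "\<lambda>s x y. (V s x y - V t x y) / (s - t) - velocity M k (removal_rule F) (V t) x y"
  have Vt: "kernel M (V t)" using V t by (simp add: is_trajectory_def)
  have "((\<lambda>s. Linf_norm M (?q s)) \<longlongrightarrow> 0) (at t within {0..})" using V t by (simp add: is_trajectory_def)
  then have 1: "\<forall>\<^sub>F s in at t within {0..}. Linf_norm M (?q s) < ereal e"
    using e by (intro order_tendstoD(2)) auto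
  have 2: "\<forall>\<^sub>F s in at t within {0..}. s \<noteq> t" by (auto simp: eventually_at intro!: exI[of _ 1])
  show ?thesis using 1 2
  proof eventually_elim
    case (elim s)
    have "AE z in M2. (\<lambda>(x, y). ereal \<bar>?q s x y\<bar>) z \<le> Linf_norm M (?q s)"
      unfolding Linf_norm_def by (rule esssup_AE)
    then show ?case using AE_space
    proof eventually_elim
      case (elim z)
      have "ereal \<bar>?q s (fst z) (snd z)\<bar> < ereal e"
        using le_less_trans[OF elim(1) \<open>Linf_norm M (?q s) < ereal e\<close>] by (simp add: split_beta')
      moreover have "?q s (fst z) (snd z) = (V s (fst z) (snd z) - V t (fst z) (snd z) +
          (s - t) * removal_rate (V t) (fst z) (snd z)) / (s - t)"
        using \<open>s \<noteq> t\<close> velocity_removal_rule[OF F Vt, of "fst z" "snd z"] elim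
        by (simp add: space_pair_measure mem_Times_iff add_divide_distrib)
      ultimately show ?case using \<open>s \<noteq> t\<close> by (simp add: abs_divide pos_divide_less_eq)
    qed
  qed
qed

text \<open>\<open>kernel\<close> bounds each \<open>V s\<close> separately, with bounds that may
  grow without control in \<open>s\<close>. Differentiability gives a common bound almost everywhere
  near each time, and compactness of the interval extends it.\<close>

lemma trajectory_bounded:
  assumes V: "is_trajectory M k (removal_rule F) W V"
  shows "\<exists>B\<ge>1. \<forall>s\<in>{0..T}. AE z in M2. \<bar>V s (fst z) (snd z)\<bar> \<le> B"
proof (cases "0 \<le> T")
  case True
  define P where "P a b \<longleftrightarrow> (\<exists>B. \<forall>s\<in>{a..b}. 0 \<le> s \<longrightarrow> (AE z in M2. \<bar>V s (fst z) (snd z)\<bar> \<le> B))" for a b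
  have "P 0 T" using True
  proof (rule Bolzano)
    fix a b c :: real assume "P a b" "P b c" "a \<le> b" "b \<le> c"
    then obtain B1 B2 where B: "\<And>s. s \<in> {a..b} \<Longrightarrow> 0 \<le> s \<Longrightarrow> AE z in M2. \<bar>V s (fst z) (snd z)\<bar> \<le> B1"
      "\<And>s. s \<in> {b..c} \<Longrightarrow> 0 \<le> s \<Longrightarrow> AE z in M2. \<bar>V s (fst z) (snd z)\<bar> \<le> B2"
      unfolding P_def by blast
    have "AE z in M2. \<bar>V s (fst z) (snd z)\<bar> \<le> max B1 B2" if "s \<in> {a..c}" "0 \<le> s" for s
    proof (cases "s \<le> b")
      case True
      then show ?thesis using B(1)[of s] that by (auto elim!: eventually_mono)
    next
      case False
      then show ?thesis using B(2)[of s] that by (auto elim!: eventually_mono)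
    qed
    then show "P a c" unfolding P_def by blast
  next
    fix t :: real assume t: "0 \<le> t" "t \<le> T"
    have Vt: "kernel M (V t)" using V t by (simp add: is_trajectory_def)
    obtain B where B: "1 \<le> B" "\<And>x y. x \<in> space M \<Longrightarrow> y \<in> space M \<Longrightarrow> \<bar>V t x y\<bar> \<le> B"
      using kernel_bounded[OF Vt] by blast
    obtain R where R: "0 \<le> R" "\<And>z. z \<in> space M2 \<Longrightarrow> \<bar>removal_rate (V t) (fst z) (snd z)\<bar> \<le> R"
      using removal_rate_bounded[OF Vt] by blast
    \<comment> \<open>Increments with error factor 1 bound the kernels at all times near
      \<open>t\<close> by the kernel and the rate at time \<open>t\<close>.\<close>
    from trajectory_increment[OF V t(1), of 1] obtain d where d: "0 < d"
      "\<And>s. 0 \<le> s \<Longrightarrow> s \<noteq> t \<Longrightarrow> dist s t < d \<Longrightarrow> AE z in M2.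
        \<bar>V s (fst z) (snd z) - V t (fst z) (snd z) + (s - t) * removal_rate (V t) (fst z) (snd z)\<bar> \<le> 1 * \<bar>s - t\<bar>"
      by (auto simp: eventually_at)
    have "AE z in M2. \<bar>V s (fst z) (snd z)\<bar> \<le> B + d + d * R" if s: "0 \<le> s" "dist s t < d" for s
    proof (cases "s = t")
      case True
      have "\<bar>V t (fst z) (snd z)\<bar> \<le> B + d + d * R" if "z \<in> space M2" for z
        using B(2)[of "fst z" "snd z"] that d(1) R(1) by (auto simp: space_pair_measure intro: add_increasing2)
      then show ?thesis unfolding True by (intro AE_I2)
    next
      case False
      from d(2)[OF s(1) False s(2)] AE_space show ?thesis
      proof eventually_elim
        case (elim z)
        have "\<bar>(s - t) * removal_rate (V t) (fst z) (snd z)\<bar> \<le> d * R"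
          unfolding abs_mult using R(2)[OF elim(2)] s(2) d(1) by (intro mult_mono) (auto simp: dist_real_def)
        moreover have "\<bar>V t (fst z) (snd z)\<bar> \<le> B" using B(2) elim(2) by (auto simp: space_pair_measure)
        moreover have "\<bar>s - t\<bar> < d" using s(2) by (simp add: dist_real_def)
        moreover have "\<bar>v\<bar> \<le> B + d + c" if "\<bar>p\<bar> \<le> c" "\<bar>w\<bar> \<le> B" "h < d" "\<bar>v - w + p\<bar> \<le> 1 * h" for v w p c h :: real
          using that by linarith
        ultimately show ?case using elim(1) by blast
      qed
    qed
    then have "P a b" if "a \<le> t" "t \<le> b" "b - a < d" for a b
      unfolding P_def using that by (intro exI[of _ "B + d + d * R"]) (auto simp: dist_real_def)
    then show "\<exists>d>0. \<forall>a b. a \<le> t \<and> t \<le> b \<and> b - a < d \<longrightarrow> P a b" using d(1) by blast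
  qed
  then obtain B where B: "\<And>s. s \<in> {0..T} \<Longrightarrow> AE z in M2. \<bar>V s (fst z) (snd z)\<bar> \<le> B"
    unfolding P_def by (meson atLeastAtMost_iff)
  have "AE z in M2. \<bar>V s (fst z) (snd z)\<bar> \<le> max 1 B" if "s \<in> {0..T}" for s
    using B[OF that] by (auto elim!: eventually_mono)
  then show ?thesis by (intro exI[of _ "max 1 B"]) auto
qed (auto intro: exI[of _ 1])

text \<open>Gronwall for the squared distance in L2. The constant is finite because of the common
  bound on \<open>[0, T]\<close> from \<open>trajectory_bounded\<close>.\<close>

theorem trajectory_unique:
  assumes U: "is_trajectory M k (removal_rule F) W U" and V: "is_trajectory M k (removal_rule F) W V" and T: "0 \<le> T"
  shows "AE z in M2. V T (fst z) (snd z) = U T (fst z) (snd z)"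
proof -
  let ?E = "edge_pairs k F"
  have kU: "kernel M (U t)" and kV: "kernel M (V t)" if "0 \<le> t" for t
    using U V that by (auto simp: is_trajectory_def)
  define D where "D s z = U s (fst z) (snd z) - V s (fst z) (snd z)" for s z
  define D' where "D' t z = - (removal_rate (U t) (fst z) (snd z) - removal_rate (V t) (fst z) (snd z))" for t z
  define N where "N s = (\<integral>z. (D s z)\<^sup>2 \<partial>M2)" for s
  have Dm: "D s \<in> borel_measurable M2" if "0 \<le> s" for s
    unfolding D_def[abs_def] using kernel_measurable'[OF kU[OF that]] kernel_measurable'[OF kV[OF that]] by simp
  have Db: "\<exists>B. \<forall>z\<in>space M2. \<bar>D s z\<bar> \<le> B" if s: "0 \<le> s" for s
  proof -
    obtain B1 where B1: "\<And>x y. x \<in> space M \<Longrightarrow> y \<in> space M \<Longrightarrow> \<bar>U s x y\<bar> \<le> B1"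
      using kernel_bounded[OF kU[OF s]] by blast
    obtain B2 where B2: "\<And>x y. x \<in> space M \<Longrightarrow> y \<in> space M \<Longrightarrow> \<bar>V s x y\<bar> \<le> B2"
      using kernel_bounded[OF kV[OF s]] by blast
    have "\<bar>D s z\<bar> \<le> B1 + B2" if "z \<in> space M2" for z
      unfolding D_def using B1[of "fst z" "snd z"] B2[of "fst z" "snd z"] that
      by (simp add: space_pair_measure mem_Times_iff)
    then show ?thesis by blast
  qed
  have der: "(N has_real_derivative 2 * (\<integral>z. D t z * D' t z \<partial>M2)) (at t within {0..})" if t: "0 \<le> t" for t
  proof -
    obtain B1 where B1: "0 \<le> B1" "\<And>z. z \<in> space M2 \<Longrightarrow> \<bar>removal_rate (U t) (fst z) (snd z)\<bar> \<le> B1"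
      using removal_rate_bounded[OF kU[OF t]] by blast
    obtain B2 where B2: "0 \<le> B2" "\<And>z. z \<in> space M2 \<Longrightarrow> \<bar>removal_rate (V t) (fst z) (snd z)\<bar> \<le> B2"
      using removal_rate_bounded[OF kV[OF t]] by blast
    show ?thesis unfolding N_def[abs_def]
    proof (rule has_derivative_integral_square[OF prob_space_pair Dm Db _ _ t, where B'="B1 + B2"])
      show "D' t \<in> borel_measurable M2"
        unfolding D'_def[abs_def]
        using rate_measurable[OF edge_pairs_context kernel_measurable[OF kU[OF t]]]
          rate_measurable[OF edge_pairs_context kernel_measurable[OF kV[OF t]]] by simp
      show "\<bar>D' t z\<bar> \<le> B1 + B2" if "z \<in> space M2" for z
        using B1(2)[OF that] B2(2)[OF that] unfolding D'_def by linarith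
      fix e :: real assume "0 < e"
      then have e: "0 < e / 2" by simp
      from trajectory_increment[OF U t e] trajectory_increment[OF V t e]
      show "\<forall>\<^sub>F s in at t within {0..}. AE z in M2. \<bar>D s z - D t z - (s - t) * D' t z\<bar> \<le> e * \<bar>s - t\<bar>"
      proof eventually_elim
        case (elim s)
        then show ?case
        proof eventually_elim
          case (elim z)
          let ?p = "U s (fst z) (snd z) - U t (fst z) (snd z) + (s - t) * removal_rate (U t) (fst z) (snd z)"
          let ?q = "V s (fst z) (snd z) - V t (fst z) (snd z) + (s - t) * removal_rate (V t) (fst z) (snd z)"
          have "D s z - D t z - (s - t) * D' t z = ?p - ?q" by (simp add: D_def D'_def algebra_simps)
          moreover have "\<bar>?p - ?q\<bar> \<le> e / 2 * \<bar>s - t\<bar> + e / 2 * \<bar>s - t\<bar>"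
            using elim abs_triangle_ineq4[of ?p ?q] by linarith
          ultimately show ?case by simp
        qed
      qed
    qed
  qed
  obtain BU where BU: "BU \<ge> 1" "\<forall>s\<in>{0..T}. AE z in M2. \<bar>U s (fst z) (snd z)\<bar> \<le> BU"
    using trajectory_bounded[OF U] by blast
  obtain BV where BV: "BV \<ge> 1" "\<forall>s\<in>{0..T}. AE z in M2. \<bar>V s (fst z) (snd z)\<bar> \<le> BV"
    using trajectory_bounded[OF V] by blast
  define B where "B = max BU BV"
  \<comment> \<open>The factor 2 comes from differentiating the square.\<close>
  define c where "c = 2 * (real (card (?E \<union> ?E\<inverse>) * card ?E) * B ^ card ?E)"
  have le: "2 * (\<integral>z. D t z * D' t z \<partial>M2) \<le> c * N t" if t: "0 \<le> t" "t \<le> T" for t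
  proof -
    obtain B1 where "1 \<le> B1" and B1: "\<And>x y. x \<in> space M \<Longrightarrow> y \<in> space M \<Longrightarrow> \<bar>U t x y\<bar> \<le> B1"
      by (rule kernel_bounded[OF kU[OF t(1)]], rule that)
    obtain B2 where "1 \<le> B2" and B2: "\<And>x y. x \<in> space M \<Longrightarrow> y \<in> space M \<Longrightarrow> \<bar>V t x y\<bar> \<le> B2"
      by (rule kernel_bounded[OF kV[OF t(1)]], rule that)
    have "AE z in M2. \<bar>U t (fst z) (snd z)\<bar> \<le> BU" using BU(2) t by simp
    then have aU: "AE z in M2. \<bar>U t (fst z) (snd z)\<bar> \<le> B" by eventually_elim (simp add: B_def)
    have "AE z in M2. \<bar>V t (fst z) (snd z)\<bar> \<le> BV" using BV(2) t by simp
    then have aV: "AE z in M2. \<bar>V t (fst z) (snd z)\<bar> \<le> B" by eventually_elim (simp add: B_def)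
    have "1 \<le> B" using BU(1) by (simp add: B_def)
    have "\<bar>\<integral>z. (U t (fst z) (snd z) - V t (fst z) (snd z)) *
        (removal_rate (U t) (fst z) (snd z) - removal_rate (V t) (fst z) (snd z)) \<partial>M2\<bar> \<le>
      real (card (?E \<union> ?E\<inverse>) * card ?E) * B ^ card ?E * (\<integral>z. (U t (fst z) (snd z) - V t (fst z) (snd z))\<^sup>2 \<partial>M2)"
      by (rule rate_L2_lipschitz[OF edge_pairs_context kernel_measurable[OF kU[OF t(1)]]
        kernel_measurable[OF kV[OF t(1)]] _ _ \<open>1 \<le> B\<close> aU aV]) (fact B1, fact B2)
    moreover have "(\<integral>z. D t z * D' t z \<partial>M2) = - (\<integral>z. (U t (fst z) (snd z) - V t (fst z) (snd z)) *
        (removal_rate (U t) (fst z) (snd z) - removal_rate (V t) (fst z) (snd z)) \<partial>M2)"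
      unfolding D_def D'_def mult_minus_right by (rule Bochner_Integration.integral_minus)
    moreover have "c * N t = 2 * (real (card (?E \<union> ?E\<inverse>) * card ?E) * B ^ card ?E *
        (\<integral>z. (U t (fst z) (snd z) - V t (fst z) (snd z))\<^sup>2 \<partial>M2))"
      by (simp only: c_def N_def D_def mult.assoc)
    ultimately show ?thesis by linarith
  qed
  have N0: "N 0 = 0"
  proof -
    have "AE z in M2. U 0 (fst z) (snd z) = W (fst z) (snd z)" "AE z in M2. V 0 (fst z) (snd z) = W (fst z) (snd z)"
      using U V by (auto simp: is_trajectory_def split_beta')
    then have "AE z in M2. (D 0 z)\<^sup>2 = 0" by eventually_elim (simp add: D_def)
    then show ?thesis unfolding N_def by (rule integral_eq_zero_AE)
  qed
  have "N T = 0"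
    by (rule gronwall_zero[OF T N0 _ der le]) (auto simp: N_def)
  moreover have "integrable M2 (\<lambda>z. (D T z)\<^sup>2)"
  proof -
    obtain B where B: "\<And>z. z \<in> space M2 \<Longrightarrow> \<bar>D T z\<bar> \<le> B" using Db[OF T] by blast
    show ?thesis
    proof (rule integrable_bounded[OF prob_space_pair])
      show "\<bar>(D T z)\<^sup>2\<bar> \<le> B\<^sup>2" if "z \<in> space M2" for z
        using power_mono[OF B[OF that], of 2] by simp
    qed (use Dm[OF T] in simp)
  qed
  ultimately have "AE z in M2. (D T z)\<^sup>2 = 0"
    unfolding N_def by (subst (asm) integral_nonneg_eq_0_iff_AE) auto
  then show ?thesis by eventually_elim (simp add: D_def)
qed

end
end

section \<open>Destinations and uniform convergence\<close>

lemma DERIV_within_nonpos_imp_decreasing: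
  fixes g :: "real \<Rightarrow> real"
  assumes ab: "0 \<le> a" "a \<le> b"
    and g: "\<And>t. a \<le> t \<Longrightarrow> t \<le> b \<Longrightarrow> (g has_real_derivative g' t) (at t within {0..})"
    and g': "\<And>t. a \<le> t \<Longrightarrow> t \<le> b \<Longrightarrow> g' t \<le> 0"
  shows "g b \<le> g a"
proof (rule DERIV_nonpos_imp_decreasing_open[OF ab(2)])
  fix t assume t: "a < t" "t < b"
  have "at t within {0..} = at t" using t ab by (intro at_within_interior) (simp add: interior_real_atLeast)
  then show "\<exists>y. (g has_real_derivative y) (at t) \<and> y \<le> 0" using g[of t] g'[of t] t by auto
next
  show "continuous_on {a..b} g"
  proof (rule DERIV_continuous_on)
    show "(g has_real_derivative g' t) (at t within {a..b})" if "t \<in> {a..b}" for t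
      using that ab by (intro DERIV_subset[OF g]) auto
  qed
qed

lemma has_real_derivative_quadratic:
  fixes g :: "real \<Rightarrow> real"
  assumes "\<And>s. s \<in> S \<Longrightarrow> \<bar>g s - g t - (s - t) * d\<bar> \<le> K * (s - t)\<^sup>2"
  shows "(g has_real_derivative d) (at t within S)"
proof -
  have "((\<lambda>s. (g s - g t) / (s - t) - d) \<longlongrightarrow> 0) (at t within S)"
  proof (rule Lim_null_comparison)
    have "((\<lambda>s. K * \<bar>s - t\<bar>) \<longlongrightarrow> K * \<bar>t - t\<bar>) (at t within S)" by (intro tendsto_intros)
    then show "((\<lambda>s. K * \<bar>s - t\<bar>) \<longlongrightarrow> 0) (at t within S)" by simp
    have "\<forall>\<^sub>F s in at t within S. s \<in> S \<and> s \<noteq> t" by (auto simp: eventually_at intro!: exI[of _ 1])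
    then show "\<forall>\<^sub>F s in at t within S. norm ((g s - g t) / (s - t) - d) \<le> K * \<bar>s - t\<bar>"
    proof eventually_elim
      case (elim s)
      have "(g s - g t) / (s - t) - d = (g s - g t - (s - t) * d) / (s - t)"
        using elim by (simp add: diff_divide_distrib)
      then have "norm ((g s - g t) / (s - t) - d) = \<bar>g s - g t - (s - t) * d\<bar> / \<bar>s - t\<bar>" by simp
      also have "\<dots> \<le> K * (s - t)\<^sup>2 / \<bar>s - t\<bar>" using assms elim by (intro divide_right_mono) auto
      also have "K * (s - t)\<^sup>2 = K * \<bar>s - t\<bar> * \<bar>s - t\<bar>" by (simp add: power2_eq_square)
      finally show ?case using elim by simp
    qed
  qed
  then show ?thesis unfolding has_field_derivative_iff by (rule LIM_zero_cancel)
qed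

section \<open>Limits in the cut distance and in L1\<close>

context prob_space
begin

text \<open>Rectangles form a generator that is stable under intersections, and the sets with
  vanishing integral are closed under complements and countable disjoint unions. So the integral
  vanishes over every measurable set, in particular where \<open>f\<close> is positive and where it
  is negative.\<close>

lemma AE_eq_0_of_rectangles:
  fixes f :: "'a \<times> 'a \<Rightarrow> real"
  assumes f: "integrable M2 f"
    and rect: "\<And>S T. S \<in> sets M \<Longrightarrow> T \<in> sets M \<Longrightarrow> (LINT z:(S \<times> T)|M2. f z) = 0"
  shows "AE z in M2. f z = 0"
proof -
  have si: "set_integrable M2 A f" if "A \<in> sets M2" for A
    unfolding set_integrable_def using that f by (rule integrable_mult_indicator)
  have all: "(LINT z:A|M2. f z) = 0" if A: "A \<in> sets M2" for A
  proof -
    have sp: "(LINT z:space M \<times> space M|M2. f z) = 0" by (intro rect) auto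
    have "A \<in> sigma_sets (space M \<times> space M) {a \<times> b |a b. a \<in> sets M \<and> b \<in> sets M}"
      using A by (simp add: sets_pair_measure)
    then show ?thesis
    proof (induction rule: sigma_sets_induct_disjoint[OF Int_stable_pair_measure_generator pair_measure_closed, consumes 1, case_names basic empty compl union])
      case (basic A)
      then show ?case using rect by auto
    next
      case empty
      show ?case by (simp add: set_lebesgue_integral_def)
    next
      case (compl A)
      then have A: "A \<in> sets M2" by (simp add: sets_pair_measure)
      have "A \<subseteq> space M \<times> space M" using sets.sets_into_space[OF A] by (simp add: space_pair_measure)
      then have "A \<union> (space M \<times> space M - A) = space M \<times> space M" by auto
      moreover have "(LINT z:A \<union> (space M \<times> space M - A)|M2. f z) =
          (LINT z:A|M2. f z) + (LINT z:space M \<times> space M - A|M2. f z)"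
        using A by (intro set_integral_Un si) (auto simp: space_pair_measure[symmetric])
      ultimately show ?case using compl sp by simp
    next
      case (union A)
      have A: "A i \<in> sets M2" for i using union by (auto simp: sets_pair_measure)
      have "(LINT z:(\<Union>i. A i)|M2. f z) = (\<Sum>i. LINT z:A i|M2. f z)"
        using A union(1) by (intro lebesgue_integral_countable_add si) (auto simp: disjoint_family_on_def)
      then show ?case using union by simp
    qed
  qed
  have half: "AE z in M2. c * f z \<le> 0" for c
  proof -
    let ?A = "{z \<in> space M2. 0 < c * f z}"
    have [measurable]: "f \<in> borel_measurable M2" using f by auto
    have "(\<integral>z. max 0 (c * f z) \<partial>M2) = (\<integral>z. c * (indicator ?A z *\<^sub>R f z) \<partial>M2)"
      by (intro Bochner_Integration.integral_cong) (auto simp: indicator_def max_def)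
    also have "\<dots> = 0" using all[of ?A] by (simp add: set_lebesgue_integral_def)
    finally have "AE z in M2. max 0 (c * f z) = 0"
      using f by (subst (asm) integral_nonneg_eq_0_iff_AE) auto
    then show ?thesis by eventually_elim (metis max.cobounded2)
  qed
  from half[of 1] half[of "-1"] show ?thesis by eventually_elim simp
qed

lemma graphon_kernel: "graphon M W \<Longrightarrow> kernel M W"
  by (simp add: graphon_def)

lemma graphon_bounds: "graphon M W \<Longrightarrow> x \<in> space M \<Longrightarrow> y \<in> space M \<Longrightarrow> 0 \<le> W x y \<and> W x y \<le> 1"
  by (simp add: graphon_def)

lemma integrable_kernel:
  assumes "kernel M W"
  shows "integrable M2 (\<lambda>z. W (fst z) (snd z))"
proof -
  obtain B where "1 \<le> B" and B: "\<And>x y. x \<in> space M \<Longrightarrow> y \<in> space M \<Longrightarrow> \<bar>W x y\<bar> \<le> B"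
    by (rule kernel_bounded[OF assms], rule that)
  then show ?thesis
    by (intro integrable_bounded[OF prob_space_pair kernel_measurable'[OF assms], of B]) (auto simp: space_pair_measure)
qed

lemma cut_dist_bounds:
  assumes U: "kernel M U" and V: "kernel M V"
  shows "cut_dist M U V \<le> L1_norm M (\<lambda>x y. U x y - V x y)"
    and "S \<in> sets M \<Longrightarrow> T \<in> sets M \<Longrightarrow>
      \<bar>LINT z:(S \<times> T)|M2. U (fst z) (snd z) - V (fst z) (snd z)\<bar> \<le> cut_dist M U V"
    and "0 \<le> cut_dist M U V"
proof -
  let ?f = "\<lambda>z. U (fst z) (snd z) - V (fst z) (snd z)"
  have int: "integrable M2 ?f" using integrable_kernel U V by simp
  have le: "\<bar>LINT z:(S \<times> T)|M2. ?f z\<bar> \<le> L1_norm M (\<lambda>x y. U x y - V x y)"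
    if "S \<in> sets M" "T \<in> sets M" for S T
  proof -
    have i: "integrable M2 (\<lambda>z. indicator (S \<times> T) z *\<^sub>R ?f z)"
      using int that by (intro integrable_mult_indicator) auto
    have "\<bar>LINT z:(S \<times> T)|M2. ?f z\<bar> \<le> (\<integral>z. \<bar>indicator (S \<times> T) z *\<^sub>R ?f z\<bar> \<partial>M2)"
      unfolding set_lebesgue_integral_def by (rule integral_abs_bound)
    also have "\<dots> \<le> (\<integral>z. \<bar>?f z\<bar> \<partial>M2)"
      using int i by (intro Bochner_Integration.integral_mono integrable_abs) (auto simp: indicator_def)
    finally show ?thesis by (simp add: L1_norm_def)
  qed
  \<comment> \<open>A supremum of reals is known to bound its members only if they are bounded
    above.\<close>
  have bdd: "bdd_above ((\<lambda>(S, T). \<bar>LINT z:(S \<times> T)|M2. ?f z\<bar>) ` (sets M \<times> sets M))"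
    using le by (intro bdd_aboveI[of _ "L1_norm M (\<lambda>x y. U x y - V x y)"]) auto
  show "cut_dist M U V \<le> L1_norm M (\<lambda>x y. U x y - V x y)"
    unfolding cut_dist_def using le by (intro cSUP_least) auto
  show up: "\<bar>LINT z:(S \<times> T)|M2. ?f z\<bar> \<le> cut_dist M U V" if "S \<in> sets M" "T \<in> sets M" for S T
    unfolding cut_dist_def using cSUP_upper[OF _ bdd, of "(S, T)"] that by simp
  show "0 \<le> cut_dist M U V" using up[of "{}" "{}"] by simp
qed

text \<open>\<open>dest\<close> selects some graphon with the required limit. This identifies it,
  almost everywhere, with the limit constructed in \<open>decreasing_limit\<close>.\<close>

lemma cut_limit_unique:
  fixes V :: "real \<Rightarrow> 'a \<Rightarrow> 'a \<Rightarrow> real"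
  assumes V: "\<And>t. 0 \<le> t \<Longrightarrow> kernel M (V t)" and S: "kernel M S" and S': "kernel M S'"
    and lim: "((\<lambda>t. cut_dist M (V t) S) \<longlongrightarrow> 0) at_top" "((\<lambda>t. cut_dist M (V t) S') \<longlongrightarrow> 0) at_top"
  shows "AE z in M2. S (fst z) (snd z) = S' (fst z) (snd z)"
proof -
  have "AE z in M2. S (fst z) (snd z) - S' (fst z) (snd z) = 0"
  proof (rule AE_eq_0_of_rectangles)
    show "integrable M2 (\<lambda>z. S (fst z) (snd z) - S' (fst z) (snd z))"
      using integrable_kernel S S' by simp
    fix A B assume AB: "A \<in> sets M" "B \<in> sets M"
    let ?v = "LINT z:(A \<times> B)|M2. S (fst z) (snd z) - S' (fst z) (snd z)"
    have si: "set_integrable M2 (A \<times> B) (\<lambda>z. W (fst z) (snd z))" if "kernel M W" for W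
      unfolding set_integrable_def using AB by (intro integrable_mult_indicator integrable_kernel[OF that]) auto
    have le: "\<bar>?v\<bar> \<le> cut_dist M (V t) S + cut_dist M (V t) S'" if t: "0 \<le> t" for t
    proof -
      have "?v = (LINT z:(A \<times> B)|M2. V t (fst z) (snd z) - S' (fst z) (snd z)) -
         (LINT z:(A \<times> B)|M2. V t (fst z) (snd z) - S (fst z) (snd z))"
        using si[OF V[OF t]] si[OF S] si[OF S'] by (simp add: set_integral_diff)
      then show ?thesis
        using cut_dist_bounds(2)[OF V[OF t] S AB] cut_dist_bounds(2)[OF V[OF t] S' AB] by linarith
    qed
    have "((\<lambda>t. cut_dist M (V t) S + cut_dist M (V t) S') \<longlongrightarrow> 0 + 0) at_top" by (intro tendsto_add lim)
    moreover have "\<forall>\<^sub>F t in at_top. \<bar>?v\<bar> \<le> cut_dist M (V t) S + cut_dist M (V t) S'"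
      using eventually_ge_at_top[of 0] by eventually_elim (rule le)
    ultimately have "\<bar>?v\<bar> \<le> 0 + 0" by (intro tendsto_lowerbound) auto
    then show "?v = 0" by simp
  qed
  then show ?thesis by eventually_elim simp
qed

lemma L1_norm_cong_AE:
  assumes "kernel M U" "kernel M V" "kernel M U'" "kernel M V'"
    and "AE z in M2. U (fst z) (snd z) = U' (fst z) (snd z)" "AE z in M2. V (fst z) (snd z) = V' (fst z) (snd z)"
  shows "L1_norm M (\<lambda>x y. U x y - V x y) = L1_norm M (\<lambda>x y. U' x y - V' x y)"
  unfolding L1_norm_def
proof (rule integral_cong_AE)
  show "AE z in M2. \<bar>U (fst z) (snd z) - V (fst z) (snd z)\<bar> = \<bar>U' (fst z) (snd z) - V' (fst z) (snd z)\<bar>"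
    using assms(5,6) by eventually_elim simp
qed (use assms(1-4)[THEN kernel_measurable'] in simp_all)

text \<open>Bounded monotone paths converge in L1 by dominated convergence. That \<open>S\<close>
  lies below \<open>U t\<close> at every point makes the L1 distance a difference of
  integrals.\<close>

lemma decreasing_limit:
  fixes U :: "real \<Rightarrow> 'a \<Rightarrow> 'a \<Rightarrow> real"
  assumes U: "\<And>t. 0 \<le> t \<Longrightarrow> graphon M (U t)"
    and anti: "\<And>s t x y. 0 \<le> s \<Longrightarrow> s \<le> t \<Longrightarrow> x \<in> space M \<Longrightarrow> y \<in> space M \<Longrightarrow> U t x y \<le> U s x y"
  obtains S where "graphon M S"
    "\<And>t x y. 0 \<le> t \<Longrightarrow> x \<in> space M \<Longrightarrow> y \<in> space M \<Longrightarrow> S x y \<le> U t x y"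
    "((\<lambda>t. L1_norm M (\<lambda>x y. U t x y - S x y)) \<longlongrightarrow> 0) at_top"
proof -
  interpret MM: prob_space M2 by (rule prob_space_pair)
  \<comment> \<open>A limit along the integers preserves measurability; monotonicity carries the
    convergence over to real times.\<close>
  define S where "S x y = lim (\<lambda>n. U (real n) x y)" for x y
  have conv: "(\<lambda>n. U (real n) x y) \<longlonglongrightarrow> S x y" if xy: "x \<in> space M" "y \<in> space M" for x y
  proof -
    have "decseq (\<lambda>n. U (real n) x y)" using anti xy by (intro decseq_SucI) auto
    moreover have "\<forall>n. 0 \<le> U (real n) x y" using graphon_bounds[OF U xy] by simp
    ultimately have "convergent (\<lambda>n. U (real n) x y)" using decseq_convergent convergentI by metis
    then show ?thesis unfolding S_def by (simp add: convergent_LIMSEQ_iff)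
  qed
  have le: "S x y \<le> U t x y" if t: "0 \<le> t" and xy: "x \<in> space M" "y \<in> space M" for t x y
  proof (rule LIMSEQ_le_const2[OF conv[OF xy]], intro exI allI impI)
    fix n assume "nat \<lceil>t\<rceil> \<le> n"
    then have "t \<le> real n" by linarith
    then show "U (real n) x y \<le> U t x y" using anti[OF t _ xy] by blast
  qed
  have ge: "0 \<le> S x y" if xy: "x \<in> space M" "y \<in> space M" for x y
    using graphon_bounds[OF U xy] by (intro LIMSEQ_le_const[OF conv[OF xy]]) auto
  have Sm: "(\<lambda>(x, y). S x y) \<in> borel_measurable M2"
  proof -
    have "(\<lambda>z. U (real n) (fst z) (snd z)) \<in> borel_measurable M2" for n
      by (intro kernel_measurable' graphon_kernel U) simp
    from borel_measurable_lim_metric[OF this] show ?thesis by (simp add: S_def split_beta')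
  qed
  have sym: "S x y = S y x" if xy: "x \<in> space M" "y \<in> space M" for x y
  proof -
    have "U (real n) x y = U (real n) y x" for n
      using U[OF of_nat_0_le_iff[of n]] xy unfolding graphon_def kernel_def by blast
    then show ?thesis by (simp add: S_def)
  qed
  have S1: "S x y \<le> 1" if "x \<in> space M" "y \<in> space M" for x y
    using le[of 0 x y] graphon_bounds[OF U that, of 0] that by simp
  have gS: "graphon M S"
    unfolding graphon_def kernel_def
  proof (intro conjI ballI exI[of _ 1])
    show "\<bar>S x y\<bar> \<le> 1" if "x \<in> space M" "y \<in> space M" for x y using ge[OF that] S1[OF that] by simp
  qed (use Sm sym ge S1 in blast)+
  let ?d = "\<lambda>t z. U t (fst z) (snd z) - S (fst z) (snd z)"
  have int: "integrable M2 (?d t)" if "0 \<le> t" for t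
    using integrable_kernel graphon_kernel U[OF that] gS by simp
  have d0: "0 \<le> ?d t z" if "0 \<le> t" "z \<in> space M2" for t z
    using le that by (auto simp: space_pair_measure)
  have L1: "L1_norm M (\<lambda>x y. U t x y - S x y) = (\<integral>z. ?d t z \<partial>M2)" if "0 \<le> t" for t
    unfolding L1_norm_def using d0[OF that] by (intro Bochner_Integration.integral_cong) auto
  have "(\<lambda>n. \<integral>z. ?d (real n) z \<partial>M2) \<longlonglongrightarrow> (\<integral>z. 0 \<partial>M2)"
  proof (rule integral_dominated_convergence[where w="\<lambda>_. 1"])
    show "AE z in M2. (\<lambda>n. ?d (real n) z) \<longlonglongrightarrow> 0"
    proof (rule AE_I2)
      fix z assume "z \<in> space M2"
      then have "(\<lambda>n. ?d (real n) z) \<longlonglongrightarrow> S (fst z) (snd z) - S (fst z) (snd z)"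
        by (intro tendsto_diff conv tendsto_const) (auto simp: space_pair_measure)
      then show "(\<lambda>n. ?d (real n) z) \<longlonglongrightarrow> 0" by simp
    qed
    show "AE z in M2. norm (?d (real n) z) \<le> 1" for n
    proof (rule AE_I2)
      fix z assume z: "z \<in> space M2"
      then have "fst z \<in> space M" "snd z \<in> space M" by (auto simp: space_pair_measure)
      then show "norm (?d (real n) z) \<le> 1"
        using d0[of "real n" z] z ge[of "fst z" "snd z"] graphon_bounds[OF U, of "real n" "fst z" "snd z"] by simp
    qed
  qed (use int in auto)
  then have lim: "(\<lambda>n. \<integral>z. ?d (real n) z \<partial>M2) \<longlonglongrightarrow> 0" by simp
  have "((\<lambda>t. L1_norm M (\<lambda>x y. U t x y - S x y)) \<longlongrightarrow> 0) at_top"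
  proof (rule tendstoI)
    fix e :: real assume "0 < e"
    then obtain n where n: "(\<integral>z. ?d (real n) z \<partial>M2) < e"
      using order_tendstoD(2)[OF lim] by (auto simp: eventually_sequentially)
    show "\<forall>\<^sub>F t in at_top. dist (L1_norm M (\<lambda>x y. U t x y - S x y)) 0 < e"
      using eventually_ge_at_top[of "real n"]
    proof eventually_elim
      case (elim t)
      then have t: "0 \<le> t" by simp
      have "(\<integral>z. ?d t z \<partial>M2) \<le> (\<integral>z. ?d (real n) z \<partial>M2)"
        using int[OF t] int[of "real n"] anti[OF _ elim]
        by (intro Bochner_Integration.integral_mono) (auto simp: space_pair_measure)
      moreover have "0 \<le> (\<integral>z. ?d t z \<partial>M2)" using d0[OF t] by (intro Bochner_Integration.integral_nonneg)
      ultimately show ?case using n by (simp add: L1[OF t] dist_real_def)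
    qed
  qed
  then show ?thesis using that gS le by blast
qed

end

section \<open>Mass lost along the flow\<close>

context prob_space
begin

lemma integrable_mult_graphon:
  assumes \<phi>: "\<phi> \<in> borel_measurable M2" "\<And>z. z \<in> space M2 \<Longrightarrow> \<bar>\<phi> z\<bar> \<le> B" and U: "graphon M U"
  shows "integrable M2 (\<lambda>z. \<phi> z * U (fst z) (snd z))"
proof (rule integrable_bounded[OF prob_space_pair])
  show "(\<lambda>z. \<phi> z * U (fst z) (snd z)) \<in> borel_measurable M2"
    by (intro borel_measurable_times \<phi>(1) kernel_measurable' graphon_kernel U)
  show "\<bar>\<phi> z * U (fst z) (snd z)\<bar> \<le> B * 1" if z: "z \<in> space M2" for z
  proof -
    have "0 \<le> U (fst z) (snd z)" "U (fst z) (snd z) \<le> 1"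
      using graphon_bounds[OF U, of "fst z" "snd z"] z by (auto simp: space_pair_measure)
    then show ?thesis unfolding abs_mult using \<phi>(2)[OF z] by (intro mult_mono) auto
  qed
qed

context
  fixes I :: "'i set" and E :: "('i \<times> 'i) set" and U :: "real \<Rightarrow> 'a \<Rightarrow> 'a \<Rightarrow> real" and C :: real
  assumes I: "finite I" "E \<subseteq> I \<times> I" and irr: "\<And>i. (i, i) \<notin> E"
    and U: "\<And>t. 0 \<le> t \<Longrightarrow> graphon M (U t)"
    and anti: "\<And>s t x y. 0 \<le> s \<Longrightarrow> s \<le> t \<Longrightarrow> x \<in> space M \<Longrightarrow> y \<in> space M \<Longrightarrow> U t x y \<le> U s x y"
    and C: "\<And>s t x y. 0 \<le> s \<Longrightarrow> 0 \<le> t \<Longrightarrow> x \<in> space M \<Longrightarrow> y \<in> space M \<Longrightarrow>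
      \<bar>U s x y - U t x y + (s - t) * rate I E (U t) x y\<bar> \<le> C * (s - t)\<^sup>2"
begin

text \<open>The uniform quadratic error can be integrated against any bounded \<phi>. The constant 1
  gives the total mass; a weight that depends on \<open>A\<close> compares the total loss with the
  loss outside \<open>A\<close>.\<close>

lemma has_derivative_flow_integral:
  assumes \<phi>: "\<phi> \<in> borel_measurable M2" "\<And>z. z \<in> space M2 \<Longrightarrow> \<bar>\<phi> z\<bar> \<le> B" and t: "0 \<le> t"
  shows "((\<lambda>s. \<integral>z. \<phi> z * U s (fst z) (snd z) \<partial>M2) has_real_derivative
    - (\<Sum>(a, b)\<in>E \<union> E\<inverse>. \<integral>v. \<phi> (v a, v b) * hom_weight E (U t) v \<partial>Mpow I)) (at t within {0..})"
proof -
  interpret MM: prob_space M2 by (rule prob_space_pair)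
  let ?r = "\<lambda>z. rate I E (U t) (fst z) (snd z)"
  have U1: "\<bar>U t x y\<bar> \<le> 1" if "x \<in> space M" "y \<in> space M" for x y
    using graphon_bounds[OF U[OF t] that] by auto
  note r = integral_rate(1,2)[OF I irr kernel_measurable[OF graphon_kernel[OF U[OF t]]] order.refl U1 \<phi>]
  have iU: "integrable M2 (\<lambda>z. \<phi> z * U s (fst z) (snd z))" if "0 \<le> s" for s
    by (rule integrable_mult_graphon[OF \<phi> U[OF that]])
  show ?thesis
  proof (rule has_real_derivative_quadratic[where K="B * C"])
    fix s :: real assume "s \<in> {0..}"
    then have s: "0 \<le> s" by simp
    let ?q = "\<lambda>z. \<phi> z * U s (fst z) (snd z) - \<phi> z * U t (fst z) (snd z) + (s - t) * (\<phi> z * ?r z)"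
    have iq: "integrable M2 ?q" using iU[OF s] iU[OF t] r(2) by simp
    have eq: "(\<integral>z. \<phi> z * U s (fst z) (snd z) \<partial>M2) - (\<integral>z. \<phi> z * U t (fst z) (snd z) \<partial>M2) -
       (s - t) * - (\<Sum>(a, b)\<in>E \<union> E\<inverse>. \<integral>v. \<phi> (v a, v b) * hom_weight E (U t) v \<partial>Mpow I) = (\<integral>z. ?q z \<partial>M2)"
      using iU[OF s] iU[OF t] r by simp
    have "\<bar>\<integral>z. ?q z \<partial>M2\<bar> \<le> (\<integral>z. \<bar>?q z\<bar> \<partial>M2)" by (rule integral_abs_bound)
    also have "\<dots> \<le> B * C * (s - t)\<^sup>2"
    proof (rule MM.integral_le_const)
      show "integrable M2 (\<lambda>z. \<bar>?q z\<bar>)" using iq by (rule integrable_abs)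
      have "\<bar>?q z\<bar> \<le> B * C * (s - t)\<^sup>2" if z: "z \<in> space M2" for z
      proof -
        have "?q z = \<phi> z * (U s (fst z) (snd z) - U t (fst z) (snd z) + (s - t) * ?r z)"
          by (simp add: algebra_simps)
        also have "\<bar>\<dots>\<bar> \<le> B * (C * (s - t)\<^sup>2)"
          unfolding abs_mult using \<phi>(2)[OF z] C[OF s t, of "fst z" "snd z"] z
          by (intro mult_mono) (auto simp: space_pair_measure)
        finally show ?thesis by (simp add: mult.assoc)
      qed
      then show "AE z in M2. \<bar>?q z\<bar> \<le> B * C * (s - t)\<^sup>2" by (rule AE_I2)
    qed
    finally show "\<bar>(\<integral>z. \<phi> z * U s (fst z) (snd z) \<partial>M2) - (\<integral>z. \<phi> z * U t (fst z) (snd z) \<partial>M2) -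
       (s - t) * - (\<Sum>(a, b)\<in>E \<union> E\<inverse>. \<integral>v. \<phi> (v a, v b) * hom_weight E (U t) v \<partial>Mpow I)\<bar> \<le> B * C * (s - t)\<^sup>2"
      unfolding eq .
  qed
qed

lemma integrable_hom_weight_flow:
  assumes "0 \<le> t" shows "integrable (Mpow I) (hom_weight E (U t))"
proof (rule integrable_bounded[OF prob_space_power])
  show "hom_weight E (U t) \<in> borel_measurable (Mpow I)"
    using graphon_kernel[OF U[OF assms]] by (intro hom_weight_measurable I kernel_measurable)
  show "\<bar>hom_weight E (U t) v\<bar> \<le> 1" if "v \<in> space (Mpow I)" for v
    using hom_weight_01[OF graphon_bounds[OF U[OF assms]] that I(2)] by simp
qed

lemma hom_weight_flow_antimono:
  assumes "0 \<le> s" "s \<le> t" and v: "v \<in> space (Mpow I)"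
  shows "hom_weight E (U t) v \<le> hom_weight E (U s) v"
  unfolding hom_weight_def
proof (rule prod_mono)
  fix e assume "e \<in> E"
  then have "v (fst e) \<in> space M" "v (snd e) \<in> space M"
    using v I(2) by (auto simp: space_PiM PiE_def Pi_iff)
  then show "0 \<le> (case e of (i, j) \<Rightarrow> U t (v i) (v j)) \<and>
      (case e of (i, j) \<Rightarrow> U t (v i) (v j)) \<le> (case e of (i, j) \<Rightarrow> U s (v i) (v j))"
    using graphon_bounds[OF U, of t] anti[OF assms(1,2)] assms(1,2) by (auto simp: split_beta')
qed

lemma hom_density_decay:
  assumes T: "0 \<le> T"
  shows "T * (card (E \<union> E\<inverse>) * (\<integral>v. hom_weight E (U T) v \<partial>Mpow I)) \<le> 1"
proof -
  interpret MM: prob_space M2 by (rule prob_space_pair)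
  define h where "h t = (\<integral>v. hom_weight E (U t) v \<partial>Mpow I)" for t
  let ?m = "real (card (E \<union> E\<inverse>))"
  \<comment> \<open>Until time \<open>T\<close> the density is at least \<open>h T\<close>, so the
    mass decreases at a rate of at least \<open>?m * h T\<close>. The linear term compensates for
    this, and the sum still does not increase.\<close>
  let ?g = "\<lambda>t. (\<integral>z. 1 * U t (fst z) (snd z) \<partial>M2) + ?m * h T * t"
  have "?g T \<le> ?g 0"
  proof (rule DERIV_within_nonpos_imp_decreasing[of 0 T ?g "\<lambda>t. - (?m * h t) + ?m * h T"])
    fix t assume t: "0 \<le> t" "t \<le> T"
    have "((\<lambda>s. \<integral>z. 1 * U s (fst z) (snd z) \<partial>M2) has_real_derivative
      - (\<Sum>(a, b)\<in>E \<union> E\<inverse>. \<integral>v. 1 * hom_weight E (U t) v \<partial>Mpow I)) (at t within {0..})"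
      using t by (intro has_derivative_flow_integral[where \<phi>="\<lambda>_. 1" and B=1]) auto
    then have "((\<lambda>s. \<integral>z. 1 * U s (fst z) (snd z) \<partial>M2) has_real_derivative - (?m * h t)) (at t within {0..})"
      by (simp add: h_def split_beta')
    then show "(?g has_real_derivative - (?m * h t) + ?m * h T) (at t within {0..})"
      by (intro DERIV_add) (auto intro!: derivative_eq_intros)
    have "h T \<le> h t" unfolding h_def using t T
      by (intro Bochner_Integration.integral_mono integrable_hom_weight_flow hom_weight_flow_antimono) auto
    then show "- (?m * h t) + ?m * h T \<le> 0" by (simp add: mult_left_mono)
  qed (use T in auto)
  moreover have "(\<integral>z. 1 * U 0 (fst z) (snd z) \<partial>M2) \<le> 1"
    using integrable_kernel[OF graphon_kernel[OF U]] graphon_bounds[OF U]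
    by (intro MM.integral_le_const) (auto simp: space_pair_measure intro!: AE_I2)
  moreover have "0 \<le> (\<integral>z. 1 * U T (fst z) (snd z) \<partial>M2)"
    using graphon_bounds[OF U] T by (intro Bochner_Integration.integral_nonneg) (auto simp: space_pair_measure)
  ultimately have "?m * h T * T \<le> 1" by linarith
  then show ?thesis by (simp add: h_def mult_ac)
qed

text \<open>Every copy removed after time \<open>T\<close> uses an edge outside \<open>A\<close>, so the total loss is at most the
  number of oriented edges times the loss outside \<open>A\<close>.\<close>

lemma flow_loss_le:
  assumes T: "0 \<le> T" "T \<le> t" and A: "A \<in> sets M2"
    and free: "\<And>v. v \<in> space (Mpow I) \<Longrightarrow> \<exists>(i, j)\<in>E. (v i, v j) \<notin> A"
  shows "(\<integral>z. U T (fst z) (snd z) \<partial>M2) - (\<integral>z. U t (fst z) (snd z) \<partial>M2) \<le>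
    card (E \<union> E\<inverse>) * (\<integral>z. U T (fst z) (snd z) * indicator (- A) z \<partial>M2)"
proof -
  let ?m = "real (card (E \<union> E\<inverse>))" and ?P = "Mpow I"
  \<comment> \<open>Weighted with this \<phi>, the mass is \<open>?m\<close> times the mass outside
    \<open>A\<close> minus the total mass. That it does not increase says exactly that the total
    loss is at most \<open>?m\<close> times the loss outside \<open>A\<close>.\<close>
  define \<phi> where "\<phi> z = ?m * indicator (- A) z - 1" for z :: "'a \<times> 'a"
  have ind: "indicator (- A) z = (1 - indicator A z :: real)" for z by (simp add: indicator_def)
  have \<phi>m: "\<phi> \<in> borel_measurable M2" unfolding \<phi>_def[abs_def] ind using A by measurable
  have \<phi>b: "\<bar>\<phi> z\<bar> \<le> ?m + 1" for z by (auto simp: \<phi>_def indicator_def)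
  have split: "(\<integral>z. \<phi> z * U s (fst z) (snd z) \<partial>M2) =
      ?m * (\<integral>z. U s (fst z) (snd z) * indicator (- A) z \<partial>M2) - (\<integral>z. U s (fst z) (snd z) \<partial>M2)"
    if s: "0 \<le> s" for s
  proof -
    have i: "integrable M2 (\<lambda>z. U s (fst z) (snd z))" by (rule integrable_kernel[OF graphon_kernel[OF U[OF s]]])
    have "integrable M2 (\<lambda>z. indicator (- A) z * U s (fst z) (snd z))"
      unfolding ind using A by (intro integrable_mult_graphon[where B=1] U s) (auto simp: indicator_def)
    then have i': "integrable M2 (\<lambda>z. U s (fst z) (snd z) * indicator (- A) z)"
      by (simp add: mult.commute)
    have "\<phi> z * U s (fst z) (snd z) = ?m * (U s (fst z) (snd z) * indicator (- A) z) - U s (fst z) (snd z)" for z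
      by (simp add: \<phi>_def algebra_simps)
    then show ?thesis using i i' by (simp only: Bochner_Integration.integral_diff integrable_mult_right integral_mult_right_zero)
  qed
  have "(\<integral>z. \<phi> z * U t (fst z) (snd z) \<partial>M2) \<le> (\<integral>z. \<phi> z * U T (fst z) (snd z) \<partial>M2)"
  proof (rule DERIV_within_nonpos_imp_decreasing[OF T])
    fix s assume "T \<le> s" "s \<le> t"
    then have s: "0 \<le> s" using T by simp
    show "((\<lambda>s. \<integral>z. \<phi> z * U s (fst z) (snd z) \<partial>M2) has_real_derivative
      - (\<Sum>(a, b)\<in>E \<union> E\<inverse>. \<integral>v. \<phi> (v a, v b) * hom_weight E (U s) v \<partial>?P)) (at s within {0..})"
      by (rule has_derivative_flow_integral[OF \<phi>m \<phi>b s])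
    have U1: "\<bar>U s x y\<bar> \<le> 1" if "x \<in> space M" "y \<in> space M" for x y
      using graphon_bounds[OF U[OF s] that] by auto
    have int: "integrable ?P (\<lambda>v. \<phi> (v (fst e), v (snd e)) * hom_weight E (U s) v)" if "e \<in> E \<union> E\<inverse>" for e
      using integral_rate(3)[OF I irr kernel_measurable[OF graphon_kernel[OF U[OF s]]] order.refl U1 \<phi>m \<phi>b, of "fst e" "snd e"] that
      by simp
    have "0 \<le> (\<integral>v. (\<Sum>e\<in>E \<union> E\<inverse>. \<phi> (v (fst e), v (snd e)) * hom_weight E (U s) v) \<partial>?P)"
    proof (rule Bochner_Integration.integral_nonneg)
      fix v assume v: "v \<in> space ?P"
      \<comment> \<open>There are \<open>?m\<close> oriented edges and at least one of them is
        outside \<open>A\<close>, so the values of \<phi> at the edges of a copy add up to at least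
        \<open>?m * 1 - ?m\<close>, which is 0.\<close>
      obtain i j where ij: "(i, j) \<in> E" "(v i, v j) \<notin> A" using free[OF v] by auto
      have "1 \<le> (\<Sum>e\<in>E \<union> E\<inverse>. indicator (- A) (v (fst e), v (snd e)) :: real)"
        using member_le_sum[of "(i, j)" "E \<union> E\<inverse>" "\<lambda>e. indicator (- A) (v (fst e), v (snd e)) :: real"]
          ij finite_edges(2)[OF I irr] by simp
      then have "?m * 1 \<le> ?m * (\<Sum>e\<in>E \<union> E\<inverse>. indicator (- A) (v (fst e), v (snd e)))"
        by (intro mult_left_mono) auto
      then have "0 \<le> (\<Sum>e\<in>E \<union> E\<inverse>. \<phi> (v (fst e), v (snd e)))"
        by (simp add: \<phi>_def sum_subtractf sum_distrib_left)
      moreover have "0 \<le> hom_weight E (U s) v"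
        using hom_weight_01[OF graphon_bounds[OF U[OF s]] v I(2)] by simp
      ultimately show "0 \<le> (\<Sum>e\<in>E \<union> E\<inverse>. \<phi> (v (fst e), v (snd e)) * hom_weight E (U s) v)"
        unfolding sum_distrib_right[symmetric] by (rule mult_nonneg_nonneg)
    qed
    then show "- (\<Sum>(a, b)\<in>E \<union> E\<inverse>. \<integral>v. \<phi> (v a, v b) * hom_weight E (U s) v \<partial>?P) \<le> 0"
      using int by (subst (asm) Bochner_Integration.integral_sum) (auto simp: split_beta')
  qed
  \<comment> \<open>What remains outside \<open>A\<close> at time \<open>t\<close> is not negative
    and is dropped, so that the bound refers to time \<open>T\<close> alone.\<close>
  moreover have "0 \<le> ?m * (\<integral>z. U t (fst z) (snd z) * indicator (- A) z \<partial>M2)"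
    using graphon_bounds[OF U] T
    by (intro mult_nonneg_nonneg Bochner_Integration.integral_nonneg) (auto simp: space_pair_measure)
  ultimately show ?thesis using split[of T] split[of t] T by simp
qed

end

text \<open>Replaces the selected \<open>flow\<close> and \<open>dest\<close> by a concrete
  decreasing path \<open>U\<close> and its limit \<open>S\<close>. The L1 distance can be
  transferred because it does not see null sets.\<close>

lemma removal_flow_dest:
  assumes F: "F \<in> graphs k" and W: "graphon M W"
  obtains U S C where "\<And>t. 0 \<le> t \<Longrightarrow> graphon M (U t)" "graphon M S"
    "\<And>s t x y. 0 \<le> s \<Longrightarrow> s \<le> t \<Longrightarrow> x \<in> space M \<Longrightarrow> y \<in> space M \<Longrightarrow> U t x y \<le> U s x y"
    "\<And>s t x y. 0 \<le> s \<Longrightarrow> 0 \<le> t \<Longrightarrow> x \<in> space M \<Longrightarrow> y \<in> space M \<Longrightarrow>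
      \<bar>U s x y - U t x y + (s - t) * rate {1..k} (edge_pairs k F) (U t) x y\<bar> \<le> C * (s - t)\<^sup>2"
    "\<And>t x y. 0 \<le> t \<Longrightarrow> x \<in> space M \<Longrightarrow> y \<in> space M \<Longrightarrow> S x y \<le> U t x y"
    "((\<lambda>t. L1_norm M (\<lambda>x y. U t x y - S x y)) \<longlongrightarrow> 0) at_top"
    "\<And>t. 0 \<le> t \<Longrightarrow> L1_norm M (\<lambda>x y. flow M k (removal_rule F) t W x y - dest M k (removal_rule F) W x y) =
      L1_norm M (\<lambda>x y. U t x y - S x y)"
proof -
  let ?R = "removal_rule F"
  obtain U C where U: "\<And>t. 0 \<le> t \<Longrightarrow> graphon M (U t)"
    and U0: "\<And>x y. x \<in> space M \<Longrightarrow> y \<in> space M \<Longrightarrow> U 0 x y = W x y"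
    and anti: "\<And>s t x y. 0 \<le> s \<Longrightarrow> s \<le> t \<Longrightarrow> x \<in> space M \<Longrightarrow> y \<in> space M \<Longrightarrow> U t x y \<le> U s x y"
    and C: "\<And>s t x y. 0 \<le> s \<Longrightarrow> 0 \<le> t \<Longrightarrow> x \<in> space M \<Longrightarrow> y \<in> space M \<Longrightarrow>
      \<bar>U s x y - U t x y + (s - t) * rate {1..k} (edge_pairs k F) (U t) x y\<bar> \<le> C * (s - t)\<^sup>2"
    by (rule removal_flow_exists[OF finite_atLeastAtMost edge_pairs_subset edge_pairs_irrefl W], rule that)
  obtain S where S: "graphon M S"
    and le: "\<And>t x y. 0 \<le> t \<Longrightarrow> x \<in> space M \<Longrightarrow> y \<in> space M \<Longrightarrow> S x y \<le> U t x y"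
    and lim: "((\<lambda>t. L1_norm M (\<lambda>x y. U t x y - S x y)) \<longlongrightarrow> 0) at_top"
    by (rule decreasing_limit[of U], rule U, assumption, rule anti, assumption+, rule that)
  have tU: "is_trajectory M k ?R W U"
    using graphon_kernel[OF U] U0 C by (intro is_trajectory_removal[OF F]) auto
  \<comment> \<open>That \<open>U\<close> is a trajectory makes this selection a trajectory too;
    uniqueness then gives agreement with \<open>U\<close> almost everywhere at each single
    time.\<close>
  define V where "V = (SOME U. is_trajectory M k ?R W U)"
  have tV: "is_trajectory M k ?R W V" unfolding V_def by (rule someI[of _ U]) (rule tU)
  have flow: "flow M k ?R t W = V t" for t by (simp add: flow_def V_def)
  have kU: "kernel M (U t)" and kV: "kernel M (V t)" if "0 \<le> t" for t
    using graphon_kernel[OF U[OF that]] tV that by (auto simp: is_trajectory_def)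
  have eqV: "AE z in M2. V t (fst z) (snd z) = U t (fst z) (snd z)" if "0 \<le> t" for t
    by (rule trajectory_unique[OF F tU tV that])
  have limS: "((\<lambda>t. cut_dist M (V t) S) \<longlongrightarrow> 0) at_top"
  proof (rule tendsto_sandwich[OF _ _ tendsto_const lim])
    show "\<forall>\<^sub>F t in at_top. 0 \<le> cut_dist M (V t) S"
      using eventually_ge_at_top[of 0] by eventually_elim (intro cut_dist_bounds kV graphon_kernel[OF S])
    show "\<forall>\<^sub>F t in at_top. cut_dist M (V t) S \<le> L1_norm M (\<lambda>x y. U t x y - S x y)"
      using eventually_ge_at_top[of 0]
    proof eventually_elim
      case (elim t)
      have "L1_norm M (\<lambda>x y. V t x y - S x y) = L1_norm M (\<lambda>x y. U t x y - S x y)"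
        using kU kV graphon_kernel[OF S] eqV elim by (intro L1_norm_cong_AE) auto
      then show ?case using cut_dist_bounds(1)[OF kV[OF elim] graphon_kernel[OF S]] by simp
    qed
  qed
  define D where "D = dest M k ?R W"
  have D: "graphon M D \<and> ((\<lambda>t. cut_dist M (V t) D) \<longlongrightarrow> 0) at_top"
    unfolding D_def dest_def flow by (rule someI[of _ S]) (use S limS in simp)
  have eqD: "AE z in M2. D (fst z) (snd z) = S (fst z) (snd z)"
    using D limS by (intro cut_limit_unique[OF kV] graphon_kernel S) auto
  have eq: "L1_norm M (\<lambda>x y. flow M k ?R t W x y - dest M k ?R W x y) = L1_norm M (\<lambda>x y. U t x y - S x y)"
    if "0 \<le> t" for t
    unfolding flow D_def[symmetric]
    using kU[OF that] kV[OF that] graphon_kernel[OF S] graphon_kernel[of D] D eqV[OF that] eqD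
    by (intro L1_norm_cong_AE) auto
  show ?thesis
    by (rule that[of U S C]) (fact U, fact S, fact anti, fact C, fact le, fact lim, fact eq)
qed

theorem removal_flow_uniform_convergence:
  assumes F: "F \<in> graphs k" and card: "card F > 0" and \<epsilon>: "\<epsilon> > 0"
  shows "\<exists>T\<ge>0. \<forall>W. graphon M W \<longrightarrow>
    L1_norm M (\<lambda>x y. flow M k (removal_rule F) T W x y - dest M k (removal_rule F) W x y) < \<epsilon>"
proof -
  let ?E = "edge_pairs k F" and ?I = "{1..k}"
  define m where "m = real (card (?E \<union> ?E\<inverse>))"
  note ctx = finite_atLeastAtMost[of 1 k] edge_pairs_subset[of k F] edge_pairs_irrefl[of _ k F]
  have "?E \<noteq> {}" using graph_eq_image_edge_pairs[OF F] card by auto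
  then have "card (?E \<union> ?E\<inverse>) > 0" using finite_edges(2)[OF ctx] by (auto simp: card_gt_0_iff)
  then have m: "m \<ge> 1" by (simp add: m_def)
  \<comment> \<open>The loss after \<open>T\<close> will be at most \<open>m\<close> times the mass
    outside \<open>A\<close>, so this share keeps it at most \<epsilon> / 2.\<close>
  have "\<epsilon> / (2 * m) > 0" using \<epsilon> m by simp
  then obtain \<delta> where \<delta>: "\<delta> > 0" "\<forall>W. graphon M W \<longrightarrow> (\<integral>v. hom_weight ?E W v \<partial>Mpow ?I) < \<delta> \<longrightarrow>
    (\<exists>A\<in>sets M2. (\<integral>z. W (fst z) (snd z) * indicator (- A) z \<partial>M2) < \<epsilon> / (2 * m) \<and>
      (\<forall>v\<in>space (Mpow ?I). \<exists>(i, j)\<in>?E. (v i, v j) \<notin> A))"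
    using removal_lemma[OF ctx edge_pairs_asym] by blast
  \<comment> \<open>At time \<open>T\<close> the density is at most \<open>1 / (T * m)\<close>,
    hence at most \<delta> / 2; the factor 2 provides the strict inequality that the removal lemma
    asks for.\<close>
  define T where "T = 2 / \<delta>"
  have T: "T > 0" using \<delta> by (simp add: T_def)
  have "L1_norm M (\<lambda>x y. flow M k (removal_rule F) T W x y - dest M k (removal_rule F) W x y) < \<epsilon>"
    if W: "graphon M W" for W
  proof -
    obtain U S C where U: "\<And>t. 0 \<le> t \<Longrightarrow> graphon M (U t)" and S: "graphon M S"
      and anti: "\<And>s t x y. 0 \<le> s \<Longrightarrow> s \<le> t \<Longrightarrow> x \<in> space M \<Longrightarrow> y \<in> space M \<Longrightarrow> U t x y \<le> U s x y"
      and C: "\<And>s t x y. 0 \<le> s \<Longrightarrow> 0 \<le> t \<Longrightarrow> x \<in> space M \<Longrightarrow> y \<in> space M \<Longrightarrow>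
        \<bar>U s x y - U t x y + (s - t) * rate {1..k} (edge_pairs k F) (U t) x y\<bar> \<le> C * (s - t)\<^sup>2"
      and le: "\<And>t x y. 0 \<le> t \<Longrightarrow> x \<in> space M \<Longrightarrow> y \<in> space M \<Longrightarrow> S x y \<le> U t x y"
      and lim: "((\<lambda>t. L1_norm M (\<lambda>x y. U t x y - S x y)) \<longlongrightarrow> 0) at_top"
      and eq: "\<And>t. 0 \<le> t \<Longrightarrow> L1_norm M (\<lambda>x y. flow M k (removal_rule F) t W x y - dest M k (removal_rule F) W x y) =
        L1_norm M (\<lambda>x y. U t x y - S x y)"
      by (rule removal_flow_dest[OF F W], rule that)
    define h where "h = (\<integral>v. hom_weight ?E (U T) v \<partial>Mpow ?I)"
    have h0: "0 \<le> h" unfolding h_def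
      using hom_weight_01(1)[OF graphon_bounds[OF U[OF less_imp_le[OF T]]] _ edge_pairs_subset]
      by (intro Bochner_Integration.integral_nonneg)
    have "T * (m * h) \<le> 1" unfolding m_def h_def
      by (rule hom_density_decay[OF ctx]) (fact U, fact anti, fact C, use T in simp)
    moreover have "T * h \<le> T * (m * h)" using T m h0 mult_right_mono[OF m h0] by (intro mult_left_mono) auto
    ultimately have "h < \<delta>" using \<delta>(1) by (simp add: T_def divide_simps)
    have "\<exists>A\<in>sets M2. (\<integral>z. U T (fst z) (snd z) * indicator (- A) z \<partial>M2) < \<epsilon> / (2 * m) \<and>
      (\<forall>v\<in>space (Mpow ?I). \<exists>(i, j)\<in>?E. (v i, v j) \<notin> A)"
      using \<delta>(2) U[of T] T \<open>h < \<delta>\<close> unfolding h_def by simp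
    then obtain A where A: "A \<in> sets M2"
      "(\<integral>z. U T (fst z) (snd z) * indicator (- A) z \<partial>M2) < \<epsilon> / (2 * m)"
      "\<And>v. v \<in> space (Mpow ?I) \<Longrightarrow> \<exists>(i, j)\<in>?E. (v i, v j) \<notin> A"
      by blast
    have i: "integrable M2 (\<lambda>z. V (fst z) (snd z))" if "graphon M V" for V
      by (rule integrable_kernel[OF graphon_kernel[OF that]])
    have L1: "L1_norm M (\<lambda>x y. U t x y - S x y) =
        (\<integral>z. U t (fst z) (snd z) \<partial>M2) - (\<integral>z. S (fst z) (snd z) \<partial>M2)" if t: "0 \<le> t" for t
    proof -
      have "L1_norm M (\<lambda>x y. U t x y - S x y) = (\<integral>z. U t (fst z) (snd z) - S (fst z) (snd z) \<partial>M2)"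
        unfolding L1_norm_def using le[OF t]
        by (intro Bochner_Integration.integral_cong) (auto simp: space_pair_measure)
      then show ?thesis using i[OF U[OF t]] i[OF S] by simp
    qed
    have "L1_norm M (\<lambda>x y. U T x y - S x y) - L1_norm M (\<lambda>x y. U t x y - S x y) \<le> \<epsilon> / 2" if t: "T \<le> t" for t
    proof -
      have "L1_norm M (\<lambda>x y. U T x y - S x y) - L1_norm M (\<lambda>x y. U t x y - S x y) \<le>
        m * (\<integral>z. U T (fst z) (snd z) * indicator (- A) z \<partial>M2)"
      proof -
        have "(\<integral>z. U T (fst z) (snd z) \<partial>M2) - (\<integral>z. U t (fst z) (snd z) \<partial>M2) \<le>
            m * (\<integral>z. U T (fst z) (snd z) * indicator (- A) z \<partial>M2)"
          unfolding m_def
          by (rule flow_loss_le[OF ctx]) (fact U, fact anti, fact C, use T in simp, fact t, fact A(1), fact A(3))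
        then show ?thesis using L1[of T] L1[of t] T t by simp
      qed
      also have "\<dots> \<le> m * (\<epsilon> / (2 * m))" using A(2) m by (intro mult_left_mono) auto
      also have "\<dots> = \<epsilon> / 2" using m by simp
      finally show ?thesis .
    qed
    \<comment> \<open>As \<open>t\<close> tends to infinity, the loss between \<open>T\<close> and
      \<open>t\<close> becomes the distance to the destination. A limit keeps only the weak
      inequality, hence \<epsilon> / 2 instead of \<epsilon>.\<close>
    then have "\<forall>\<^sub>F t in at_top. L1_norm M (\<lambda>x y. U T x y - S x y) - L1_norm M (\<lambda>x y. U t x y - S x y) \<le> \<epsilon> / 2"
      by (rule eventually_at_top_linorderI)
    moreover have "((\<lambda>t. L1_norm M (\<lambda>x y. U T x y - S x y) - L1_norm M (\<lambda>x y. U t x y - S x y)) \<longlongrightarrow>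
        L1_norm M (\<lambda>x y. U T x y - S x y) - 0) at_top"
      by (intro tendsto_diff tendsto_const lim)
    ultimately have "L1_norm M (\<lambda>x y. U T x y - S x y) - 0 \<le> \<epsilon> / 2"
      by (intro tendsto_upperbound[of _ _ at_top]) auto
    then show ?thesis using eq[of T] T \<epsilon> by simp
  qed
  then show ?thesis using T by (intro exI[of _ T]) auto
qed

end

theorem theorem10p9:
  fixes M :: "'a measure" and k :: nat and F :: "nat set set"
  assumes "prob_space M"
    and "atomless M"
    and "separable_sigma_algebra M"
    and "F \<in> graphs k"
    and "card F > 0"
  shows "\<forall>\<epsilon>::real. \<epsilon> > 0 \<longrightarrow> (\<exists>T\<ge>0. \<forall>W. graphon M W \<longrightarrow>
           L1_norm M (\<lambda>x y. flow M k (removal_rule F) T W x y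
                            - dest M k (removal_rule F) W x y) < \<epsilon>)"
  using prob_space.removal_flow_uniform_convergence[OF assms(1,4,5)] by blast

end
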